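(* Let $r,m\in\mathbb{Z}_{\ge 0}$ with $r+k\ge m+1$. For $v\in V_b^{\mathrm{symp}}$ put $\alpha_v:=\langle v,F^n(v)\rangle\in\breve K^\times$. For $v_1,v_2\in V_b^{\mathrm{symp}}$ define $$v_1\sim_{b,m,r}v_2 \iff g_{b,r}(v_1)I^m=g_{b,r}(v_2)I^m,\qquad v_1\mathrel{\dot\sim}_{b,m,r}v_2\iff g_{b,r}(v_1)\dot I^m=g_{b,r}(v_2)\dot I^m .$$ Then there are the following two $J_b(K)$-equivariant commutative diagrams in which the horizontal arrows are well defined and bijective (the vertical arrows being the natural maps). (1) The map $v\mapsto g_{b,0}(v)$ induces bijections $$\{v\in V_b^{\mathrm{symp}}\mid \alpha_v\in K^\times\}\xrightarrow{\ \sim\ }X_w^{(U)}(b),\qquad V_b^{\mathrm{symp}}/\breve K^\times\xrightarrow{\ \sim\ }X_w^{(B)}(b),$$ compatible with the natural maps $\{v\in V_b^{\mathrm{symp}}\mid\alpha_v\in K^\times\}\to V_b^{\mathrm{symp}}/\breve K^\times$ and $X_w^{(U)}(b)\to X_w^{(B)}(b)$. (2) The map $v\mapsto g_{b,r}(v)$ induces bijections $$\Bigl\{v\in V_b^{\mathrm{symp}}\Bigm| \tfrac{\sigma(\alpha_v)}{\alpha_v}\equiv 1 \bmod \mathfrak p^{m+1}\Bigr\}\Big/\dot\sim_{b,m,r}\xrightarrow{\ \sim\ }\dot X^m_{w_r}(b)(\overline{\mathbb F}_q),\qquad V_b^{\mathrm{symp}}/\!\sim_{b,m,r}\xrightarrow{\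 \sim\ }X^m_{w_r}(b)(\overline{\mathbb F}_q),$$ compatible with the natural maps from the first source to the second source and $\dot X^m_{w_r}(b)(\overline{\mathbb F}_q)\to X^m_{w_r}(b)(\overline{\mathbb F}_q)$.
   Context: Setting. $K$ is a non-archimedean local field with residue field $\mathbb F_q$ of characteristic $p$ and uniformizer $\varpi$; $\breve K$ is the completion of its maximal unramified extension, with ring of integers $\mathcal O$, maximal ideal $\mathfrak p$, residue field $\overline{\mathbb F}_q$; $\sigma$ is the Frobenius of $\breve K/K$ and $\mathrm{ord}$ the normalized valuation. Let $n\ge1$, $V=\breve K^{2n}$ with standard basis $e_1,\dots,e_{2n}$ and symplectic form $\langle x,y\rangle={}^tx\,\Omega\,y$, where $\Omega$ is the antidiagonal $2n\times 2n$ matrix with all antidiagonal entries $1$, multiplied on the right by $\mathrm{diag}(1,-1,1,-1,\dots,1,-1)$. $G=\mathrm{GSp}_{2n}$ is the group of similitudes of this form over $K$, with similitude character $\lambda$. Fix $k\in\{0,1\}$ and a basic $\sigma$-conjugacy class $[b]$ of $G(\breve K)$ with $\mathrm{ord}\,\lambda(b)=k$, with a representative $b\in G(K)$ satisfying $\lambda(b)=-\varpi^k$. Put $F=b\sigma:V\to V$ and $V_k:=\varpi^kF^{-1}=\varpi^k\sigma^{-1}b^{-1}$. Let $J_b(K)=\{g\in G(\breve K)\mid g^{-1}b\sigma(g)=b\}$, acting by left multiplication everywhere. $V_b^{\mathrm{symp}}:=\{v\in V\mid\langle v,F(v)\rangle=\cdots=\langle v,F^{n-1}(v)\rangle=0,\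 \langle v,F^n(v)\rangle\ne0\}$. The map $g_{b,r}$. For $v\in V_b^{\mathrm{symp}}$, with $\alpha_v=\langle v,F^n(v)\rangle$, set $G_1(v):=(-1)^{n+1}\frac{\alpha_v}{\sigma^{-1}(\alpha_v)}\bigl(V_k(v)-\frac{\langle V_k(v),F^n(v)\rangle}{\alpha_v}v\bigr)$ and, for $1\le i\le n-2$, $G_{i+1}(v):=\frac{\alpha_v}{\sigma^{-1}(\alpha_v)}\bigl(V_k(G_i(v))-\frac{\langle V_k(G_i(v)),F^n(v)\rangle}{\alpha_v}v\bigr)$. For $r\ge0$, $g_{b,r}(v)$ is the matrix with columns $$\bigl(v,\varpi^rF(v),\dots,\varpi^{(n-1)r}F^{n-1}(v),\varpi^rG_1(v),\varpi^{2r}G_2(v),\dots,\varpi^{(n-1)r}G_{n-1}(v),\varpi^{nr}F^n(v)\bigr);$$ it lies in $\mathrm{GSp}_{2n}(\breve K)$. The element $w_r\in G(\breve K)$ is given by $w_re_i=\varpi^{-r}e_{i+1}$ $(1\le i\le n-1)$, $w_re_n=\varpi^{-r}e_{2n}$, $w_re_{n+1}=(-1)^{n+1}\varpi^{r+k}e_1$, $w_re_{n+i}=\varpi^{r+k}e_{n+i-1}$ $(2\le i\le n)$; $w:=w_0$. $B\subset G$ is the subgroup of upper triangular matrices in $\mathrm{GSp}_{2n}$ and $U$ its unipotent radical. Semi-infinite Deligne–Lusztig sets: $X_w^{(U)}(b)=\{g\in G(\breve K)/U(\breve K)\mid g^{-1}b\sigma(g)\in U(\breve K)wU(\breve K)\}$,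 $X_w^{(B)}(b)=\{g\in G(\breve K)/B(\breve K)\mid g^{-1}b\sigma(g)\in B(\breve K)wB(\breve K)\}$. For $m\ge0$, $I^m\subset G(\breve K)$ (resp. $\dot I^m$) is the subgroup of matrices in $G(\breve K)$ with diagonal entries in $\mathcal O^\times$ (resp. $1+\mathfrak p^{m+1}$), entries strictly above the diagonal in $\mathfrak p^{m+1}$ and entries strictly below the diagonal in $\mathfrak p^m$. Affine Deligne–Lusztig sets of level $m$: $X^m_{w_r}(b)(\overline{\mathbb F}_q)=\{gI^m\in G(\breve K)/I^m\mid g^{-1}b\sigma(g)\in I^mw_rI^m\}$, $\dot X^m_{w_r}(b)(\overline{\mathbb F}_q)=\{g\dot I^m\in G(\breve K)/\dot I^m\mid g^{-1}b\sigma(g)\in\dot I^mw_r\dot I^m\}$. *)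

theory Defs
  imports "Jordan_Normal_Form.Determinant" "HOL-Algebra.Algebraic_Closure_Type" "HOL-Algebra.Coset"
begin

section \<open>Valued fields\<close>

definition discrete_valuation_on :: "'a::field set \<Rightarrow> ('a \<Rightarrow> int) \<Rightarrow> bool" where
  "discrete_valuation_on A w \<longleftrightarrow>
     (\<forall>x\<in>A - {0}. \<forall>y\<in>A - {0}. w (x * y) = w x + w y) \<and>
     (\<forall>x\<in>A - {0}. \<forall>y\<in>A - {0}. x + y \<noteq> 0 \<longrightarrow> min (w x) (w y) \<le> w (x + y)) \<and>
     (\<exists>x\<in>A - {0}. w x = 1)"

text \<open>Valuations are integer valued with an irrelevant value at \<open>0\<close>; hence the explicit \<open>x = 0\<close>.
  For \<open>N \<ge> 0\<close> this is the \<open>N\<close>-th power of the maximal ideal.\<close>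

definition ppow :: "('a::field \<Rightarrow> int) \<Rightarrow> int \<Rightarrow> 'a set" where
  "ppow w N = {x. x = 0 \<or> N \<le> w x}"

definition complete_in :: "('a::field \<Rightarrow> int) \<Rightarrow> 'a set \<Rightarrow> bool" where
  "complete_in w A \<longleftrightarrow>
     (\<forall>x :: nat \<Rightarrow> 'a. range x \<subseteq> A \<longrightarrow>
        (\<forall>N. \<exists>i0. \<forall>i\<ge>i0. \<forall>j\<ge>i0. x i - x j \<in> ppow w N) \<longrightarrow>
        (\<exists>l\<in>A. \<forall>N. \<exists>i0. \<forall>i\<ge>i0. x i - l \<in> ppow w N))"

definition residue_field :: "('a::field \<Rightarrow> int) \<Rightarrow> 'a set \<Rightarrow> 'a set set" where
  "residue_field w A =
     (A \<inter> ppow w 0) // {(x, y). x \<in> A \<inter> ppow w 0 \<and> y \<in> A \<inter> ppow w 0 \<and> x - y \<in> ppow w 1}"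

definition local_field :: "'a::field set \<Rightarrow> ('a \<Rightarrow> int) \<Rightarrow> bool" where
  "local_field K w \<longleftrightarrow>
     subfield K ring_of_type_algebra \<and> discrete_valuation_on K w \<and>
     complete_in w K \<and> finite (residue_field w K)"

text \<open>Finite unramified extensions of \<open>K\<close> inside an algebraic closure of the ambient field (which
  contains an algebraic closure of \<open>K\<close>). Unramified means ramification index one, i.e. the
  normalised valuation of \<open>K\<close> extends to an integer valued one; the residue extension is
  automatically separable since the residue field of \<open>K\<close> is finite.\<close>

definition finite_unramified_ext :: "'a::field set \<Rightarrow> ('a \<Rightarrow> int) \<Rightarrow> 'a alg_closure set \<Rightarrow> bool" where
  "finite_unramified_ext K w E \<longleftrightarrow>
     subfield E ring_of_type_algebra \<and> to_ac ` K \<subseteq> E \<and>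
     (\<exists>B. finite B \<and> E = {\<Sum>b\<in>B. to_ac (c b) * b | c. c ` B \<subseteq> K}) \<and>
     (\<exists>w'. discrete_valuation_on E w' \<and> (\<forall>x\<in>K - {0}. w' (to_ac x) = w x))"

definition max_unramified_ext :: "'a::field set \<Rightarrow> ('a \<Rightarrow> int) \<Rightarrow> 'a alg_closure set" where
  "max_unramified_ext K w = \<Union> {E. finite_unramified_ext K w E}"

text \<open>The type \<open>'a\<close> with valuation \<open>w\<close> is the completion of the maximal unramified extension
  of \<open>K\<close>: it is complete and contains that extension as a dense subfield.
  The last two conditions say that its residue field is an algebraic closure of that of \<open>K\<close>;
  they are consequences of the preceding ones and are recorded as part of the setting.\<close>

definition completed_max_unramified :: "'a::field set \<Rightarrow> ('a \<Rightarrow> int) \<Rightarrow> bool" where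
  "completed_max_unramified K w \<longleftrightarrow>
     discrete_valuation_on UNIV w \<and> complete_in w UNIV \<and>
     max_unramified_ext K w \<subseteq> range to_ac \<and>
     (\<forall>x N. \<exists>y. to_ac y \<in> max_unramified_ext K w \<and> x - y \<in> ppow w N) \<and>
     (\<forall>x\<in>ppow w 0. \<exists>d\<ge>1. x ^ (card (residue_field w K) ^ d) - x \<in> ppow w 1) \<and>
     (\<forall>f :: 'a poly. Polynomial.coeff f (Polynomial.degree f) = 1 \<and> 0 < Polynomial.degree f \<and>
          (\<forall>i. Polynomial.coeff f i \<in> ppow w 0) \<longrightarrow>
        (\<exists>x\<in>ppow w 0. Polynomial.poly f x \<in> ppow w 1))"

definition frobenius_of :: "'a::field set \<Rightarrow> ('a \<Rightarrow> int) \<Rightarrow> ('a \<Rightarrow> 'a) \<Rightarrow> bool" where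
  "frobenius_of K w s \<longleftrightarrow>
     bij s \<and> (\<forall>x y. s (x + y) = s x + s y) \<and> (\<forall>x y. s (x * y) = s x * s y) \<and>
     (\<forall>x\<in>K. s x = x) \<and> (\<forall>x. x \<noteq> 0 \<longrightarrow> w (s x) = w x) \<and>
     (\<forall>x\<in>ppow w 0. s x - x ^ card (residue_field w K) \<in> ppow w 1)"

section \<open>The group of symplectic similitudes\<close>

definition Omega :: "nat \<Rightarrow> 'a::field mat" where
  "Omega n = mat (2 * n) (2 * n) (\<lambda>(i, j). if i + j = 2 * n - 1 then 1 else 0)
           * mat (2 * n) (2 * n) (\<lambda>(i, j). if i = j then (- 1) ^ i else 0)"

definition sform :: "nat \<Rightarrow> 'a::field vec \<Rightarrow> 'a vec \<Rightarrow> 'a" where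
  "sform n x y = x \<bullet> (Omega n *\<^sub>v y)"

definition similitude_by :: "nat \<Rightarrow> 'a::field mat \<Rightarrow> 'a \<Rightarrow> bool" where
  "similitude_by n g c \<longleftrightarrow>
     c \<noteq> 0 \<and> (\<forall>x\<in>carrier_vec (2 * n). \<forall>y\<in>carrier_vec (2 * n).
       sform n (g *\<^sub>v x) (g *\<^sub>v y) = c * sform n x y)"

definition GSp :: "nat \<Rightarrow> 'a::field mat monoid" where
  "GSp n = \<lparr>carrier = {g \<in> carrier_mat (2 * n) (2 * n).
                          invertible_mat g \<and> (\<exists>c. similitude_by n g c)},
            mult = (*), one = 1\<^sub>m (2 * n)\<rparr>"

definition similitude :: "nat \<Rightarrow> 'a::field mat \<Rightarrow> 'a" where
  "similitude n g = (THE c. similitude_by n g c)"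

definition Borel :: "nat \<Rightarrow> 'a::field mat set" where
  "Borel n = {g \<in> carrier (GSp n). upper_triangular g}"

definition Unip :: "nat \<Rightarrow> 'a::field mat set" where
  "Unip n = {g \<in> Borel n. \<forall>i<2 * n. g $$ (i, i) = 1}"

definition I_grp :: "nat \<Rightarrow> ('a::field \<Rightarrow> int) \<Rightarrow> nat \<Rightarrow> 'a mat set" where
  "I_grp n w m = {g \<in> carrier (GSp n). \<forall>i<2 * n. \<forall>j<2 * n.
     (i = j \<longrightarrow> g $$ (i, j) \<noteq> 0 \<and> w (g $$ (i, j)) = 0) \<and>
     (i < j \<longrightarrow> g $$ (i, j) \<in> ppow w (int m + 1)) \<and>
     (j < i \<longrightarrow> g $$ (i, j) \<in> ppow w (int m))}"

definition Idot_grp :: "nat \<Rightarrow> ('a::field \<Rightarrow> int) \<Rightarrow> nat \<Rightarrow> 'a mat set" where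
  "Idot_grp n w m = {g \<in> carrier (GSp n). \<forall>i<2 * n. \<forall>j<2 * n.
     (i = j \<longrightarrow> g $$ (i, j) - 1 \<in> ppow w (int m + 1)) \<and>
     (i < j \<longrightarrow> g $$ (i, j) \<in> ppow w (int m + 1)) \<and>
     (j < i \<longrightarrow> g $$ (i, j) \<in> ppow w (int m))}"

text \<open>Algebraic homomorphisms from the multiplicative group to \<open>GSp\<close>, given on points over the
  (infinite) field: the matrix entries are Laurent polynomials.\<close>

definition cocharacter :: "nat \<Rightarrow> ('a::field \<Rightarrow> 'a mat) \<Rightarrow> bool" where
  "cocharacter n \<mu> \<longleftrightarrow>
     (\<forall>t. t \<noteq> 0 \<longrightarrow> \<mu> t \<in> carrier (GSp n)) \<and>
     (\<forall>t u. t \<noteq> 0 \<and> u \<noteq> 0 \<longrightarrow> \<mu> (t * u) = \<mu> t * \<mu> u) \<and>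
     (\<exists>(N::int) c. \<forall>t. t \<noteq> 0 \<longrightarrow> (\<forall>i<2 * n. \<forall>j<2 * n.
        \<mu> t $$ (i, j) = (\<Sum>a\<in>{- N..N}. c a i j * t powi a)))"

text \<open>\<open>sigma_norm s n b l\<close> is \<open>b \<cdot> s(b) \<cdots> s\<^sup>l\<^sup>-\<^sup>1(b)\<close>, the linear part of \<open>(b s)\<^sup>l\<close>.\<close>

primrec sigma_norm :: "('a::field \<Rightarrow> 'a) \<Rightarrow> nat \<Rightarrow> 'a mat \<Rightarrow> nat \<Rightarrow> 'a mat" where
  "sigma_norm s n b 0 = 1\<^sub>m (2 * n)"
| "sigma_norm s n b (Suc l) = b * map_mat s (sigma_norm s n b l)"

text \<open>Kottwitz's characterisation of the slope homomorphism \<open>\<nu>\<close> of \<open>b\<close>: \<open>l \<nu> = \<mu>\<close> is a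
  cocharacter, and for some \<open>c\<close> the conjugate \<open>c \<mu> c\<^sup>-\<^sup>1\<close> is defined over the fixed field of
  \<open>s\<^sup>l\<close> and \<open>c (b s)\<^sup>l c\<^sup>-\<^sup>1 = c \<mu>(\<varpi>) c\<^sup>-\<^sup>1 s\<^sup>l\<close>. The element \<open>b\<close> is basic if its slope
  homomorphism is central.\<close>

definition slope_hom_multiple ::
    "('a::field \<Rightarrow> 'a) \<Rightarrow> 'a \<Rightarrow> nat \<Rightarrow> 'a mat \<Rightarrow> nat \<Rightarrow> ('a \<Rightarrow> 'a mat) \<Rightarrow> bool" where
  "slope_hom_multiple s \<pi> n b l \<mu> \<longleftrightarrow>
     0 < l \<and> cocharacter n \<mu> \<and>
     (\<exists>c\<in>carrier (GSp n).
        (\<forall>t. t \<noteq> 0 \<longrightarrow> map_mat (s ^^ l) (c * \<mu> t * inv\<^bsub>GSp n\<^esub> c)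
                          = c * \<mu> ((s ^^ l) t) * inv\<^bsub>GSp n\<^esub> c) \<and>
        c * sigma_norm s n b l * map_mat (s ^^ l) (inv\<^bsub>GSp n\<^esub> c) = c * \<mu> \<pi> * inv\<^bsub>GSp n\<^esub> c)"

definition basic :: "('a::field \<Rightarrow> 'a) \<Rightarrow> 'a \<Rightarrow> nat \<Rightarrow> 'a mat \<Rightarrow> bool" where
  "basic s \<pi> n b \<longleftrightarrow>
     (\<exists>l \<mu>. slope_hom_multiple s \<pi> n b l \<mu> \<and>
        (\<forall>t. t \<noteq> 0 \<longrightarrow> (\<forall>g\<in>carrier (GSp n). g * \<mu> t = \<mu> t * g)))"

section \<open>The setting\<close>

text \<open>The type \<open>'a\<close> is the completed maximal unramified extension of the local field \<open>base\<close>;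
  \<open>hdim\<close>, \<open>kap\<close>, \<open>bmat\<close> are \<open>n\<close>, \<open>k\<close>, \<open>b\<close>. The operators \<open>Fop\<close> and \<open>Vop\<close> below are
  \<open>F = b \<sigma>\<close> and \<open>V\<^sub>k = \<varpi>\<^sup>k F\<^sup>-\<^sup>1\<close>.\<close>

record 'a gsp_datum =
  base :: "'a set"
  vord :: "'a \<Rightarrow> int"
  unif :: 'a
  frob :: "'a \<Rightarrow> 'a"
  hdim :: nat
  kap :: nat
  bmat :: "'a mat"

definition gsp_setting :: "'a::field gsp_datum \<Rightarrow> bool" where
  "gsp_setting D \<longleftrightarrow>
     local_field (base D) (vord D) \<and>
     completed_max_unramified (base D) (vord D) \<and>
     frobenius_of (base D) (vord D) (frob D) \<and>
     unif D \<in> base D \<and> unif D \<noteq> 0 \<and> vord D (unif D) = 1 \<and>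
     1 \<le> hdim D \<and> kap D \<in> {0, 1} \<and>
     bmat D \<in> carrier (GSp (hdim D)) \<and>
     (\<forall>i<2 * hdim D. \<forall>j<2 * hdim D. bmat D $$ (i, j) \<in> base D) \<and>
     similitude (hdim D) (bmat D) = - (unif D ^ kap D) \<and>
     basic (frob D) (unif D) (hdim D) (bmat D)"

definition form :: "'a::field gsp_datum \<Rightarrow> 'a vec \<Rightarrow> 'a vec \<Rightarrow> 'a" where
  "form D = sform (hdim D)"

definition Fop :: "'a::field gsp_datum \<Rightarrow> 'a vec \<Rightarrow> 'a vec" where
  "Fop D v = bmat D *\<^sub>v map_vec (frob D) v"

definition Vop :: "'a::field gsp_datum \<Rightarrow> 'a vec \<Rightarrow> 'a vec" where
  "Vop D v = unif D ^ kap D \<cdot>\<^sub>v map_vec (inv_into UNIV (frob D)) (inv\<^bsub>GSp (hdim D)\<^esub> (bmat D) *\<^sub>v v)"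

definition J_grp :: "'a::field gsp_datum \<Rightarrow> 'a mat set" where
  "J_grp D = {g \<in> carrier (GSp (hdim D)).
     inv\<^bsub>GSp (hdim D)\<^esub> g * bmat D * map_mat (frob D) g = bmat D}"

definition alpha :: "'a::field gsp_datum \<Rightarrow> 'a vec \<Rightarrow> 'a" where
  "alpha D v = form D v ((Fop D ^^ hdim D) v)"

definition Vsymp :: "'a::field gsp_datum \<Rightarrow> 'a vec set" where
  "Vsymp D = {v \<in> carrier_vec (2 * hdim D).
     (\<forall>i\<in>{1..<hdim D}. form D v ((Fop D ^^ i) v) = 0) \<and> form D v ((Fop D ^^ hdim D) v) \<noteq> 0}"

definition Gstep :: "'a::field gsp_datum \<Rightarrow> 'a vec \<Rightarrow> 'a vec \<Rightarrow> 'a vec" where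
  "Gstep D v x = (alpha D v / inv_into UNIV (frob D) (alpha D v)) \<cdot>\<^sub>v
     (Vop D x - (form D (Vop D x) ((Fop D ^^ hdim D) v) / alpha D v) \<cdot>\<^sub>v v)"

text \<open>\<open>Gvec D v i\<close> is \<open>G\<^sub>i(v)\<close> for \<open>i \<ge> 1\<close>; it is not used for \<open>i = 0\<close>.\<close>

definition Gvec :: "'a::field gsp_datum \<Rightarrow> 'a vec \<Rightarrow> nat \<Rightarrow> 'a vec" where
  "Gvec D v i = (Gstep D v ^^ (i - 1)) ((- 1) ^ (hdim D + 1) \<cdot>\<^sub>v Gstep D v v)"

definition gmat :: "'a::field gsp_datum \<Rightarrow> nat \<Rightarrow> 'a vec \<Rightarrow> 'a mat" where
  "gmat D r v = mat_of_cols (2 * hdim D)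
     (map (\<lambda>i. unif D ^ (i * r) \<cdot>\<^sub>v (Fop D ^^ i) v) [0..<hdim D] @
      map (\<lambda>i. unif D ^ (i * r) \<cdot>\<^sub>v Gvec D v i) [1..<hdim D] @
      [unif D ^ (hdim D * r) \<cdot>\<^sub>v (Fop D ^^ hdim D) v])"

text \<open>\<open>basis_vec n i\<close> is \<open>e\<^sub>i\<close> in the one-based numbering \<open>1 \<le> i \<le> 2n\<close>.\<close>

definition basis_vec :: "nat \<Rightarrow> nat \<Rightarrow> 'a::field vec" where
  "basis_vec n i = unit_vec (2 * n) (i - 1)"

definition wmat :: "'a::field gsp_datum \<Rightarrow> nat \<Rightarrow> 'a mat" where
  "wmat D r = (let n = hdim D; e = basis_vec n; \<pi> = unif D in
     mat_of_cols (2 * n) (map (\<lambda>i.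
       if i < n then \<pi> powi (- int r) \<cdot>\<^sub>v e (i + 1)
       else if i = n then \<pi> powi (- int r) \<cdot>\<^sub>v e (2 * n)
       else if i = n + 1 then ((- 1) ^ (n + 1) * \<pi> ^ (r + kap D)) \<cdot>\<^sub>v e 1
       else \<pi> ^ (r + kap D) \<cdot>\<^sub>v e (i - 1)) [1..<2 * n + 1]))"

section \<open>Deligne--Lusztig sets\<close>

text \<open>The condition on \<open>g\<close> depends only on \<open>g H\<close> when \<open>H\<close> is stable under the Frobenius, as
  are all subgroups used below.\<close>

definition DL_set :: "'a::field gsp_datum \<Rightarrow> 'a mat set \<Rightarrow> 'a mat \<Rightarrow> 'a mat set set" where
  "DL_set D H w = (let G = GSp (hdim D) in
     {g <#\<^bsub>G\<^esub> H | g. g \<in> carrier G \<and>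
        inv\<^bsub>G\<^esub> g * bmat D * map_mat (frob D) g \<in> (H #>\<^bsub>G\<^esub> w) <#>\<^bsub>G\<^esub> H})"

abbreviation U_of :: "'a::field gsp_datum \<Rightarrow> 'a mat set" where
  "U_of D \<equiv> Unip (hdim D)"

abbreviation B_of :: "'a::field gsp_datum \<Rightarrow> 'a mat set" where
  "B_of D \<equiv> Borel (hdim D)"

abbreviation I_of :: "'a::field gsp_datum \<Rightarrow> nat \<Rightarrow> 'a mat set" where
  "I_of D m \<equiv> I_grp (hdim D) (vord D) m"

abbreviation Idot_of :: "'a::field gsp_datum \<Rightarrow> nat \<Rightarrow> 'a mat set" where
  "Idot_of D m \<equiv> Idot_grp (hdim D) (vord D) m"

definition coset :: "'a::field gsp_datum \<Rightarrow> 'a mat set \<Rightarrow> 'a mat \<Rightarrow> 'a mat set" where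
  "coset D H g = g <#\<^bsub>GSp (hdim D)\<^esub> H"

section \<open>Sources of the maps\<close>

definition Vsymp_rat :: "'a::field gsp_datum \<Rightarrow> 'a vec set" where
  "Vsymp_rat D = {v \<in> Vsymp D. alpha D v \<in> base D - {0}}"

definition Vsymp_cong :: "'a::field gsp_datum \<Rightarrow> nat \<Rightarrow> 'a vec set" where
  "Vsymp_cong D m = {v \<in> Vsymp D. frob D (alpha D v) / alpha D v - 1 \<in> ppow (vord D) (int m + 1)}"

definition scalar_rel :: "'a::field gsp_datum \<Rightarrow> ('a vec \<times> 'a vec) set" where
  "scalar_rel D = {(v, c \<cdot>\<^sub>v v) | v c. v \<in> Vsymp D \<and> c \<noteq> 0}"

definition sim_rel :: "'a::field gsp_datum \<Rightarrow> nat \<Rightarrow> nat \<Rightarrow> ('a vec \<times> 'a vec) set" where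
  "sim_rel D m r = {(v1, v2). v1 \<in> Vsymp D \<and> v2 \<in> Vsymp D \<and>
     coset D (I_of D m) (gmat D r v1) = coset D (I_of D m) (gmat D r v2)}"

definition simdot_rel :: "'a::field gsp_datum \<Rightarrow> nat \<Rightarrow> nat \<Rightarrow> ('a vec \<times> 'a vec) set" where
  "simdot_rel D m r = {(v1, v2). v1 \<in> Vsymp D \<and> v2 \<in> Vsymp D \<and>
     coset D (Idot_of D m) (gmat D r v1) = coset D (Idot_of D m) (gmat D r v2)}"

definition restrict_rel :: "('b \<times> 'b) set \<Rightarrow> 'b set \<Rightarrow> ('b \<times> 'b) set" where
  "restrict_rel R S = R \<inter> S \<times> S"

section \<open>Induced maps and equivariant squares\<close>

text \<open>For a function \<open>f\<close> that is constant on each class in \<open>Q\<close> (\<open>descends f Q\<close>),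
  \<open>induced f C\<close> is its value on the class \<open>C\<close>.\<close>

definition descends :: "('b \<Rightarrow> 'c) \<Rightarrow> 'b set set \<Rightarrow> bool" where
  "descends f Q \<longleftrightarrow> (\<forall>C\<in>Q. is_singleton (f ` C))"

definition induced :: "('b \<Rightarrow> 'c) \<Rightarrow> 'b set \<Rightarrow> 'c" where
  "induced f C = the_elem (f ` C)"

definition equivariant ::
    "'j set \<Rightarrow> ('j \<Rightarrow> 's \<Rightarrow> 's) \<Rightarrow> 's set \<Rightarrow> ('j \<Rightarrow> 't \<Rightarrow> 't) \<Rightarrow> 't set \<Rightarrow> ('s \<Rightarrow> 't) \<Rightarrow> bool" where
  "equivariant J actS S actT T f \<longleftrightarrow>
     f ` S \<subseteq> T \<and>
     (\<forall>j\<in>J. (\<forall>x\<in>S. actS j x \<in> S) \<and> (\<forall>y\<in>T. actT j y \<in> T) \<and>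
             (\<forall>x\<in>S. f (actS j x) = actT j (f x)))"

text \<open>A commutative square of \<open>J\<close>-equivariant maps with bijective horizontal arrows:
  \<open>hor1 : X1 \<rightarrow> Y1\<close>, \<open>ver1 : X1 \<rightarrow> X2\<close>, \<open>ver2 : Y1 \<rightarrow> Y2\<close>, \<open>hor2 : X2 \<rightarrow> Y2\<close>;
  \<open>aX1\<close> is the action on \<open>X1\<close>, and so on.\<close>

definition equivariant_bij_square ::
    "'j set \<Rightarrow> ('j \<Rightarrow> 'x1 \<Rightarrow> 'x1) \<Rightarrow> 'x1 set \<Rightarrow> ('j \<Rightarrow> 'y1 \<Rightarrow> 'y1) \<Rightarrow> 'y1 set \<Rightarrow>
     ('j \<Rightarrow> 'x2 \<Rightarrow> 'x2) \<Rightarrow> 'x2 set \<Rightarrow> ('j \<Rightarrow> 'y2 \<Rightarrow> 'y2) \<Rightarrow> 'y2 set \<Rightarrow>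
     ('x1 \<Rightarrow> 'y1) \<Rightarrow> ('x1 \<Rightarrow> 'x2) \<Rightarrow> ('y1 \<Rightarrow> 'y2) \<Rightarrow> ('x2 \<Rightarrow> 'y2) \<Rightarrow> bool" where
  "equivariant_bij_square J aX1 X1 aY1 Y1 aX2 X2 aY2 Y2 hor1 ver1 ver2 hor2 \<longleftrightarrow>
     equivariant J aX1 X1 aY1 Y1 hor1 \<and> bij_betw hor1 X1 Y1 \<and>
     equivariant J aX2 X2 aY2 Y2 hor2 \<and> bij_betw hor2 X2 Y2 \<and>
     equivariant J aX1 X1 aX2 X2 ver1 \<and> equivariant J aY1 Y1 aY2 Y2 ver2 \<and>
     (\<forall>x\<in>X1. ver2 (hor1 x) = hor2 (ver1 x))"

definition class_act :: "'a::field mat \<Rightarrow> 'a vec set \<Rightarrow> 'a vec set" where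
  "class_act j C = (\<lambda>v. j *\<^sub>v v) ` C"

definition coset_act :: "'a::field gsp_datum \<Rightarrow> 'a mat \<Rightarrow> 'a mat set \<Rightarrow> 'a mat set" where
  "coset_act D j C = j <#\<^bsub>GSp (hdim D)\<^esub> C"

end

theory Submission
  imports Defs
begin

text \<open>
  Write \<open>b \<sigma>(g) = g w\<^sub>r \<beta>\<close>. For \<open>g = g\<^sub>b\<^sub>,\<^sub>r(v)\<close> the matrix \<open>\<beta>\<close> has diagonal entries \<open>1\<close> and
  \<open>\<sigma>(\<alpha>)/\<alpha>\<close>, and off the diagonal it is supported on the first row and the last column, with entries
  \<open>\<pm> \<varpi>\<^sup>(\<^sup>i\<^sup>+\<^sup>1\<^sup>)\<^sup>r \<langle>G\<^sub>i(v), F\<^sup>n\<^sup>+\<^sup>1 v\<rangle> / \<alpha>\<close>. Basicness makes \<open>F\<close> isoclinic of slope \<open>k/2\<close>, which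
  forces \<open>2 ord \<langle>v, F\<^sup>j v\<rangle> \<ge> 2 ord \<alpha> + (j - n) k\<close>, so these entries are divisible enough.

  Conversely, if \<open>b \<sigma>(g) = g w\<^sub>r \<beta>\<close> with \<open>\<beta>\<close> in one of the four groups, one looks for \<open>v = g x\<close> with \<open>x\<close> of
  the shape of a first column and \<open>v\<close> in \<open>V\<^sub>b\<^sup>s\<^sup>y\<^sup>m\<^sup>p\<close>. For \<open>B\<close> and \<open>U\<close> the first column of \<open>g\<close> works; for
  \<open>I\<^sup>m\<close> the isotropy equations are solved by successive approximation. Applying \<open>F\<close> and \<open>V\<^sub>k\<close> to \<open>v\<close> then
  produces vectors of the shape of the remaining columns, so that \<open>g\<^sup>-\<^sup>1 g\<^sub>b\<^sub>,\<^sub>r(v)\<close> lies in the group.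
\<close>

text \<open>The four sources form one family: each consists of the v whose ratio
  sigma(alpha_v)/alpha_v lies in the diagonal set of the group. For B and I^m this always holds, as
  sigma preserves valuations; for U it says that alpha_v is fixed by sigma, which is why the fixed
  field of sigma has to be identified with K. The ratio appears as the multiplier of beta. In
  g-coordinates pi^r F becomes the semilinear map pi^r w_r beta sigma, and pi^r w_r moves the first
  n coordinates with coefficient 1 and the last n with pi^(2r+k) up to sign. Hence the powers of pi
  in the columns of g_{b,r}(v), and the double use of r+k >= m+1: it puts entries of valuation at
  least r+k into p^(m+1), and it makes 2r+k positive, so that vectors supported on the last n
  coordinates are contracted and the quadratic isotropy equations behave like linear ones. The slope
  bound is only half-integral; integrality of valuations and k in {0,1} close the gap. Injectivity
  in the second diagram is built into the relations; in the first it is read off the first column of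
  g_{b,0}(v), which is v.\<close>

locale valued_field =
  fixes w :: "'a::field \<Rightarrow> int"
  assumes disc: "discrete_valuation_on UNIV w"
begin

section \<open>Discrete valuations, the filtration by \<open>ppow\<close>, and completeness\<close>

lemma w_mult: "x \<noteq> 0 \<Longrightarrow> y \<noteq> 0 \<Longrightarrow> w (x * y) = w x + w y"
  using disc by (auto simp: discrete_valuation_on_def)

lemma w_add: "x \<noteq> 0 \<Longrightarrow> y \<noteq> 0 \<Longrightarrow> x + y \<noteq> 0 \<Longrightarrow> min (w x) (w y) \<le> w (x + y)"
  using disc by (auto simp: discrete_valuation_on_def)

lemma w_one [simp]: "w 1 = 0"
  using w_mult[of 1 1] by simp

lemma w_uminus_one: "w (- 1) = 0"
  using w_mult[of "-1" "-1"] by simp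

lemma w_uminus [simp]: "w (- x) = w x"
  using w_mult[of "-1" x] w_uminus_one by (cases "x = 0") auto

lemma w_inverse: "x \<noteq> 0 \<Longrightarrow> w (inverse x) = - w x"
  using w_mult[of x "inverse x"] by simp

lemma w_divide: "x \<noteq> 0 \<Longrightarrow> y \<noteq> 0 \<Longrightarrow> w (x / y) = w x - w y"
  by (simp add: divide_inverse w_mult w_inverse)

lemma w_power: "x \<noteq> 0 \<Longrightarrow> w (x ^ n) = int n * w x"
  by (induction n) (auto simp: w_mult algebra_simps)

lemma ppow_0 [simp]: "0 \<in> ppow w N"
  by (simp add: ppow_def)

lemma ppow_mono: "x \<in> ppow w M \<Longrightarrow> N \<le> M \<Longrightarrow> x \<in> ppow w N"
  by (auto simp: ppow_def)

lemma ppow_uminus [simp]: "- x \<in> ppow w N \<longleftrightarrow> x \<in> ppow w N"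
  by (auto simp: ppow_def)

lemma ppow_add: "x \<in> ppow w N \<Longrightarrow> y \<in> ppow w N \<Longrightarrow> x + y \<in> ppow w N"
  using w_add[of x y] by (cases "x = 0"; cases "y = 0"; cases "x + y = 0") (auto simp: ppow_def)

lemma ppow_diff: "x \<in> ppow w N \<Longrightarrow> y \<in> ppow w N \<Longrightarrow> x - y \<in> ppow w N"
  using ppow_add[of x N "- y"] by simp

lemma ppow_sum: "(\<And>i. i \<in> A \<Longrightarrow> f i \<in> ppow w N) \<Longrightarrow> sum f A \<in> ppow w N"
  by (induction A rule: infinite_finite_induct) (auto intro: ppow_add)

lemma ppow_mult: "x \<in> ppow w M \<Longrightarrow> y \<in> ppow w N \<Longrightarrow> x * y \<in> ppow w (M + N)"
  by (cases "x = 0"; cases "y = 0") (auto simp: ppow_def w_mult)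

lemma ppow_mult_le: "x \<in> ppow w M \<Longrightarrow> y \<in> ppow w N \<Longrightarrow> L \<le> M + N \<Longrightarrow> x * y \<in> ppow w L"
  using ppow_mult ppow_mono by blast

lemma ppow_one: "1 \<in> ppow w N \<longleftrightarrow> N \<le> 0"
  by (simp add: ppow_def)

lemma ppow_all: "(\<And>N. x \<in> ppow w N) \<Longrightarrow> x = 0"
proof (rule ccontr)
  assume a: "\<And>N. x \<in> ppow w N" "x \<noteq> 0"
  have "x \<in> ppow w (w x + 1)" by (rule a)
  then show False using a(2) by (auto simp: ppow_def)
qed

lemma ppow_all_nat: "(\<And>t::nat. x \<in> ppow w (int t)) \<Longrightarrow> x = 0"
proof (rule ppow_all)
  fix N assume "\<And>t::nat. x \<in> ppow w (int t)"
  then show "x \<in> ppow w N" by (rule ppow_mono[of _ "int (nat N)"]) simp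
qed

text \<open>The ultrametric inequality for x = (x + y) + (-y) supplies the upper bound on w (x + y).
  Phrasing the hypothesis with \<open>ppow\<close> covers y = 0, where \<open>w\<close> carries no
  information.\<close>

lemma w_add_dominant:
  assumes "x \<noteq> 0" "y \<in> ppow w (w x + 1)"
  shows "x + y \<noteq> 0 \<and> w (x + y) = w x"
proof (cases "y = 0")
  case False
  then have y: "w x < w y" using assms by (auto simp: ppow_def)
  have ne: "x + y \<noteq> 0"
  proof
    assume "x + y = 0"
    then have "x = - y" by (simp add: eq_neg_iff_add_eq_0)
    then show False using y by simp
  qed
  have "w x \<le> w (x + y)" using w_add[OF assms(1) False ne] y by simp
  moreover have "min (w (x + y)) (w (- y)) \<le> w (x + y + - y)"
    using w_add[of "x + y" "- y"] ne False assms(1) by simp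
  ultimately show ?thesis using ne y by simp
qed (use assms in simp)

text \<open>One term of strictly smallest valuation cannot be cancelled by the others. This produces
  the contradiction with linear dependence in \<open>Vsymp_weight\<close>.\<close>

lemma sum_dominant_nonzero:
  assumes "finite A" "a \<in> A" "f a \<noteq> 0" "\<And>i. i \<in> A \<Longrightarrow> i \<noteq> a \<Longrightarrow> f i \<in> ppow w (w (f a) + 1)"
  shows "sum f A \<noteq> 0"
proof -
  have "sum f (A - {a}) \<in> ppow w (w (f a) + 1)"
    by (rule ppow_sum) (use assms in auto)
  then show ?thesis
    using w_add_dominant[OF assms(3)] by (simp add: sum.remove[OF assms(1,2)])
qed

text \<open>Increments telescope, so the t-th term already approximates the limit to order t. It
  serves both the digit expansions in K and the coordinates of the isotropic vector in the full
  field.\<close>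

lemma complete_increments:
  assumes A: "complete_in w A" and xA: "range x \<subseteq> A"
    and inc: "\<And>t. x (Suc t) - x t \<in> ppow w (int t)"
  shows "\<exists>l\<in>A. \<forall>t. l - x t \<in> ppow w (int t)"
proof -
  have tail: "x (t + u) - x t \<in> ppow w (int t)" for t u
  proof (induction u)
    case (Suc u)
    have "x (Suc (t + u)) - x (t + u) \<in> ppow w (int t)"
      by (rule ppow_mono[OF inc]) simp
    then show ?case using ppow_add[OF Suc.IH] by fastforce
  qed simp
  have tail': "x i - x t \<in> ppow w (int t)" if "t \<le> i" for i t
    using tail[of t "i - t"] that by simp
  have "\<exists>i0. \<forall>i\<ge>i0. \<forall>j\<ge>i0. x i - x j \<in> ppow w N" for N
  proof (intro exI[of _ "nat N"] allI impI)
    fix i j assume "nat N \<le> i" "nat N \<le> j"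
    then have "x i - x (nat N) - (x j - x (nat N)) \<in> ppow w (int (nat N))"
      by (intro ppow_diff tail')
    then show "x i - x j \<in> ppow w N" by (auto elim: ppow_mono)
  qed
  then obtain l where l: "l \<in> A" "\<forall>N. \<exists>i0. \<forall>i\<ge>i0. x i - l \<in> ppow w N"
    using A xA unfolding complete_in_def by blast
  have "l - x t \<in> ppow w (int t)" for t
  proof -
    obtain i0 where i0: "\<forall>i\<ge>i0. x i - l \<in> ppow w (int t)" using l(2) by blast
    have "x (max i0 t) - x t - (x (max i0 t) - l) \<in> ppow w (int t)"
      by (rule ppow_diff) (use i0 tail' in auto)
    then show ?thesis by simp
  qed
  then show ?thesis using l(1) by blast
qed

section \<open>Roots modulo the maximal ideal\<close>

text \<open>The count of roots of a monic polynomial over the residue field, carried out on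
  representatives: divide by X - a and use that x - a is a unit when x and a are
  incongruent.\<close>

lemma monic_roots_mod_bound:
  assumes "Polynomial.coeff f (Polynomial.degree f) = 1"
    "finite R" "R \<subseteq> ppow w 0" "\<And>x y. x \<in> R \<Longrightarrow> y \<in> R \<Longrightarrow> x - y \<in> ppow w 1 \<Longrightarrow> x = y"
    "\<And>x. x \<in> R \<Longrightarrow> Polynomial.poly f x \<in> ppow w 1"
  shows "card R \<le> Polynomial.degree f"
  using assms
proof (induction "Polynomial.degree f" arbitrary: f R)
  case 0
  have "f = [:1:]"
    using 0(1,2) by (metis degree_0_id)
  then show ?case using 0(6) by (cases "R = {}") (auto simp: ppow_one)
next
  case (Suc d)
  show ?case
  proof (cases "R = {}")
    case False
    then obtain a where a: "a \<in> R" by blast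
    define q where "q = synthetic_div f a"
    have id: "f + Polynomial.smult a q = pCons (Polynomial.poly f a) q"
      unfolding q_def by (rule synthetic_div_correct)
    have dq: "Polynomial.degree q = d"
      using Suc(2) by (simp add: q_def degree_synthetic_div)
    have "Polynomial.coeff (f + Polynomial.smult a q) (Suc d)
        = Polynomial.coeff (pCons (Polynomial.poly f a) q) (Suc d)"
      by (simp only: id)
    then have "Polynomial.coeff f (Suc d) = Polynomial.coeff q d"
      using dq coeff_eq_0[of q "Suc d"] by simp
    then have lq: "Polynomial.coeff q (Polynomial.degree q) = 1"
      using Suc(2,3) dq by simp
    have ev: "Polynomial.poly f x = Polynomial.poly f a + (x - a) * Polynomial.poly q x" for x
      using arg_cong[OF id, of "\<lambda>p. Polynomial.poly p x"] by (simp add: algebra_simps)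
    have "Polynomial.poly q x \<in> ppow w 1" if x: "x \<in> R - {a}" for x
    proof -
      have "(x - a) * Polynomial.poly q x \<in> ppow w 1"
        using ppow_diff[OF Suc(7)[of x] Suc(7)[OF a]] x by (simp add: ev[of x])
      moreover have "x - a \<notin> ppow w 1" "x - a \<in> ppow w 0"
        using Suc(5,6) x a by (blast intro: ppow_diff)+
      ultimately show ?thesis
        by (cases "Polynomial.poly q x = 0"; cases "x = a") (auto simp: ppow_def w_mult)
    qed
    then have "card (R - {a}) \<le> Polynomial.degree q"
      using Suc(4,5,6) by (intro Suc(1)[OF dq[symmetric] lq]) auto
    then show ?thesis using Suc(2,4) a dq by (simp add: card_Diff_singleton)
  qed simp
qed

lemma sub_closed:
  assumes K: "subfield K (ring_of_type_algebra :: 'a ring)"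
  shows "0 \<in> K" "1 \<in> K" "x \<in> K \<Longrightarrow> y \<in> K \<Longrightarrow> x + y \<in> K" "x \<in> K \<Longrightarrow> y \<in> K \<Longrightarrow> x * y \<in> K"
    "x \<in> K \<Longrightarrow> - x \<in> K" "x \<in> K \<Longrightarrow> inverse x \<in> K"
proof -
  let ?R = "ring_of_type_algebra :: 'a ring"
  interpret R: field ?R by (rule field_from_type_algebra)
  have ops: "carrier ?R = UNIV" "mult ?R = (*)" "one ?R = 1" "zero ?R = 0" "add ?R = (+)"
    by (simp_all add: ring_of_type_algebra_def)
  note cl = subringE[OF subfieldE(1)[OF K], unfolded ops]
  show "0 \<in> K" "1 \<in> K" "x \<in> K \<Longrightarrow> y \<in> K \<Longrightarrow> x + y \<in> K" "x \<in> K \<Longrightarrow> y \<in> K \<Longrightarrow> x * y \<in> K"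
    using cl by auto
  show "- x \<in> K" if "x \<in> K"
  proof -
    have "x + (\<ominus>\<^bsub>?R\<^esub> x) = 0" using R.r_neg[of x] by (simp add: ops)
    then have "\<ominus>\<^bsub>?R\<^esub> x = - x" by (simp add: add_eq_0_iff)
    then show ?thesis using cl(5)[OF that] by simp
  qed
  show "inverse x \<in> K" if x: "x \<in> K"
  proof (cases "x = 0")
    case False
    then have inv: "inv\<^bsub>?R\<^esub> x \<in> K" "x * inv\<^bsub>?R\<^esub> x = 1"
      using R.subfield_m_inv[OF K, of x] x by (auto simp: ops)
    have "inv\<^bsub>?R\<^esub> x = inverse x" using inverse_unique[OF inv(2)] by simp
    then show ?thesis using inv by simp
  qed (use cl in simp)
qed

text \<open>Choosing one element per residue class gives a finite digit set inside K of size q,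
  which avoids computing in the quotient.\<close>

lemma residue_reps:
  assumes K: "subfield K ring_of_type_algebra" and fin: "finite (residue_field w K)"
  obtains R where "finite R" "R \<subseteq> K \<inter> ppow w 0" "card R = card (residue_field w K)"
    "\<And>x y. x \<in> R \<Longrightarrow> y \<in> R \<Longrightarrow> x - y \<in> ppow w 1 \<Longrightarrow> x = y"
    "\<And>x. x \<in> K \<inter> ppow w 0 \<Longrightarrow> \<exists>y\<in>R. x - y \<in> ppow w 1"
proof -
  let ?O = "K \<inter> ppow w 0"
  let ?r = "{(x, y). x \<in> ?O \<and> y \<in> ?O \<and> x - y \<in> ppow w 1}"
  have eq: "equiv ?O ?r"
  proof (rule equivI)
    have "y - x \<in> ppow w 1" if "x - y \<in> ppow w 1" for x y
      using that ppow_uminus[of "x - y" 1] by simp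
    then show "sym ?r" by (auto intro!: symI)
    have "x - z \<in> ppow w 1" if "x - y \<in> ppow w 1" "y - z \<in> ppow w 1" for x y z
      using ppow_add[OF that] by simp
    then show "trans ?r" by (auto intro!: transI)
  qed (auto simp: refl_on_def)
  define rep where "rep C = (SOME x. x \<in> C)" for C :: "'a set"
  have rep: "rep C \<in> C" if "C \<in> ?O // ?r" for C
    unfolding rep_def using that equiv_Eps_in[OF eq] by blast
  have inj: "inj_on rep (?O // ?r)"
  proof (rule inj_onI)
    fix C C' assume C: "C \<in> ?O // ?r" "C' \<in> ?O // ?r" "rep C = rep C'"
    then have "rep C \<in> C \<inter> C'" using rep[of C] rep[of C'] by simp
    then show "C = C'" using quotient_disj[OF eq C(1,2)] by blast
  qed
  show ?thesis
  proof
    show "finite (rep ` (?O // ?r))" using fin by (simp add: residue_field_def)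
    show "card (rep ` (?O // ?r)) = card (residue_field w K)"
      using inj by (simp add: residue_field_def card_image)
    show "rep ` (?O // ?r) \<subseteq> ?O"
      using rep in_quotient_imp_subset[OF eq] by blast
    show "x = y" if "x \<in> rep ` (?O // ?r)" "y \<in> rep ` (?O // ?r)" "x - y \<in> ppow w 1" for x y
    proof -
      obtain C C' where C: "C \<in> ?O // ?r" "C' \<in> ?O // ?r" "x = rep C" "y = rep C'"
        using \<open>x \<in> _\<close> \<open>y \<in> _\<close> by blast
      have "x \<in> ?O" "y \<in> ?O" using C rep in_quotient_imp_subset[OF eq] by blast+
      then have "(x, y) \<in> ?r" using that(3) by simp
      then have "C = C'"
        using quotient_eqI[OF eq C(1,2) rep[OF C(1)] rep[OF C(2)]] C by simp
      then show ?thesis using C by simp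
    qed
    show "\<exists>y\<in>rep ` (?O // ?r). x - y \<in> ppow w 1" if "x \<in> ?O" for x
    proof -
      have "?r `` {x} \<in> ?O // ?r" using that by (rule quotientI)
      then show ?thesis using rep by blast
    qed
  qed
qed

text \<open>The Frobenius acts as the \<open>q\<close>-th power on residues, so a fixed element is congruent to an
  element of \<open>K\<close>, and its digits can be peeled off one by one.\<close>

lemma frobenius_fixed_in_base:
  assumes K: "local_field K w" and s: "frobenius_of K w s"
    and pi: "\<pi> \<in> K" "\<pi> \<noteq> 0" "w \<pi> = 1" and x: "s x = x"
  shows "x \<in> K"
proof -
  define q where "q = card (residue_field w K)"
  have sub: "subfield K ring_of_type_algebra" and comp: "complete_in w K"
    and fin: "finite (residue_field w K)"
    using K by (auto simp: local_field_def)
  note cl = sub_closed[OF sub]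
  have cl_diff: "a - b \<in> K" if "a \<in> K" "b \<in> K" for a b
    using cl(3)[OF that(1) cl(5)[OF that(2)]] by simp
  have cl_pow: "\<pi> ^ t \<in> K" for t
    by (induction t) (use cl pi in auto)
  have s_add: "s (a + b) = s a + s b" and s_mult: "s (a * b) = s a * s b"
    and s_K: "a \<in> K \<Longrightarrow> s a = a" and s_q: "a \<in> ppow w 0 \<Longrightarrow> s a - a ^ q \<in> ppow w 1" for a b
    using s by (auto simp: frobenius_of_def q_def)
  have s_diff: "s (a - b) = s a - s b" for a b
    using s_add[of "a - b" b] by (simp add: algebra_simps)
  obtain R where R: "finite R" "R \<subseteq> K \<inter> ppow w 0" "card R = q"
    "\<And>x y. x \<in> R \<Longrightarrow> y \<in> R \<Longrightarrow> x - y \<in> ppow w 1 \<Longrightarrow> x = y"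
    "\<And>x. x \<in> K \<inter> ppow w 0 \<Longrightarrow> \<exists>y\<in>R. x - y \<in> ppow w 1"
    using residue_reps[OF sub fin] unfolding q_def by metis
  obtain r0 r1 where r: "r0 \<in> R" "0 - r0 \<in> ppow w 1" "r1 \<in> R" "1 - r1 \<in> ppow w 1"
    using R(5)[of 0] R(5)[of 1] cl(1,2) by (auto simp: ppow_one)
  have "r0 \<noteq> r1"
  proof
    assume "r0 = r1"
    then have "1 - r1 - (0 - r0) = 1" by simp
    then show False using ppow_diff[OF r(4,2)] by (simp add: ppow_one)
  qed
  then have q2: "2 \<le> q"
    using card_mono[OF R(1), of "{r0, r1}"] r R(3) by simp
  \<comment> \<open>The polynomial X^q - X; the bound q >= 2, from the distinct residues of 0 and 1,
    makes it monic of degree q.\<close>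
  define f where "f = Polynomial.monom (1::'a) q - Polynomial.monom 1 1"
  have f: "Polynomial.degree f = q" "Polynomial.coeff f q = 1"
    "\<And>a. Polynomial.poly f a = a ^ q - a"
  proof -
    show c: "Polynomial.coeff f q = 1" using q2 by (simp add: f_def)
    have "Polynomial.degree f \<le> q"
      unfolding f_def using q2
      by (intro degree_diff_le) (auto simp: degree_monom_eq)
    then show "Polynomial.degree f = q"
      using le_degree[of f q] c by simp
    show "Polynomial.poly f a = a ^ q - a" for a by (simp add: f_def poly_monom)
  qed
  \<comment> \<open>If z were incongruent to all of \<open>R\<close>, then \<open>R\<close> together
    with z would be q + 1 incongruent roots of X^q - X modulo the maximal ideal.\<close>
  have digit: "\<exists>a\<in>R. z - a \<in> ppow w 1" if z: "z \<in> ppow w 0" "s z = z" for z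
  proof (rule ccontr)
    assume neg: "\<not> ?thesis"
    have "card (insert z R) \<le> Polynomial.degree f"
    proof (rule monic_roots_mod_bound)
      have "a ^ q - a \<in> ppow w 1" if "a \<in> ppow w 0" "s a = a" for a
        using s_q[OF that(1)] that(2) by (metis minus_diff_eq ppow_uminus)
      then show "Polynomial.poly f a \<in> ppow w 1" if "a \<in> insert z R" for a
        using that R(2) z s_K by (auto simp: f)
      show "a = b" if "a \<in> insert z R" "b \<in> insert z R" "a - b \<in> ppow w 1" for a b
        using that R(4) neg by (auto, metis minus_diff_eq ppow_uminus)
    qed (use R z f in auto)
    moreover have "z \<notin> R" using neg by (metis cancel_comm_monoid_add_class.diff_cancel ppow_0)
    ultimately show False using R(1,3) f(1) by simp
  qed
  have integral: "x \<in> K" if x: "s x = x" "x \<in> ppow w 0" for x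
  proof -
    have step: "\<exists>y'. (y' \<in> K \<and> x - y' \<in> ppow w (int (Suc t))) \<and> y' - y \<in> ppow w (int t)"
      if y: "y \<in> K \<and> x - y \<in> ppow w (int t)" for y t
    proof -
      have pt: "\<pi> ^ t \<noteq> 0" "w (\<pi> ^ t) = int t" using pi by (auto simp: w_power)
      define z where "z = (x - y) / \<pi> ^ t"
      have z0: "z \<in> ppow w 0" using y pt by (cases "x = y") (auto simp: z_def ppow_def w_divide)
      have "s z * s (\<pi> ^ t) = s (x - y)" using pt by (simp add: z_def flip: s_mult)
      then have "s z * \<pi> ^ t = x - y" using y x s_K cl_pow by (simp add: s_diff cl_diff)
      then have "s z = z" using pt by (simp add: z_def field_simps)
      then obtain a where a: "a \<in> R" "z - a \<in> ppow w 1" using digit z0 by blast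
      have "x - (y + a * \<pi> ^ t) = (z - a) * \<pi> ^ t" using pt by (simp add: z_def field_simps)
      moreover have "(z - a) * \<pi> ^ t \<in> ppow w (int (Suc t))"
        by (rule ppow_mult_le[OF a(2), of _ "int t"]) (use pt in \<open>auto simp: ppow_def\<close>)
      moreover have "a * \<pi> ^ t \<in> ppow w (int t)"
        by (rule ppow_mult_le[of _ 0 _ "int t"]) (use pt a R in \<open>auto simp: ppow_def\<close>)
      moreover have "y + a * \<pi> ^ t \<in> K" using y a R cl cl_pow by auto
      ultimately show ?thesis by (intro exI[of _ "y + a * \<pi> ^ t"]) auto
    qed
    obtain y where y: "\<And>t. y t \<in> K \<and> x - y t \<in> ppow w (int t)"
      "\<And>t. y (Suc t) - y t \<in> ppow w (int t)"
      using dependent_nat_choice[of "\<lambda>t y. y \<in> K \<and> x - y \<in> ppow w (int t)"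
          "\<lambda>t y y'. y' - y \<in> ppow w (int t)"] step x cl(1)
      by (metis diff_zero of_nat_0)
    obtain l where l: "l \<in> K" "\<And>t. l - y t \<in> ppow w (int t)"
      using complete_increments[OF comp, of y] y by blast
    have "x - l \<in> ppow w (int t)" for t
      using ppow_diff[OF conjunct2[OF y(1)] l(2), of t] by simp
    then have "x - l = 0" by (rule ppow_all_nat)
    then show ?thesis using l by simp
  qed
  \<comment> \<open>Multiplication by pi^N clears the denominator of x; \<open>nat\<close> truncates
    to N = 0 when x is already integral.\<close>
  define N where "N = nat (- w x)"
  have int: "\<pi> ^ N * x \<in> ppow w 0"
  proof (cases "x = 0")
    case False
    then have "w (\<pi> ^ N * x) = int N + w x" using pi by (simp add: w_mult w_power)
    then show ?thesis by (simp add: ppow_def N_def)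
  qed simp
  have fixed: "s (\<pi> ^ N * x) = \<pi> ^ N * x" by (simp only: s_mult s_K[OF cl_pow] x)
  have "\<pi> ^ N * x \<in> K" by (rule integral[OF fixed int])
  then have "inverse (\<pi> ^ N) * (\<pi> ^ N * x) \<in> K" by (rule cl(4)[OF cl(6)[OF cl_pow]])
  then show ?thesis using pi by (simp flip: mult.assoc)
qed

end

section \<open>The symplectic form\<close>

lemma minus_one_reflect: "i < 2 * n \<Longrightarrow> (- 1 :: 'a::comm_ring_1) ^ (2 * n - Suc i) = - ((- 1) ^ i)"
  by (auto simp: minus_one_power_iff)

lemma Omega_carrier [simp]: "Omega n \<in> carrier_mat (2 * n) (2 * n)"
  unfolding Omega_def by (rule mult_carrier_mat[of _ _ "2 * n"]) auto

lemma Omega_dim [simp]: "dim_row (Omega n) = 2 * n" "dim_col (Omega n) = 2 * n"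
  by (simp_all add: Omega_def)

text \<open>With zero-based indices j = 2n-1-i has parity opposite to i, which turns the sign (-1)^j
  into -((-1)^i). This sign recurs in every Gram matrix below.\<close>

lemma Omega_index:
  assumes "i < 2 * n" "j < 2 * n"
  shows "Omega n $$ (i, j) = (if j = 2 * n - Suc i then - ((- 1) ^ i) else 0 :: 'a::field)"
proof -
  have "Omega n $$ (i, j) = (\<Sum>l = 0..<2 * n. (if i + l = 2 * n - 1 then 1 else 0) *
      (if l = j then (- 1) ^ l else 0 :: 'a))"
    using assms by (simp add: Omega_def scalar_prod_def)
  also have "\<dots> = (\<Sum>l = 0..<2 * n. if l = j then (if i + j = 2 * n - 1 then (- 1) ^ j else 0) else 0)"
    by (rule sum.cong) auto
  also have "\<dots> = (if i + j = 2 * n - 1 then (- 1) ^ j else 0)"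
    using assms by simp
  finally show ?thesis using assms by (auto simp: minus_one_reflect)
qed

lemma Omega_mult_index:
  assumes "y \<in> carrier_vec (2 * n)" "i < 2 * n"
  shows "(Omega n *\<^sub>v y) $ i = - ((- 1) ^ i) * y $ (2 * n - Suc i)"
proof -
  have "(Omega n *\<^sub>v y) $ i = (\<Sum>j = 0..<2 * n. Omega n $$ (i, j) * y $ j)"
    using assms by (simp add: scalar_prod_def)
  also have "\<dots> = (\<Sum>j = 0..<2 * n. if j = 2 * n - Suc i then - ((- 1) ^ i) * y $ j else 0)"
    by (rule sum.cong) (use assms in \<open>auto simp: Omega_index\<close>)
  finally show ?thesis using assms by simp
qed

lemma sform_sum:
  assumes "x \<in> carrier_vec (2 * n)" "y \<in> carrier_vec (2 * n)"
  shows "sform n x y = (\<Sum>i<2 * n. - ((- 1) ^ i) * x $ i * y $ (2 * n - Suc i))"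
proof -
  have "sform n x y = (\<Sum>i<2 * n. x $ i * (Omega n *\<^sub>v y) $ i)"
    using assms by (simp add: sform_def scalar_prod_def atLeast0LessThan)
  then show ?thesis
    using assms by (simp add: Omega_mult_index mult.assoc mult.left_commute del: index_mult_mat_vec)
qed

lemma sform_add_left:
  assumes "x \<in> carrier_vec (2 * n)" "x' \<in> carrier_vec (2 * n)" "y \<in> carrier_vec (2 * n)"
  shows "sform n (x + x') y = sform n x y + sform n x' y"
  using assms by (auto simp: sform_sum algebra_simps simp flip: sum.distrib intro!: sum.cong)

lemma sform_add_right:
  assumes "x \<in> carrier_vec (2 * n)" "y \<in> carrier_vec (2 * n)" "y' \<in> carrier_vec (2 * n)"
  shows "sform n x (y + y') = sform n x y + sform n x y'"
  using assms by (auto simp: sform_sum algebra_simps simp flip: sum.distrib intro!: sum.cong)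

lemma sform_diff_left:
  assumes "x \<in> carrier_vec (2 * n)" "x' \<in> carrier_vec (2 * n)" "y \<in> carrier_vec (2 * n)"
  shows "sform n (x - x') y = sform n x y - sform n x' y"
  using assms by (auto simp: sform_sum algebra_simps simp flip: sum_subtractf intro!: sum.cong)

lemma sform_diff_right:
  assumes "x \<in> carrier_vec (2 * n)" "y \<in> carrier_vec (2 * n)" "y' \<in> carrier_vec (2 * n)"
  shows "sform n x (y - y') = sform n x y - sform n x y'"
  using assms by (auto simp: sform_sum algebra_simps simp flip: sum_subtractf intro!: sum.cong)

lemma sform_smult_left:
  assumes "x \<in> carrier_vec (2 * n)" "y \<in> carrier_vec (2 * n)"
  shows "sform n (c \<cdot>\<^sub>v x) y = c * sform n x y"
  using assms by (simp add: sform_sum sum_distrib_left algebra_simps)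

lemma sform_smult_right:
  assumes "x \<in> carrier_vec (2 * n)" "y \<in> carrier_vec (2 * n)"
  shows "sform n x (c \<cdot>\<^sub>v y) = c * sform n x y"
  using assms by (simp add: sform_sum sum_distrib_left algebra_simps)

lemma sform_swap:
  assumes "x \<in> carrier_vec (2 * n)" "y \<in> carrier_vec (2 * n)"
  shows "sform n x y = - sform n y x"
proof -
  have "sform n x y = (\<Sum>i<2 * n. - ((- 1) ^ (2 * n - Suc i)) * x $ (2 * n - Suc i) * y $ (2 * n - Suc (2 * n - Suc i)))"
    unfolding sform_sum[OF assms]
    by (subst sum.nat_diff_reindex[symmetric]) simp
  also have "\<dots> = - (\<Sum>i<2 * n. - ((- 1) ^ i) * y $ i * x $ (2 * n - Suc i))"
    unfolding sum_negf[symmetric]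
    by (rule sum.cong) (auto simp: minus_one_reflect mult.assoc mult.commute[of "y $ _"])
  finally show ?thesis using assms by (simp add: sform_sum)
qed

text \<open>Characteristic 2 is allowed, so antisymmetry alone does not suffice; instead the terms
  for i and 2n-1-i cancel in pairs.\<close>

lemma sform_self:
  assumes "x \<in> carrier_vec (2 * n)"
  shows "sform n x x = 0"
proof -
  let ?f = "\<lambda>i. - ((- 1) ^ i) * x $ i * x $ (2 * n - Suc i)"
  have split: "{..<2 * n} = {..<n} \<union> {n..<2 * n}" by auto
  have "(\<Sum>i\<in>{n..<2 * n}. ?f i) = (\<Sum>i<n. ?f (2 * n - Suc i))"
    by (rule sum.reindex_bij_witness[of _ "\<lambda>i. 2 * n - Suc i" "\<lambda>i. 2 * n - Suc i"]) auto
  also have "\<dots> = (\<Sum>i<n. - ?f i)"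
    by (rule sum.cong) (auto simp: minus_one_reflect)
  finally show ?thesis
    unfolding sform_sum[OF assms assms] split by (subst sum.union_disjoint) (auto simp: sum_negf)
qed

lemma sform_unit_left:
  assumes "y \<in> carrier_vec (2 * n)" "i < 2 * n"
  shows "sform n (unit_vec (2 * n) i) y = - ((- 1) ^ i) * y $ (2 * n - Suc i)"
  using assms mult_mat_vec_carrier[OF Omega_carrier assms(1)]
  by (simp add: sform_def Omega_mult_index del: index_mult_mat_vec)

lemma sform_unit_right:
  assumes "x \<in> carrier_vec (2 * n)" "i < 2 * n"
  shows "sform n x (unit_vec (2 * n) i) = (- 1) ^ i * x $ (2 * n - Suc i)"
  using assms sform_swap[of x n "unit_vec (2 * n) i"] by (simp add: sform_unit_left)

lemma sform_unit_unit:
  assumes "i < 2 * n" "j < 2 * n"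
  shows "sform n (unit_vec (2 * n) i) (unit_vec (2 * n) j)
    = (if j = 2 * n - Suc i then - ((- 1) ^ i) else 0)"
  using assms by (auto simp: sform_unit_left)

lemma sform_map:
  assumes s: "field_hom s" and "x \<in> carrier_vec (2 * n)" "y \<in> carrier_vec (2 * n)"
  shows "sform n (map_vec s x) (map_vec s y) = s (sform n x y)"
proof -
  interpret field_hom s by (rule s)
  show ?thesis using assms(2,3) by (simp add: sform_sum hom_distribs)
qed

section \<open>Symplectic similitudes\<close>

lemma sform_mult_mat:
  assumes "g \<in> carrier_mat (2 * n) (2 * n)" "x \<in> carrier_vec (2 * n)" "y \<in> carrier_vec (2 * n)"
  shows "sform n (g *\<^sub>v x) (g *\<^sub>v y) = x \<bullet> ((transpose_mat g * Omega n * g) *\<^sub>v y)"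
proof -
  have "sform n (g *\<^sub>v x) (g *\<^sub>v y) = (Omega n *\<^sub>v (g *\<^sub>v y)) \<bullet> (g *\<^sub>v x)"
    unfolding sform_def
    by (rule comm_scalar_prod[of _ "2 * n"]) (use assms in \<open>auto intro!: mult_mat_vec_carrier\<close>)
  also have "\<dots> = (transpose_mat g *\<^sub>v (Omega n *\<^sub>v (g *\<^sub>v y))) \<bullet> x"
    by (rule transpose_vec_mult_scalar[symmetric])
      (use assms in \<open>auto intro!: mult_mat_vec_carrier\<close>)
  also have "transpose_mat g *\<^sub>v (Omega n *\<^sub>v (g *\<^sub>v y)) = (transpose_mat g * Omega n * g) *\<^sub>v y"
    using assms by (simp add: assoc_mult_mat_vec[of _ "2 * n" "2 * n" _ "2 * n"] mult_mat_vec_carrier)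
  finally show ?thesis
    using assms by (subst comm_scalar_prod[of _ "2 * n"]) (auto intro!: mult_mat_vec_carrier)
qed

lemma col_eq_mult_unit:
  assumes "(g :: 'a::field mat) \<in> carrier_mat m n" "i < n"
  shows "g *\<^sub>v unit_vec n i = col g i"
  using assms by (intro eq_vecI) (auto simp: scalar_prod_right_unit[OF assms(2)])

text \<open>By bilinearity only the Gram matrix of the columns matters. The multipliers of
  \<open>gmat\<close> and \<open>wmat\<close> are verified in this form.\<close>

lemma similitude_by_iff_cols:
  assumes g: "g \<in> carrier_mat (2 * n) (2 * n)"
  shows "similitude_by n g c \<longleftrightarrow> c \<noteq> 0 \<and> (\<forall>i<2 * n. \<forall>j<2 * n. sform n (col g i) (col g j)
    = c * (if j = 2 * n - Suc i then - ((- 1) ^ i) else 0))"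
proof
  assume s: "similitude_by n g c"
  show "c \<noteq> 0 \<and> (\<forall>i<2 * n. \<forall>j<2 * n. sform n (col g i) (col g j)
    = c * (if j = 2 * n - Suc i then - ((- 1) ^ i) else 0))"
  proof (intro conjI allI impI)
    show "c \<noteq> 0" using s by (simp add: similitude_by_def)
    fix i j assume ij: "i < 2 * n" "j < 2 * n"
    then have "sform n (g *\<^sub>v unit_vec (2 * n) i) (g *\<^sub>v unit_vec (2 * n) j)
        = c * sform n (unit_vec (2 * n) i) (unit_vec (2 * n) j)"
      using s by (simp add: similitude_by_def)
    then show "sform n (col g i) (col g j) = c * (if j = 2 * n - Suc i then - ((- 1) ^ i) else 0)"
      using ij by (simp add: col_eq_mult_unit[OF g] sform_unit_unit)
  qed
next
  assume h: "c \<noteq> 0 \<and> (\<forall>i<2 * n. \<forall>j<2 * n. sform n (col g i) (col g j)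
    = c * (if j = 2 * n - Suc i then - ((- 1) ^ i) else 0))"
  have "transpose_mat g * Omega n * g = c \<cdot>\<^sub>m Omega n"
  proof (rule eq_matI)
    fix i j assume "i < dim_row (c \<cdot>\<^sub>m Omega n)" "j < dim_col (c \<cdot>\<^sub>m (Omega n :: 'a mat))"
    then have ij: "i < 2 * n" "j < 2 * n" by auto
    have "(transpose_mat g * Omega n * g) $$ (i, j) = unit_vec (2 * n) i \<bullet> ((transpose_mat g * Omega n * g) *\<^sub>v unit_vec (2 * n) j)"
    proof -
      let ?T = "transpose_mat g * Omega n * g"
      have T: "?T \<in> carrier_mat (2 * n) (2 * n)"
        by (intro mult_carrier_mat[of _ "2 * n" "2 * n"]) (use g in auto)
      then have "?T $$ (i, j) = col ?T j $ i" using ij by auto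
      also have "\<dots> = unit_vec (2 * n) i \<bullet> col ?T j"
        by (rule scalar_prod_left_unit[symmetric]) (use T ij in auto)
      finally show ?thesis by (simp only: col_eq_mult_unit[OF T ij(2)])
    qed
    also have "\<dots> = sform n (col g i) (col g j)"
      using ij g by (simp add: sform_mult_mat[symmetric] col_eq_mult_unit[of g "2 * n" "2 * n"])
    finally show "(transpose_mat g * Omega n * g) $$ (i, j) = (c \<cdot>\<^sub>m Omega n) $$ (i, j)"
      using h ij by (simp add: Omega_index)
  qed (use g in auto)
  moreover have "(c \<cdot>\<^sub>m Omega n) *\<^sub>v y = c \<cdot>\<^sub>v (Omega n *\<^sub>v y)" if "y \<in> carrier_vec (2 * n)" for y :: "'a vec"
    using that by (intro eq_vecI) auto
  ultimately show "similitude_by n g c"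
    using h g unfolding similitude_by_def
    by (auto simp only: sform_mult_mat) (simp add: sform_def mult_mat_vec_carrier[OF Omega_carrier])
qed

lemma similitude_by_cols:
  assumes "g \<in> carrier_mat (2 * n) (2 * n)" "similitude_by n g c" "i < 2 * n" "j < 2 * n"
  shows "sform n (col g i) (col g j) = c * (if j = 2 * n - Suc i then - ((- 1) ^ i) else 0)"
  using assms similitude_by_iff_cols by blast

text \<open>The symplectic adjoint Omega^(-1) g^t Omega divided by the multiplier c, written out in
  entries. Reflection in the antidiagonal keeps positions above, on and below the diagonal, which is
  what \<open>shape_inv\<close> exploits.\<close>

definition sadj :: "nat \<Rightarrow> 'a::field mat \<Rightarrow> 'a \<Rightarrow> 'a mat" where
  "sadj n g c = mat (2 * n) (2 * n) (\<lambda>(i, j). (- 1) ^ (i + j) * g $$ (2 * n - Suc j, 2 * n - Suc i) / c)"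

lemma sadj_carrier [simp]: "sadj n g c \<in> carrier_mat (2 * n) (2 * n)"
  by (simp add: sadj_def)

lemma sadj_dim [simp]: "dim_row (sadj n g c) = 2 * n" "dim_col (sadj n g c) = 2 * n"
  by (simp_all add: sadj_def)

lemma sadj_left:
  assumes g: "g \<in> carrier_mat (2 * n) (2 * n)" and s: "similitude_by n g c"
  shows "sadj n g c * g = 1\<^sub>m (2 * n)"
proof (rule eq_matI)
  fix i j assume "i < dim_row (1\<^sub>m (2 * n) :: 'a mat)" "j < dim_col (1\<^sub>m (2 * n) :: 'a mat)"
  then have ij: "i < 2 * n" "j < 2 * n" by auto
  let ?i = "2 * n - Suc i"
  have c: "c \<noteq> 0" and gram: "sform n (col g j) (col g ?i)
      = c * (if ?i = 2 * n - Suc j then - ((- 1) ^ j) else 0)"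
    using s ij by (auto simp: similitude_by_iff_cols[OF g])
  have "(sadj n g c * g) $$ (i, j) = (\<Sum>l<2 * n. (- 1) ^ (i + l) * g $$ (2 * n - Suc l, ?i) / c * g $$ (l, j))"
    using g ij by (simp add: sadj_def scalar_prod_def atLeast0LessThan)
  also have "\<dots> = - ((- 1) ^ i) / c * sform n (col g j) (col g ?i)"
  proof -
    have "sform n (col g j) (col g ?i) = (\<Sum>l<2 * n. - ((- 1) ^ l) * g $$ (l, j) * g $$ (2 * n - Suc l, ?i))"
      using g ij by (subst sform_sum) (auto intro!: col_carrier_vec[where nc = "2 * n"])
    then show ?thesis
      by (auto simp: sum_distrib_left power_add intro!: sum.cong)
  qed
  also have "\<dots> = 1\<^sub>m (2 * n) $$ (i, j)"
    using c ij unfolding gram by (auto simp flip: power_add)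
  finally show "(sadj n g c * g) $$ (i, j) = 1\<^sub>m (2 * n) $$ (i, j)" .
qed (use g in auto)

lemma sadj_right:
  assumes g: "g \<in> carrier_mat (2 * n) (2 * n)" and s: "similitude_by n g c"
  shows "g * sadj n g c = 1\<^sub>m (2 * n)"
  using mat_mult_left_right_inverse[OF sadj_carrier g sadj_left[OF assms]] .

lemma similitude_byD:
  "similitude_by n g c \<Longrightarrow> x \<in> carrier_vec (2 * n) \<Longrightarrow> y \<in> carrier_vec (2 * n) \<Longrightarrow>
    sform n (g *\<^sub>v x) (g *\<^sub>v y) = c * sform n x y"
  by (simp add: similitude_by_def)

lemma similitude_by_mult:
  assumes "g \<in> carrier_mat (2 * n) (2 * n)" "h \<in> carrier_mat (2 * n) (2 * n)"
    "similitude_by n g c" "similitude_by n h e"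
  shows "similitude_by n (g * h) (c * e)"
  using assms by (auto simp: similitude_by_def)

lemma similitude_by_sadj:
  assumes g: "g \<in> carrier_mat (2 * n) (2 * n)" and s: "similitude_by n g c"
  shows "similitude_by n (sadj n g c) (inverse c)"
  unfolding similitude_by_def
proof (intro conjI ballI)
  show "inverse c \<noteq> 0" using s by (simp add: similitude_by_def)
  fix x y :: "'a vec" assume xy: "x \<in> carrier_vec (2 * n)" "y \<in> carrier_vec (2 * n)"
  have "sform n x y = sform n (g *\<^sub>v (sadj n g c *\<^sub>v x)) (g *\<^sub>v (sadj n g c *\<^sub>v y))"
    using xy g by (simp flip: assoc_mult_mat_vec[OF g sadj_carrier] add: sadj_right[OF g s])
  also have "\<dots> = c * sform n (sadj n g c *\<^sub>v x) (sadj n g c *\<^sub>v y)"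
    using xy by (intro similitude_byD[OF s]) (auto intro: mult_mat_vec_carrier[OF sadj_carrier])
  finally show "sform n (sadj n g c *\<^sub>v x) (sadj n g c *\<^sub>v y) = inverse c * sform n x y"
    using \<open>inverse c \<noteq> 0\<close> by simp
qed

lemma similitude_by_unique:
  assumes "1 \<le> n" "g \<in> carrier_mat (2 * n) (2 * n)" "similitude_by n g c" "similitude_by n g e"
  shows "c = e"
proof -
  have "sform n (col g 0) (col g (2 * n - 1)) = - c" "sform n (col g 0) (col g (2 * n - 1)) = - e"
    using similitude_by_cols[OF assms(2,3), of 0 "2 * n - 1"]
      similitude_by_cols[OF assms(2,4), of 0 "2 * n - 1"] assms(1) by simp_all
  then show ?thesis by simp
qed

lemma GSp_memI:
  assumes "g \<in> carrier_mat (2 * n) (2 * n)" "similitude_by n g c"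
  shows "g \<in> carrier (GSp n)"
  using assms sadj_left[OF assms] sadj_right[OF assms]
  by (auto simp: GSp_def invertible_mat_def inverts_mat_def intro!: exI[of _ "sadj n g c"])

lemma GSp_memE:
  assumes "g \<in> carrier (GSp n)"
  obtains c where "g \<in> carrier_mat (2 * n) (2 * n)" "similitude_by n g c" "c \<noteq> 0"
  using assms by (auto simp: GSp_def similitude_by_def)

lemma GSp_carrier_mat: "g \<in> carrier (GSp n) \<Longrightarrow> g \<in> carrier_mat (2 * n) (2 * n)"
  by (simp add: GSp_def)

lemma GSp_simps [simp]: "mult (GSp n) = (*)" "one (GSp n) = 1\<^sub>m (2 * n)"
  by (simp_all add: GSp_def)

lemma GSp_group: "group (GSp n)"
proof (rule groupI)
  show "x \<otimes>\<^bsub>GSp n\<^esub> y \<in> carrier (GSp n)" if "x \<in> carrier (GSp n)" "y \<in> carrier (GSp n)" for x y :: "'a mat"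
    using that by (elim GSp_memE) (auto intro!: GSp_memI similitude_by_mult)
  show "\<one>\<^bsub>GSp n\<^esub> \<in> carrier (GSp n)"
    by (rule GSp_memI[of _ _ 1]) (auto simp: similitude_by_def)
  show "x \<otimes>\<^bsub>GSp n\<^esub> y \<otimes>\<^bsub>GSp n\<^esub> z = x \<otimes>\<^bsub>GSp n\<^esub> (y \<otimes>\<^bsub>GSp n\<^esub> z)"
    if "x \<in> carrier (GSp n)" "y \<in> carrier (GSp n)" "z \<in> carrier (GSp n)" for x y z :: "'a mat"
    using that by (auto dest!: GSp_carrier_mat)
  show "\<one>\<^bsub>GSp n\<^esub> \<otimes>\<^bsub>GSp n\<^esub> x = x" if "x \<in> carrier (GSp n)" for x :: "'a mat"
    using that by (auto dest!: GSp_carrier_mat)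
  show "\<exists>y\<in>carrier (GSp n). y \<otimes>\<^bsub>GSp n\<^esub> x = \<one>\<^bsub>GSp n\<^esub>" if "x \<in> carrier (GSp n)" for x :: "'a mat"
    using that by (elim GSp_memE) (metis GSp_memI GSp_simps sadj_carrier sadj_left similitude_by_sadj)
qed

lemma GSp_mult_closed: "g \<in> carrier (GSp n) \<Longrightarrow> h \<in> carrier (GSp n) \<Longrightarrow> g * h \<in> carrier (GSp n)"
  using group.is_monoid[OF GSp_group, THEN monoid.m_closed] by fastforce

lemma GSp_inv:
  assumes "g \<in> carrier (GSp n)" "similitude_by n g c"
  shows "inv\<^bsub>GSp n\<^esub> g = sadj n g c"
proof -
  have g: "g \<in> carrier_mat (2 * n) (2 * n)" using assms GSp_carrier_mat by blast
  show ?thesis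
    by (rule group.inv_equality[OF GSp_group])
      (use assms sadj_left[OF g assms(2)] similitude_by_sadj[OF g assms(2)] in \<open>auto intro: GSp_memI\<close>)
qed

lemma GSp_inv_closed: "g \<in> carrier (GSp n) \<Longrightarrow> inv\<^bsub>GSp n\<^esub> g \<in> carrier (GSp n)"
  by (rule group.inv_closed[OF GSp_group])

lemma GSp_inv_left: "g \<in> carrier (GSp n) \<Longrightarrow> inv\<^bsub>GSp n\<^esub> g * g = 1\<^sub>m (2 * n)"
  using group.l_inv[OF GSp_group, of g n] by simp

lemma GSp_inv_right: "g \<in> carrier (GSp n) \<Longrightarrow> g * inv\<^bsub>GSp n\<^esub> g = 1\<^sub>m (2 * n)"
  using group.r_inv[OF GSp_group, of g n] by simp

lemma similitude_by_map:
  assumes s: "field_hom s" and g: "g \<in> carrier_mat (2 * n) (2 * n)" and sim: "similitude_by n g c"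
  shows "similitude_by n (map_mat s g) (s c)"
proof -
  interpret field_hom s by (rule s)
  have gs: "map_mat s g \<in> carrier_mat (2 * n) (2 * n)" using g by simp
  show ?thesis
    using sim g unfolding similitude_by_iff_cols[OF g] similitude_by_iff_cols[OF gs]
    by (auto simp: sform_map[OF s] hom_distribs)
qed

lemma GSp_map:
  assumes "field_hom s" "g \<in> carrier (GSp n)"
  shows "map_mat s g \<in> carrier (GSp n)"
  using assms(2) by (rule GSp_memE) (auto intro!: GSp_memI similitude_by_map assms(1))

section \<open>Frobenius and Verschiebung\<close>

locale gsp_ctx =
  fixes D :: "'a::field gsp_datum"
  assumes setting: "gsp_setting D"
begin

abbreviation "n \<equiv> hdim D"
abbreviation "k \<equiv> kap D"
abbreviation "\<pi> \<equiv> unif D"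
abbreviation "w \<equiv> vord D"
abbreviation "s \<equiv> frob D"
abbreviation "si \<equiv> inv_into UNIV (frob D)"
abbreviation "b \<equiv> bmat D"
abbreviation "F \<equiv> Fop D"
abbreviation "V \<equiv> Vop D"
abbreviation "CV \<equiv> (carrier_vec (2 * n) :: 'a vec set)"
abbreviation "CM \<equiv> (carrier_mat (2 * n) (2 * n) :: 'a mat set)"
abbreviation ip :: "'a vec \<Rightarrow> 'a vec \<Rightarrow> 'a" where "ip \<equiv> sform n"
abbreviation "\<alpha> \<equiv> alpha D"
abbreviation e :: "nat \<Rightarrow> 'a vec" where "e \<equiv> unit_vec (2 * n)"

sublocale valued_field w
  using setting by unfold_locales (auto simp: gsp_setting_def completed_max_unramified_def)

lemma n_pos: "1 \<le> n" "0 < n" "n \<noteq> 0"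
  using setting by (auto simp: gsp_setting_def)

lemma k_cases: "k = 0 \<or> k = 1"
  using setting by (auto simp: gsp_setting_def)

lemma pi: "\<pi> \<noteq> 0" "w \<pi> = 1" "\<pi> \<in> base D"
  using setting by (auto simp: gsp_setting_def)

lemma s_frob: "frobenius_of (base D) w s"
  using setting by (auto simp: gsp_setting_def)

lemma s_bij: "bij s" and s_base: "x \<in> base D \<Longrightarrow> s x = x" and w_s: "x \<noteq> 0 \<Longrightarrow> w (s x) = w x"
  using s_frob by (auto simp: frobenius_of_def)

lemma s_si [simp]: "s (si x) = x"
  using s_bij by (simp add: bij_is_surj surj_f_inv_f)

lemma si_s [simp]: "si (s x) = x"
  using s_bij by (simp add: bij_is_inj inv_f_f)

lemma s_hom: "field_hom s"
proof -
  have add: "s (x + y) = s x + s y" and mult: "s (x * y) = s x * s y" for x y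
    using s_frob by (auto simp: frobenius_of_def)
  have zero: "s 0 = 0" using add[of 0 0] by (metis add_0_right add_left_cancel)
  have "s 1 \<noteq> 0" using zero si_s by (metis zero_neq_one)
  moreover have "s 1 * s 1 = s 1" using mult[of 1 1] by simp
  ultimately have "s 1 = 1" by simp
  then show ?thesis by unfold_locales (use add mult zero in auto)
qed

sublocale s: field_hom s by (rule s_hom)

lemma si_hom: "field_hom si"
proof -
  note inj = injD[OF bij_is_inj[OF s_bij]]
  show ?thesis
    by unfold_locales (rule inj; simp add: s.hom_add s.hom_mult s.hom_one s.hom_zero)+
qed

sublocale si: field_hom si by (rule si_hom)

lemma s_eq_0 [simp]: "s x = 0 \<longleftrightarrow> x = 0" by (rule s.hom_0_iff)

lemma si_eq_0 [simp]: "si x = 0 \<longleftrightarrow> x = 0" by (rule si.hom_0_iff)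

lemma w_si: "x \<noteq> 0 \<Longrightarrow> w (si x) = w x"
  using w_s[of "si x"] by simp

lemma ppow_s [simp]: "s x \<in> ppow w M \<longleftrightarrow> x \<in> ppow w M"
  using w_s[of x] by (cases "x = 0") (auto simp: ppow_def)

lemma ppow_si [simp]: "si x \<in> ppow w M \<longleftrightarrow> x \<in> ppow w M"
  using ppow_s[of "si x" M] by simp

lemma s_pi [simp]: "s \<pi> = \<pi>" and si_pi [simp]: "si \<pi> = \<pi>"
  using s_base[OF pi(3)] si_s[of \<pi>] by simp_all

lemma s_pi_pow [simp]: "s (\<pi> ^ i) = \<pi> ^ i" and si_pi_pow [simp]: "si (\<pi> ^ i) = \<pi> ^ i"
  by (simp_all add: s.hom_power si.hom_power)

text \<open>Needed to rewrite the rationality condition on alpha_v as the condition that the ratio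
  sigma(alpha_v)/alpha_v equals 1.\<close>

lemma s_fixed_base: "s x = x \<longleftrightarrow> x \<in> base D"
proof -
  have "local_field (base D) w" using setting by (auto simp: gsp_setting_def)
  then show ?thesis using frobenius_fixed_in_base[OF _ s_frob pi(3,1,2)] s_base by blast
qed

lemma b_GSp: "b \<in> carrier (GSp n)"
  using setting by (auto simp: gsp_setting_def)

lemma b_carrier [simp]: "b \<in> CM"
  using b_GSp GSp_carrier_mat by blast

lemma b_similitude: "similitude_by n b (- (\<pi> ^ k))"
proof -
  obtain c where c: "similitude_by n b c" using b_GSp by (rule GSp_memE)
  then have "similitude n b = c"
    unfolding similitude_def using similitude_by_unique[OF n_pos(1) b_carrier] by blast
  then show ?thesis using c setting by (simp add: gsp_setting_def)
qed

lemma mv_carrier [simp]: "g \<in> CM \<Longrightarrow> x \<in> CV \<Longrightarrow> g *\<^sub>v x \<in> CV"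
  by (rule mult_mat_vec_carrier)

lemma F_carrier [simp]: "x \<in> CV \<Longrightarrow> F x \<in> CV"
  by (simp add: Fop_def)

lemma Fpow_carrier [simp]: "x \<in> CV \<Longrightarrow> (F ^^ i) x \<in> CV"
  by (induction i) auto

lemma F_smult: "x \<in> CV \<Longrightarrow> F (c \<cdot>\<^sub>v x) = s c \<cdot>\<^sub>v F x"
  by (simp add: Fop_def s.vec_hom_smult mult_mat_vec[OF b_carrier])

lemma s_vec_add: "x \<in> CV \<Longrightarrow> y \<in> CV \<Longrightarrow> map_vec s (x + y) = map_vec s x + map_vec s y"
  by (intro eq_vecI) (auto simp: s.hom_add)

lemma s_vec_diff: "x \<in> CV \<Longrightarrow> y \<in> CV \<Longrightarrow> map_vec s (x - y) = map_vec s x - map_vec s y"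
  by (intro eq_vecI) (auto simp: s.hom_minus)

lemma map_vec_s_si [simp]: "map_vec s (map_vec si x) = x" "map_vec si (map_vec s x) = x"
  by (intro eq_vecI; simp)+

lemma F_diff: "x \<in> CV \<Longrightarrow> y \<in> CV \<Longrightarrow> F (x - y) = F x - F y"
  by (simp add: Fop_def s_vec_diff mult_minus_distrib_mat_vec[OF b_carrier])

lemma F_form: "x \<in> CV \<Longrightarrow> y \<in> CV \<Longrightarrow> ip (F x) (F y) = - (\<pi> ^ k) * s (ip x y)"
  by (simp add: Fop_def similitude_byD[OF b_similitude] sform_map[OF s_hom])

lemma binv: "inv\<^bsub>GSp n\<^esub> b \<in> CM" "inv\<^bsub>GSp n\<^esub> b * b = 1\<^sub>m (2 * n)" "b * inv\<^bsub>GSp n\<^esub> b = 1\<^sub>m (2 * n)"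
  using GSp_inv_closed[OF b_GSp] GSp_carrier_mat GSp_inv_left[OF b_GSp] GSp_inv_right[OF b_GSp]
  by auto

lemma V_carrier [simp]: "x \<in> CV \<Longrightarrow> V x \<in> CV"
  using binv by (simp add: Vop_def)

lemma V_smult: "x \<in> CV \<Longrightarrow> V (c \<cdot>\<^sub>v x) = si c \<cdot>\<^sub>v V x"
  using binv by (simp add: Vop_def si.vec_hom_smult mult_mat_vec[OF binv(1)] smult_smult_assoc mult.commute)

lemma FV: "x \<in> CV \<Longrightarrow> F (V x) = \<pi> ^ k \<cdot>\<^sub>v x"
  using binv
  by (simp add: Vop_def F_smult) (simp add: Fop_def flip: assoc_mult_mat_vec[OF b_carrier])

lemma F_inj: "x \<in> CV \<Longrightarrow> y \<in> CV \<Longrightarrow> F x = F y \<Longrightarrow> x = y"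
proof -
  assume xy: "x \<in> CV" "y \<in> CV" "F x = F y"
  then have "inv\<^bsub>GSp n\<^esub> b *\<^sub>v (b *\<^sub>v map_vec s x) = inv\<^bsub>GSp n\<^esub> b *\<^sub>v (b *\<^sub>v map_vec s y)"
    by (simp add: Fop_def)
  then have "map_vec s x = map_vec s y"
    using xy binv by (simp flip: assoc_mult_mat_vec[OF binv(1) b_carrier])
  then show "x = y" by (metis map_vec_s_si(2))
qed

lemma V_eqI: "x \<in> CV \<Longrightarrow> y \<in> CV \<Longrightarrow> F y = \<pi> ^ k \<cdot>\<^sub>v x \<Longrightarrow> V x = y"
  by (rule F_inj) (auto simp: FV)

text \<open>F V is multiplication by pi^k and F has multiplier -pi^k, so the powers of pi cancel: up
  to sign and a Frobenius twist, V is the adjoint of F. All pairings with the G_i are computed by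
  moving V across in this way.\<close>

lemma V_form: "x \<in> CV \<Longrightarrow> y \<in> CV \<Longrightarrow> ip (V x) y = - si (ip x (F y))"
proof -
  assume xy: "x \<in> CV" "y \<in> CV"
  have "- (\<pi> ^ k) * s (ip (V x) y) = ip (F (V x)) (F y)"
    using xy by (simp add: F_form)
  then have eq: "\<pi> ^ k * ip x (F y) = - (\<pi> ^ k) * s (ip (V x) y)"
    using xy by (simp add: FV sform_smult_left)
  have "\<pi> ^ k * (s (ip (V x) y) + ip x (F y)) = 0"
    by (simp add: distrib_left eq)
  then have "s (ip (V x) y) = - ip x (F y)"
    using pi(1) by (simp add: eq_neg_iff_add_eq_0)
  then show ?thesis by (metis si_s si.hom_uminus)
qed

lemma V_V_form: "x \<in> CV \<Longrightarrow> y \<in> CV \<Longrightarrow> ip (V x) (V y) = - (\<pi> ^ k) * si (ip x y)"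
  by (simp add: V_form FV sform_smult_right si.hom_mult)

lemma Fpow_form:
  "x \<in> CV \<Longrightarrow> y \<in> CV \<Longrightarrow> ip ((F ^^ i) x) ((F ^^ i) y) = (- (\<pi> ^ k)) ^ i * (s ^^ i) (ip x y)"
proof (induction i)
  case (Suc i)
  then show ?case
    by (simp add: F_form s.hom_mult s.hom_power s.hom_uminus)
qed simp

section \<open>The matrices $g_{b,r}(v)$\<close>

lemma VsympD:
  assumes "v \<in> Vsymp D"
  shows "v \<in> CV" "i < n \<Longrightarrow> ip v ((F ^^ i) v) = 0" "ip v ((F ^^ n) v) = \<alpha> v" "\<alpha> v \<noteq> 0"
proof -
  show v: "v \<in> CV" "ip v ((F ^^ n) v) = \<alpha> v" "\<alpha> v \<noteq> 0"
    using assms by (auto simp: Vsymp_def alpha_def form_def)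
  show "ip v ((F ^^ i) v) = 0" if "i < n"
    using assms that sform_self[OF v(1)] by (cases "i = 0") (auto simp: Vsymp_def form_def)
qed

lemma VsympI:
  "v \<in> CV \<Longrightarrow> (\<And>i. 1 \<le> i \<Longrightarrow> i < n \<Longrightarrow> ip v ((F ^^ i) v) = 0) \<Longrightarrow> ip v ((F ^^ n) v) \<noteq> 0 \<Longrightarrow> v \<in> Vsymp D"
  by (auto simp: Vsymp_def form_def)

text \<open>The sequence G_i extended to index 0 by G_0 = (-1)^(n+1) v, so that a single recursion
  covers all indices. The sign may be placed at the start because the Frobenius fixes it.\<close>

definition Hvec :: "'a vec \<Rightarrow> nat \<Rightarrow> 'a vec" where
  "Hvec v i = (Gstep D v ^^ i) ((- 1) ^ (n + 1) \<cdot>\<^sub>v v)"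

lemma Gstep_eq: "Gstep D v x = (\<alpha> v / si (\<alpha> v)) \<cdot>\<^sub>v (V x - (ip (V x) ((F ^^ n) v) / \<alpha> v) \<cdot>\<^sub>v v)"
  by (simp add: Gstep_def form_def)

lemma Gstep_carrier [simp]: "v \<in> CV \<Longrightarrow> x \<in> CV \<Longrightarrow> Gstep D v x \<in> CV"
  by (simp add: Gstep_eq)

lemma Gstep_smult:
  assumes v: "v \<in> CV" and x: "x \<in> CV"
  shows "Gstep D v (c \<cdot>\<^sub>v x) = si c \<cdot>\<^sub>v Gstep D v x"
  unfolding Gstep_eq using assms
  by (intro eq_vecI) (auto simp: V_smult sform_smult_left right_diff_distrib carrier_vecD[OF V_carrier])

lemma Hvec_0: "Hvec v 0 = (- 1) ^ (n + 1) \<cdot>\<^sub>v v"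
  by (simp add: Hvec_def)

lemma Hvec_Suc: "Hvec v (Suc i) = Gstep D v (Hvec v i)"
  by (simp add: Hvec_def)

lemma Hvec_carrier [simp]: "v \<in> CV \<Longrightarrow> Hvec v i \<in> CV"
  by (induction i) (auto simp: Hvec_0 Hvec_Suc)

lemma Gvec_Hvec: "v \<in> CV \<Longrightarrow> Gvec D v (Suc i) = Hvec v (Suc i)"
  by (simp add: Gvec_def Hvec_def funpow_Suc_right Gstep_smult si.hom_mult si.hom_power si.hom_uminus
      del: funpow.simps)

text \<open>Induction on i: adjunction replaces the pair (i+1, j) by (i, j+1). The subtracted
  multiple of v kills the pairing with F^n v and does not affect j < n, where v is orthogonal to F^j
  v; the factor alpha/sigma^(-1)(alpha) undoes the twist of alpha.\<close>

lemma Hvec_Fpow: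
  assumes v: "v \<in> Vsymp D" and "i < n" "j \<le> n"
  shows "ip (Hvec v i) ((F ^^ j) v) = (if i + j = n then (- 1) ^ (n + 1 + i) * \<alpha> v else 0)"
  using assms(2,3)
proof (induction i arbitrary: j)
  case 0
  then show ?case using VsympD[OF v] by (simp add: Hvec_0 sform_smult_left)
next
  case (Suc i)
  note vD = VsympD[OF v]
  have "ip (Hvec v (Suc i)) ((F ^^ j) v) = (\<alpha> v / si (\<alpha> v)) * (ip (V (Hvec v i)) ((F ^^ j) v)
      - (ip (V (Hvec v i)) ((F ^^ n) v) / \<alpha> v) * ip v ((F ^^ j) v))"
    using vD by (simp add: Hvec_Suc Gstep_eq sform_smult_left sform_diff_left)
  also have "\<dots> = (if Suc i + j = n then (- 1) ^ (n + 1 + Suc i) * \<alpha> v else 0)"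
  proof (cases "j = n")
    case True
    then show ?thesis using vD by simp
  next
    case False
    then have j: "j < n" using Suc by simp
    have "ip (V (Hvec v i)) ((F ^^ j) v) = - si (ip (Hvec v i) ((F ^^ Suc j) v))"
      using vD by (simp add: V_form)
    also have "\<dots> = (if Suc i + j = n then (- 1) ^ (n + 1 + Suc i) * si (\<alpha> v) else 0)"
      using Suc.IH[of "Suc j"] Suc.prems j
      by (simp add: si.hom_mult si.hom_power si.hom_uminus del: funpow.simps)
    finally show ?thesis using vD j by simp
  qed
  finally show ?case .
qed

lemma Hvec_v:
  assumes v: "v \<in> Vsymp D" and "i < n"
  shows "ip (Hvec v i) v = 0"
  using Hvec_Fpow[OF assms, of 0] assms(2) by simp

lemma V_Hvec_v:
  assumes v: "v \<in> Vsymp D" and "Suc i < n"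
  shows "ip (V (Hvec v i)) v = 0"
  using Hvec_Fpow[OF v, of i 1] assms VsympD[OF v] by (simp add: V_form)

text \<open>V preserves orthogonality by \<open>V_V_form\<close>, and the correction terms are
  multiples of v, which is orthogonal to each V(G_i) in the relevant range.\<close>

lemma Hvec_Hvec:
  assumes v: "v \<in> Vsymp D" and "i < n" "j < n"
  shows "ip (Hvec v i) (Hvec v j) = 0"
  using assms(2,3)
proof (induction i arbitrary: j)
  case 0
  then show ?case
    using Hvec_v[OF v, of j] VsympD[OF v] sform_swap[of v n "Hvec v j"]
    by (simp add: Hvec_0 sform_smult_left)
next
  case (Suc i)
  note vD = VsympD[OF v]
  show ?case
  proof (cases j)
    case 0
    then show ?thesis
      using Hvec_v[OF v, of "Suc i"] vD Suc.prems by (simp add: Hvec_0 sform_smult_right)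
  next
    case (Suc j')
    have 1: "ip (V (Hvec v i)) (V (Hvec v j')) = 0"
      using Suc.IH[of j'] Suc.prems Suc vD by (simp add: V_V_form)
    have 2: "ip (V (Hvec v i)) v = 0" "ip (V (Hvec v j')) v = 0"
      using V_Hvec_v[OF v] Suc.prems Suc by auto
    have 3: "ip v (V (Hvec v j')) = 0"
      using 2 sform_swap[of v n "V (Hvec v j')"] vD by simp
    show ?thesis
      using 1 2 3 vD sform_self[of v n] unfolding Suc
      by (simp add: Hvec_Suc Gstep_eq sform_smult_left sform_smult_right sform_diff_left sform_diff_right)
  qed
qed

definition gcol :: "nat \<Rightarrow> 'a vec \<Rightarrow> nat \<Rightarrow> 'a vec" where
  "gcol r v j = (if j < n then \<pi> ^ (j * r) \<cdot>\<^sub>v (F ^^ j) v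
     else if j < 2 * n - 1 then \<pi> ^ ((j - n + 1) * r) \<cdot>\<^sub>v Hvec v (j - n + 1)
     else \<pi> ^ (n * r) \<cdot>\<^sub>v (F ^^ n) v)"

lemma gcol_carrier [simp]: "v \<in> CV \<Longrightarrow> gcol r v j \<in> CV"
  by (simp add: gcol_def)

lemma gmat_carrier [simp]: "gmat D r v \<in> CM"
  using n_pos unfolding gmat_def by (intro carrier_matI) auto

lemma gmat_col:
  assumes v: "v \<in> CV" and j: "j < 2 * n"
  shows "col (gmat D r v) j = gcol r v j"
proof -
  let ?L = "map (\<lambda>i. \<pi> ^ (i * r) \<cdot>\<^sub>v (F ^^ i) v) [0..<n] @
      map (\<lambda>i. \<pi> ^ (i * r) \<cdot>\<^sub>v Gvec D v i) [1..<n] @ [\<pi> ^ (n * r) \<cdot>\<^sub>v (F ^^ n) v]"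
  have nth: "?L ! j = gcol r v j"
    using j n_pos Gvec_Hvec[OF v, of "j - n"]
    by (auto simp: gcol_def nth_append Suc_diff_le nth_Cons' less_diff_conv)
  show ?thesis
    unfolding gmat_def using j n_pos v nth by (subst col_mat_of_cols) auto
qed

text \<open>Extracting the smaller power of F leaves a pairing of v with F^l v where l is the gap.
  Only the gap n survives, and it forces i = 0 and j = n.\<close>

lemma Fpow_Fpow:
  assumes v: "v \<in> Vsymp D" and "i < n" "j \<le> n"
  shows "ip ((F ^^ i) v) ((F ^^ j) v) = (if i = 0 \<and> j = n then \<alpha> v else 0)"
proof -
  note vD = VsympD[OF v]
  have *: "ip ((F ^^ i) v) ((F ^^ (i + l)) v) = (if i = 0 \<and> i + l = n then \<alpha> v else 0)"
    if "i + l \<le> n" for i l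
  proof -
    have zero: "(s ^^ i) 0 = 0" for i by (induction i) auto
    have "ip ((F ^^ i) v) ((F ^^ (i + l)) v) = (- (\<pi> ^ k)) ^ i * (s ^^ i) (ip v ((F ^^ l) v))"
      using Fpow_form[of v "(F ^^ l) v" i] vD by (simp add: funpow_add)
    moreover have "l < n \<or> (i = 0 \<and> l = n)" using that by auto
    ultimately show ?thesis using vD zero n_pos by auto
  qed
  show ?thesis
  proof (cases "i \<le> j")
    case True
    then show ?thesis using *[of i "j - i"] assms(3) by (simp split: if_splits)
  next
    case False
    then have "ip ((F ^^ j) v) ((F ^^ i) v) = 0" using *[of j "i - j"] assms by simp
    then show ?thesis using False vD sform_swap[of "(F ^^ i) v" n "(F ^^ j) v"] by simp
  qed
qed

text \<open>Columns i and 2n-1-i carry powers of pi whose exponents add up to n r; this makes the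
  multiplier the same for all reflected pairs.\<close>

lemma gcol_form_le:
  assumes v: "v \<in> Vsymp D" and ij: "i < 2 * n" "j < 2 * n" and le: "i \<le> j"
  shows "ip (gcol r v i) (gcol r v j) = (if j = 2 * n - Suc i then (- 1) ^ i * (\<pi> ^ (n * r) * \<alpha> v) else 0)"
proof -
  note vD = VsympD[OF v]
  note sm = sform_smult_left sform_smult_right
  consider (a) "i < n" "j < n" | (b) "i < n" "n \<le> j" "j < 2 * n - 1" | (c) "i < n" "j = 2 * n - 1"
    | (d) "n \<le> i" "i < 2 * n - 1" "j < 2 * n - 1" | (e) "n \<le> i" "i < 2 * n - 1" "j = 2 * n - 1"
    | (f) "i = 2 * n - 1" "j = 2 * n - 1"
    using ij le by linarith
  then show ?thesis
  proof cases
    case a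
    then show ?thesis using Fpow_Fpow[OF v, of i j] vD by (simp add: gcol_def sm)
  next
    case b
    define l where "l = j - n + 1"
    have l: "l < n" "j = n + l - 1" "1 \<le> l" using b l_def by auto
    have "ip ((F ^^ i) v) (Hvec v l) = - (if l + i = n then (- 1) ^ (n + 1 + l) * \<alpha> v else 0)"
      using Hvec_Fpow[OF v l(1), of i] b vD sform_swap[of "(F ^^ i) v" n "Hvec v l"] by simp
    then have "ip (gcol r v i) (gcol r v j) = \<pi> ^ (i * r) * (\<pi> ^ (l * r) *
        (if l + i = n then (- 1) ^ (n + l) * \<alpha> v else 0))"
      using b vD by (simp add: gcol_def sm l_def)
    also have "\<dots> = (if j = 2 * n - Suc i then (- 1) ^ i * (\<pi> ^ (n * r) * \<alpha> v) else 0)"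
    proof (cases "l + i = n")
      case True
      then have "n * r = i * r + l * r" by (metis add_mult_distrib add.commute)
      moreover have "(- 1 :: 'a) ^ (n + l) = (- 1) ^ i"
      proof -
        have "n + l = i + 2 * l" using True by simp
        then show ?thesis by (simp add: power_add power_mult)
      qed
      moreover have "j = 2 * n - Suc i" using True l by simp
      ultimately show ?thesis using True by (simp add: power_add mult_ac)
    next
      case False
      then have "j \<noteq> 2 * n - Suc i" using b l by auto
      then show ?thesis using False by simp
    qed
    finally show ?thesis .
  next
    case c
    then show ?thesis using Fpow_Fpow[OF v, of i n] vD by (auto simp: gcol_def sm)
  next
    case d
    then show ?thesis using Hvec_Hvec[OF v, of "i - n + 1" "j - n + 1"] vD le by (auto simp: gcol_def sm)
  next
    case e
    then show ?thesis using Hvec_Fpow[OF v, of "i - n + 1" n] vD by (auto simp: gcol_def sm)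
  next
    case f
    then show ?thesis using vD n_pos by (auto simp: gcol_def sm sform_self)
  qed
qed

lemma gcol_form:
  assumes v: "v \<in> Vsymp D" and ij: "i < 2 * n" "j < 2 * n"
  shows "ip (gcol r v i) (gcol r v j) =
    - (\<pi> ^ (n * r) * \<alpha> v) * (if j = 2 * n - Suc i then - ((- 1) ^ i) else 0)"
proof (cases "i \<le> j")
  case True
  then show ?thesis using gcol_form_le[OF assms True] by simp
next
  case False
  then have "ip (gcol r v j) (gcol r v i) = (if i = 2 * n - Suc j then (- 1) ^ j * (\<pi> ^ (n * r) * \<alpha> v) else 0)"
    using gcol_form_le[OF v ij(2,1)] by simp
  moreover have "ip (gcol r v i) (gcol r v j) = - ip (gcol r v j) (gcol r v i)"
    by (rule sform_swap) (use VsympD[OF v] in auto)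
  moreover have "(- 1 :: 'a) ^ j = - ((- 1) ^ i)" if "j = 2 * n - Suc i"
    using minus_one_reflect[OF ij(1)] that by simp
  ultimately show ?thesis using ij by auto
qed

lemma gmat_similitude:
  assumes v: "v \<in> Vsymp D"
  shows "similitude_by n (gmat D r v) (- (\<pi> ^ (n * r) * \<alpha> v))"
  using VsympD[OF v] pi gcol_form[OF v]
  by (subst similitude_by_iff_cols) (auto simp: gmat_col)

lemma gmat_GSp: "v \<in> Vsymp D \<Longrightarrow> gmat D r v \<in> carrier (GSp n)"
  using gmat_similitude gmat_carrier by (blast intro: GSp_memI)

section \<open>Equivariance\<close>

lemma eq_mat_colI:
  assumes "A \<in> carrier_mat m l" "B \<in> carrier_mat m l" "\<And>j. j < l \<Longrightarrow> col A j = col B j"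
  shows "A = B"
  by (rule mat_col_eqI) (use assms in auto)

lemma CM_mult [simp]: "g \<in> CM \<Longrightarrow> h \<in> CM \<Longrightarrow> g * h \<in> CM"
  by (rule mult_carrier_mat)

lemma CM_assoc: "g \<in> CM \<Longrightarrow> h \<in> CM \<Longrightarrow> l \<in> CM \<Longrightarrow> g * h * l = g * (h * l)"
  by (rule assoc_mult_mat)

lemma CM_one [simp]: "g \<in> CM \<Longrightarrow> 1\<^sub>m (2 * n) * g = g" "g \<in> CM \<Longrightarrow> g * 1\<^sub>m (2 * n) = g"
  by auto

lemma s_mat_mult: "g \<in> CM \<Longrightarrow> h \<in> CM \<Longrightarrow> map_mat s (g * h) = map_mat s g * map_mat s h"
  by (rule s.mat_hom_mult)

lemma s_mat_one [simp]: "map_mat s (1\<^sub>m m) = 1\<^sub>m m"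
  by (rule s.mat_hom_one)

lemma s_vec_mult: "g \<in> CM \<Longrightarrow> x \<in> CV \<Longrightarrow> map_vec s (g *\<^sub>v x) = map_mat s g *\<^sub>v map_vec s x"
  by (rule s.mult_mat_vec_hom)

lemma J_comm:
  assumes "j \<in> J_grp D"
  shows "j \<in> carrier (GSp n)" "j \<in> CM" "b * map_mat s j = j * b"
proof -
  show j: "j \<in> carrier (GSp n)" and jm: "j \<in> CM"
    using assms GSp_carrier_mat by (auto simp: J_grp_def)
  have inv: "inv\<^bsub>GSp n\<^esub> j \<in> CM" using GSp_inv_closed[OF j] GSp_carrier_mat by blast
  have "j * b = j * (inv\<^bsub>GSp n\<^esub> j * b * map_mat s j)"
    using assms by (simp add: J_grp_def)
  also have "\<dots> = (j * inv\<^bsub>GSp n\<^esub> j) * (b * map_mat s j)"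
    using inv jm by (simp add: CM_assoc)
  finally show "b * map_mat s j = j * b" using GSp_inv_right[OF j] jm by simp
qed

lemma J_I:
  assumes j: "j \<in> carrier (GSp n)" and "b * map_mat s j = j * b"
  shows "j \<in> J_grp D"
proof -
  have jm: "j \<in> CM" "inv\<^bsub>GSp n\<^esub> j \<in> CM" using j GSp_inv_closed[OF j] GSp_carrier_mat by blast+
  have "inv\<^bsub>GSp n\<^esub> j * b * map_mat s j = (inv\<^bsub>GSp n\<^esub> j * j) * b"
    using jm assms(2) by (simp add: CM_assoc)
  then show ?thesis using GSp_inv_left[OF j] j by (simp add: J_grp_def)
qed

lemma J_inv:
  assumes "j \<in> J_grp D"
  shows "inv\<^bsub>GSp n\<^esub> j \<in> J_grp D"
proof (rule J_I)
  note j = J_comm[OF assms]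
  let ?i = "inv\<^bsub>GSp n\<^esub> j"
  show "?i \<in> carrier (GSp n)" using GSp_inv_closed j by blast
  then have im: "?i \<in> CM" using GSp_carrier_mat by blast
  note as = CM_assoc
  have "?i * b = ?i * b * (map_mat s (j * ?i))" using im GSp_inv_right[OF j(1)] by simp
  also have "\<dots> = ?i * (b * map_mat s j) * map_mat s ?i" using im j(2) by (simp add: s_mat_mult as)
  also have "\<dots> = (?i * j) * b * map_mat s ?i" using im j(2,3) by (simp add: as)
  finally show "b * map_mat s ?i = ?i * b" using GSp_inv_left[OF j(1)] im by simp
qed

lemma J_F: "j \<in> J_grp D \<Longrightarrow> x \<in> CV \<Longrightarrow> F (j *\<^sub>v x) = j *\<^sub>v F x"
  using J_comm[of j] by (simp add: Fop_def s_vec_mult flip: assoc_mult_mat_vec[of _ "2 * n" "2 * n" _ "2 * n"])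

lemma J_Fpow: "j \<in> J_grp D \<Longrightarrow> x \<in> CV \<Longrightarrow> (F ^^ i) (j *\<^sub>v x) = j *\<^sub>v (F ^^ i) x"
  by (induction i) (auto simp: J_F)

lemma J_V: "j \<in> J_grp D \<Longrightarrow> x \<in> CV \<Longrightarrow> V (j *\<^sub>v x) = j *\<^sub>v V x"
  by (rule V_eqI) (auto simp: J_comm J_F FV mult_mat_vec[OF J_comm(2)])

text \<open>Comparing multipliers in b sigma(j) = j b. Because the multiplier c of j is
  Frobenius-fixed, alpha scales by c while alpha/sigma^(-1)(alpha) and sigma(alpha)/alpha are
  unchanged.\<close>

lemma J_similitude:
  assumes "j \<in> J_grp D"
  obtains c where "similitude_by n j c" "c \<noteq> 0" "s c = c"
proof -
  note j = J_comm[OF assms]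
  obtain c where c: "similitude_by n j c" "c \<noteq> 0" using j(1) by (rule GSp_memE)
  have "similitude_by n (b * map_mat s j) (- (\<pi> ^ k) * s c)"
    using j c by (intro similitude_by_mult b_similitude similitude_by_map s_hom) auto
  moreover have "similitude_by n (j * b) (c * - (\<pi> ^ k))"
    using j c by (intro similitude_by_mult b_similitude) auto
  ultimately have "- (\<pi> ^ k) * s c = c * - (\<pi> ^ k)"
    unfolding j(3) using similitude_by_unique[OF n_pos(1)] j(2) by (metis CM_mult b_carrier)
  then have "\<pi> ^ k * s c = \<pi> ^ k * c" by (simp add: mult.commute)
  then have "s c = c" using pi by (simp only: mult_cancel_left power_eq_0_iff) simp
  then show ?thesis using that c by blast
qed

context
  fixes j c
  assumes J: "j \<in> J_grp D" and c: "similitude_by n j c" "c \<noteq> 0" "s c = c"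
begin

lemma J_form: "x \<in> CV \<Longrightarrow> y \<in> CV \<Longrightarrow> ip (j *\<^sub>v x) (j *\<^sub>v y) = c * ip x y"
  by (rule similitude_byD[OF c(1)])

lemma J_alpha: "v \<in> CV \<Longrightarrow> \<alpha> (j *\<^sub>v v) = c * \<alpha> v"
  by (simp add: alpha_def form_def J_Fpow[OF J] J_form)

lemma J_Vsymp: "v \<in> Vsymp D \<Longrightarrow> j *\<^sub>v v \<in> Vsymp D"
  using J_comm[OF J] c VsympD[of v] by (intro VsympI) (auto simp: J_Fpow[OF J] J_form)

lemma J_Gstep:
  assumes "v \<in> CV" "x \<in> CV" "\<alpha> v \<noteq> 0"
  shows "Gstep D (j *\<^sub>v v) (j *\<^sub>v x) = j *\<^sub>v Gstep D v x"
proof -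
  have jm: "j \<in> CM" by (rule J_comm[OF J])
  have "si c = c" using c si_s by metis
  then show ?thesis
    using assms jm c
    by (simp add: Gstep_eq J_alpha J_V[OF J] J_Fpow[OF J] J_form si.hom_mult mult_mat_vec[OF jm]
        mult_minus_distrib_mat_vec[OF jm])
qed

lemma J_Hvec: "v \<in> Vsymp D \<Longrightarrow> Hvec (j *\<^sub>v v) i = j *\<^sub>v Hvec v i"
  using VsympD[of v] by (induction i) (auto simp: Hvec_0 Hvec_Suc J_Gstep mult_mat_vec[OF J_comm(2)[OF J]])

lemma J_gmat:
  assumes v: "v \<in> Vsymp D"
  shows "gmat D r (j *\<^sub>v v) = j * gmat D r v"
proof (rule eq_mat_colI)
  have jm: "j \<in> CM" by (rule J_comm[OF J])
  show "j * gmat D r v \<in> CM" using jm by simp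
  fix i assume i: "i < 2 * n"
  have "col (j * gmat D r v) i = j *\<^sub>v gcol r v i"
    using i VsympD[OF v] by (simp add: gmat_col col_mult2[OF jm gmat_carrier])
  moreover have "gcol r (j *\<^sub>v v) i = j *\<^sub>v gcol r v i"
    using VsympD[OF v] by (auto simp: gcol_def J_Fpow[OF J] J_Hvec[OF v] mult_mat_vec[OF jm])
  ultimately show "col (gmat D r (j *\<^sub>v v)) i = col (j * gmat D r v) i"
    using i VsympD[OF v] jm by (simp add: gmat_col)
qed simp

end

section \<open>Rescaling\<close>

lemma Fpow_smult: "x \<in> CV \<Longrightarrow> (F ^^ i) (c \<cdot>\<^sub>v x) = (s ^^ i) c \<cdot>\<^sub>v (F ^^ i) x"
  by (induction i) (auto simp: F_smult)

lemma s_pow_eq_0 [simp]: "(s ^^ i) c = 0 \<longleftrightarrow> c = 0"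
  by (induction i) auto

lemma smult_Vsymp: "v \<in> Vsymp D \<Longrightarrow> c \<noteq> 0 \<Longrightarrow> c \<cdot>\<^sub>v v \<in> Vsymp D"
  using VsympD[of v] by (intro VsympI) (auto simp: Fpow_smult sform_smult_left sform_smult_right)

lemma alpha_smult: "v \<in> CV \<Longrightarrow> \<alpha> (c \<cdot>\<^sub>v v) = c * (s ^^ n) c * \<alpha> v"
  by (simp add: alpha_def form_def Fpow_smult sform_smult_left sform_smult_right)

text \<open>All ingredients of the recursion are semilinear, so rescaling v only changes each column
  by some nonzero scalar. Thus the matrices of v and of c v differ by a diagonal matrix, which lies
  in the Borel subgroup.\<close>

lemma Gstep_rescale:
  assumes v: "v \<in> Vsymp D" and x: "x \<in> CV" and c: "c \<noteq> 0" "a \<noteq> 0"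
  shows "\<exists>a'. a' \<noteq> 0 \<and> Gstep D (c \<cdot>\<^sub>v v) (a \<cdot>\<^sub>v x) = a' \<cdot>\<^sub>v Gstep D v x"
proof -
  note vD = VsympD[OF v]
  let ?al = "\<alpha> (c \<cdot>\<^sub>v v)"
  let ?a = "?al / si ?al * si a * (si (\<alpha> v) / \<alpha> v)"
  have al: "?al = c * (s ^^ n) c * \<alpha> v" using vD by (simp add: alpha_smult)
  have al0: "?al \<noteq> 0" using al vD c by simp
  have coef: "ip (V (a \<cdot>\<^sub>v x)) ((F ^^ n) (c \<cdot>\<^sub>v v)) / ?al * c = si a * (ip (V x) ((F ^^ n) v) / \<alpha> v)"
    unfolding al using vD x c
    by (simp add: V_smult Fpow_smult sform_smult_left sform_smult_right)
  have "Gstep D (c \<cdot>\<^sub>v v) (a \<cdot>\<^sub>v x) = (?al / si ?al) \<cdot>\<^sub>v (V (a \<cdot>\<^sub>v x)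
      - (ip (V (a \<cdot>\<^sub>v x)) ((F ^^ n) (c \<cdot>\<^sub>v v)) / ?al * c) \<cdot>\<^sub>v v)"
    by (simp add: Gstep_eq smult_smult_assoc)
  also have "\<dots> = (?al / si ?al * si a) \<cdot>\<^sub>v (V x - (ip (V x) ((F ^^ n) v) / \<alpha> v) \<cdot>\<^sub>v v)"
    unfolding coef using vD x
    by (intro eq_vecI) (auto simp: V_smult carrier_vecD[OF V_carrier] right_diff_distrib mult.assoc)
  also have "\<dots> = ?a \<cdot>\<^sub>v Gstep D v x"
    using vD by (simp add: Gstep_eq smult_smult_assoc)
  finally show ?thesis using al0 vD c by (intro exI[of _ ?a]) auto
qed

lemma Hvec_rescale:
  assumes v: "v \<in> Vsymp D" and c: "c \<noteq> 0"
  shows "\<exists>a. a \<noteq> 0 \<and> Hvec (c \<cdot>\<^sub>v v) i = a \<cdot>\<^sub>v Hvec v i"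
proof (induction i)
  case 0
  show ?case using c by (intro exI[of _ c]) (simp add: Hvec_0 smult_smult_assoc mult.commute)
next
  case (Suc i)
  then obtain a where "a \<noteq> 0" "Hvec (c \<cdot>\<^sub>v v) i = a \<cdot>\<^sub>v Hvec v i" by blast
  then show ?case
    using Gstep_rescale[OF v Hvec_carrier c] VsympD[OF v] by (simp add: Hvec_Suc)
qed

lemma gcol_rescale:
  assumes v: "v \<in> Vsymp D" and c: "c \<noteq> 0"
  shows "\<exists>a. a \<noteq> 0 \<and> gcol r (c \<cdot>\<^sub>v v) j = a \<cdot>\<^sub>v gcol r v j"
proof -
  obtain a where a: "a \<noteq> 0" "Hvec (c \<cdot>\<^sub>v v) (j - n + 1) = a \<cdot>\<^sub>v Hvec v (j - n + 1)"
    using Hvec_rescale[OF assms] by blast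
  then have "\<exists>a. a \<noteq> 0 \<and> \<pi> ^ l \<cdot>\<^sub>v Hvec (c \<cdot>\<^sub>v v) (j - n + 1) = a \<cdot>\<^sub>v (\<pi> ^ l \<cdot>\<^sub>v Hvec v (j - n + 1))" for l
    by (intro exI[of _ a]) (simp add: smult_smult_assoc mult.commute)
  moreover have "\<exists>a. a \<noteq> 0 \<and> \<pi> ^ l \<cdot>\<^sub>v (F ^^ i) (c \<cdot>\<^sub>v v) = a \<cdot>\<^sub>v (\<pi> ^ l \<cdot>\<^sub>v (F ^^ i) v)" for l i
    using c VsympD[OF v] by (intro exI[of _ "(s ^^ i) c"]) (simp add: Fpow_smult smult_smult_assoc mult.commute)
  ultimately show ?thesis by (auto simp: gcol_def)
qed

section \<open>The element $w_r$\<close>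

definition wcol :: "nat \<Rightarrow> nat \<Rightarrow> 'a vec" where
  "wcol r j = (if j < n - 1 then inverse (\<pi> ^ r) \<cdot>\<^sub>v e (j + 1)
     else if j = n - 1 then inverse (\<pi> ^ r) \<cdot>\<^sub>v e (2 * n - 1)
     else if j = n then ((- 1) ^ (n + 1) * \<pi> ^ (r + k)) \<cdot>\<^sub>v e 0
     else \<pi> ^ (r + k) \<cdot>\<^sub>v e (j - 1))"

lemma wmat_carrier [simp]: "wmat D r \<in> CM"
  unfolding wmat_def Let_def by (intro carrier_matI) auto

lemma wmat_col:
  assumes "j < 2 * n"
  shows "col (wmat D r) j = wcol r j"
proof -
  have [simp]: "\<pi> powi - int r = inverse (\<pi> ^ r)" by (simp add: power_int_minus)
  have nth: "map f [1..<2 * n + 1] ! j = f (Suc j)" for f :: "nat \<Rightarrow> 'a vec"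
    using assms by (simp del: upt_Suc)
  show ?thesis
    unfolding wmat_def Let_def
  proof (subst col_mat_of_cols, goal_cases)
    case 3
    show ?case
      unfolding nth using assms n_pos by (auto simp: basis_vec_def wcol_def)
  qed (use assms in \<open>simp_all add: nth basis_vec_def del: upt_Suc\<close>)
qed

lemma wcol_carrier [simp]: "wcol r j \<in> CV"
  by (simp add: wcol_def)

text \<open>The matrix is monomial: column i is \<open>f i\<close> times the unit vector at
  \<open>t i\<close>. The permutation t commutes with i -> 2n-1-i, so only reflected pairs of
  columns have nonzero pairing, and their scalars multiply to pi^k up to sign.\<close>

lemma wmat_similitude: "similitude_by n (wmat D r) (- (\<pi> ^ k))"
proof (subst similitude_by_iff_cols[OF wmat_carrier], intro conjI allI impI)
  show "- (\<pi> ^ k) \<noteq> 0" using pi by simp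
  fix i j assume ij: "i < 2 * n" "j < 2 * n"
  have u: "inverse (\<pi> ^ r) * \<pi> ^ (r + k) = \<pi> ^ k" "\<pi> ^ (r + k) * inverse (\<pi> ^ r) = \<pi> ^ k"
    using pi by (simp_all add: power_add)
  define t where "t i = (if i < n - 1 then i + 1 else if i = n - 1 then 2 * n - 1 else if i = n then 0 else i - 1)" for i
  define f where "f i = (if i < n then inverse (\<pi> ^ r) else if i = n then (- 1) ^ (n + 1) * \<pi> ^ (r + k) else \<pi> ^ (r + k))" for i
  have wc: "wcol r i = f i \<cdot>\<^sub>v e (t i)" "t i < 2 * n" if "i < 2 * n" for i
    using that n_pos by (auto simp: wcol_def t_def f_def)
  \<comment> \<open>A left inverse of t, used only to see that t is injective.\<close>
  define t' where "t' p = (if p = 0 then n else if p < n then p - 1 else if p < 2 * n - 1 then p + 1 else n - 1)" for p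
  have t': "t' (t i) = i" if "i < 2 * n" for i
    using that n_pos
    by (cases "i < n - 1"; cases "i = n - 1"; cases "i = n") (auto simp: t_def t'_def)
  have t_reflect: "t (2 * n - Suc i) = 2 * n - Suc (t i)"
  proof -
    consider "i < n - 1" | "i = n - 1" | "i = n" | "n < i" by linarith
    then show ?thesis
    proof cases
      case 1
      then have "\<not> 2 * n - Suc i < n - 1" "2 * n - Suc i \<noteq> n - 1" "2 * n - Suc i \<noteq> n" by linarith+
      then show ?thesis using 1 by (simp add: t_def)
    next
      case 2
      then have "2 * n - Suc i = n" "\<not> n < n - 1" "n \<noteq> n - 1" using n_pos by linarith+
      then show ?thesis using 2 n_pos by (simp add: t_def)
    next
      case 3
      then have "2 * n - Suc i = n - 1" "\<not> n < n - 1" "n \<noteq> n - 1" using n_pos by linarith+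
      then show ?thesis using 3 by (simp add: t_def)
    next
      case 4
      then have "2 * n - Suc i < n - 1" "\<not> i < n - 1" "i \<noteq> n - 1" "i \<noteq> n" using ij by linarith+
      moreover have "2 * n - Suc i + 1 = 2 * n - Suc (i - 1)" using 4 ij by linarith
      ultimately show ?thesis by (simp add: t_def)
    qed
  qed
  have "ip (wcol r i) (wcol r j) = f i * (f j * (if t j = 2 * n - Suc (t i) then - ((- 1) ^ t i) else 0))"
    using wc ij by (simp add: sform_smult_left sform_smult_right sform_unit_unit)
  also have "\<dots> = - (\<pi> ^ k) * (if j = 2 * n - Suc i then - ((- 1) ^ i) else 0)"
  proof (cases "j = 2 * n - Suc i")
    case False
    have "t j \<noteq> 2 * n - Suc (t i)"
    proof
      assume "t j = 2 * n - Suc (t i)"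
      then have "t j = t (2 * n - Suc i)" by (simp add: t_reflect)
      then have "t' (t j) = t' (t (2 * n - Suc i))" by (simp only:)
      moreover have "2 * n - Suc i < 2 * n" using ij by simp
      ultimately have "j = 2 * n - Suc i" by (simp only: t'[OF ij(2)] t')
      then show False using False by simp
    qed
    then show ?thesis using False by simp
  next
    case True
    then have tj: "t j = 2 * n - Suc (t i)" by (simp add: t_reflect)
    have "f i * f j * - ((- 1) ^ t i) = - (\<pi> ^ k) * - ((- 1) ^ i)"
    proof -
      consider "i < n - 1" | "i = n - 1" | "i = n" | "n < i" by linarith
      then show ?thesis
      proof cases
        case 1
        then have "f i = inverse (\<pi> ^ r)" "f j = \<pi> ^ (r + k)" "t i = i + 1"
          using True by (auto simp: f_def t_def)
        then show ?thesis using u by simp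
      next
        case 2
        \<comment> \<open>This pair accounts for the sign (-1)^(n+1) in the definition of w_r:
          column n-1 goes to the odd position 2n-1, and the sign restores the required parity of
          n-1.\<close>
        have n1: "(- 1 :: 'a) ^ (n + 1) = (- 1) ^ i" using 2 n_pos by (cases n) auto
        have "f i = inverse (\<pi> ^ r)" "f j = (- 1) ^ i * \<pi> ^ (r + k)" and ti: "t i = 2 * n - 1"
          unfolding n1[symmetric] using 2 True n_pos by (auto simp: f_def t_def)
        then have "f i * f j = (- 1) ^ i * (inverse (\<pi> ^ r) * \<pi> ^ (r + k))" by simp
        moreover have "(- 1 :: 'a) ^ (2 * n - 1) = - 1" using n_pos minus_one_reflect[of 0 n] by simp
        ultimately show ?thesis unfolding u ti by simp
      next
        case 3
        then have "f i = (- 1) ^ (n + 1) * \<pi> ^ (r + k)" "f j = inverse (\<pi> ^ r)" "t i = 0"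
          using True n_pos by (auto simp: f_def t_def)
        then show ?thesis using u 3 by (simp add: mult.assoc)
      next
        case 4
        then have "f i = \<pi> ^ (r + k)" "f j = inverse (\<pi> ^ r)" "t i = i - 1"
          using True ij by (auto simp: f_def t_def)
        moreover have "(- 1 :: 'a) ^ i = - ((- 1) ^ (i - 1))" using 4 by (cases i) auto
        ultimately show ?thesis using u by simp
      qed
    qed
    then show ?thesis using True tj by (simp add: mult.assoc)
  qed
  finally show "ip (col (wmat D r) i) (col (wmat D r) j) = - (\<pi> ^ k) * (if j = 2 * n - Suc i then - ((- 1) ^ i) else 0)"
    using ij by (simp add: wmat_col)
qed

lemma wmat_GSp: "wmat D r \<in> carrier (GSp n)"
  using wmat_similitude wmat_carrier by (blast intro: GSp_memI)

section \<open>The relative position of $g_{b,r}(v)$\<close>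

text \<open>The coefficient of F v that appears when F is applied to column n + l of the matrix:
  pi^((l+1)r) is the scaling of that column, while F v itself is unscaled.\<close>

definition tcoef :: "nat \<Rightarrow> 'a vec \<Rightarrow> nat \<Rightarrow> 'a" where
  "tcoef r v l = \<pi> ^ (Suc l * r) * (ip (Hvec v l) ((F ^^ Suc n) v) / \<alpha> v)"

context
  fixes v :: "'a vec" and r :: nat
  assumes v: "v \<in> Vsymp D"
begin

text \<open>The factor pi^(-r) in w_r matches the growth of the exponents from one column to the
  next; for j = n-1 the next iterate of F sits in the last column. Hence the first n columns of beta
  are unit vectors.\<close>

lemma gmat_wcol_lt:
  assumes "j < n"
  shows "gmat D r v *\<^sub>v wcol r j = F (gcol r v j)"
proof -
  note vD = VsympD[OF v]
  have col: "gmat D r v *\<^sub>v e i = gcol r v i" if "i < 2 * n" for i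
    using that vD by (simp add: col_eq_mult_unit[OF gmat_carrier] gmat_col)
  have u: "inverse (\<pi> ^ r) * \<pi> ^ (r + i) = \<pi> ^ i" for i using pi by (simp add: power_add)
  show ?thesis
  proof (cases "j < n - 1")
    case True
    then have "Suc j < n" "j < n" by auto
    then show ?thesis
      using True vD u[of "j * r"]
      by (simp add: wcol_def mult_mat_vec[OF gmat_carrier] col gcol_def F_smult smult_smult_assoc)
  next
    case False
    then have j: "j = n - 1" and nj: "n = Suc j" using assms by auto
    have Fn: "(F ^^ n) v = F ((F ^^ j) v)" unfolding nj by simp
    have nr: "n * r = r + j * r" using nj by simp
    have "wcol r j = inverse (\<pi> ^ r) \<cdot>\<^sub>v e (2 * n - 1)" using j by (simp add: wcol_def)
    moreover have "2 * n - 1 < 2 * n" using n_pos by simp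
    moreover have "gcol r v (2 * n - 1) = \<pi> ^ (r + j * r) \<cdot>\<^sub>v F ((F ^^ j) v)"
      using n_pos unfolding gcol_def Fn nr by auto
    moreover have "F (gcol r v j) = \<pi> ^ (j * r) \<cdot>\<^sub>v F ((F ^^ j) v)"
      using assms vD by (simp add: gcol_def F_smult)
    ultimately show ?thesis
      using vD u[of "j * r"] by (simp add: mult_mat_vec[OF gmat_carrier] col smult_smult_assoc)
  qed
qed

lemma gmat_wcol_ge:
  assumes "i < n"
  shows "gmat D r v *\<^sub>v wcol r (n + i) = \<pi> ^ (r + k + i * r) \<cdot>\<^sub>v Hvec v i"
proof -
  note vD = VsympD[OF v]
  have col: "gmat D r v *\<^sub>v e i = gcol r v i" if "i < 2 * n" for i
    using that vD by (simp add: col_eq_mult_unit[OF gmat_carrier] gmat_col)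
  show ?thesis
  proof (cases i)
    case 0
    have "\<not> n < n - 1" "n \<noteq> n - 1" using n_pos by auto
    then have "wcol r n = ((- 1) ^ (n + 1) * \<pi> ^ (r + k)) \<cdot>\<^sub>v e 0" by (simp add: wcol_def)
    moreover have "gcol r v 0 = v" using n_pos vD by (simp add: gcol_def)
    ultimately have "gmat D r v *\<^sub>v wcol r n = (\<pi> ^ (r + k) * (- 1) ^ (n + 1)) \<cdot>\<^sub>v v"
      using n_pos by (simp add: mult_mat_vec[OF gmat_carrier] col mult.commute[of "\<pi> ^ (r + k)"])
    then show ?thesis using 0 by (simp add: Hvec_0 smult_smult_assoc)
  next
    case (Suc l)
    have "\<not> n + i < n - 1" "n + i \<noteq> n - 1" "n + i \<noteq> n" using Suc by auto
    then have "wcol r (n + i) = \<pi> ^ (r + k) \<cdot>\<^sub>v e (n + l)" using Suc by (simp add: wcol_def)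
    moreover have "n + l < 2 * n - 1" using Suc assms by simp
    then have "gcol r v (n + l) = \<pi> ^ (Suc l * r) \<cdot>\<^sub>v Hvec v i"
      using Suc by (simp add: gcol_def)
    ultimately have "gmat D r v *\<^sub>v wcol r (n + i) = (\<pi> ^ (r + k) * \<pi> ^ (i * r)) \<cdot>\<^sub>v Hvec v i"
      using vD assms Suc by (simp add: mult_mat_vec[OF gmat_carrier] col smult_smult_assoc)
    then show ?thesis by (simp flip: power_add)
  qed
qed

text \<open>Applying F to the recursion undoes V up to pi^k and returns the previous G_i, while the
  correction along v becomes a multiple of F v, the image of the first column of w_r.\<close>

lemma F_gcol_ge:
  assumes "Suc i < n"
  shows "F (gcol r v (n + i)) = gmat D r v *\<^sub>v ((s (\<alpha> v) / \<alpha> v) \<cdot>\<^sub>v wcol r (n + i) + tcoef r v i \<cdot>\<^sub>v wcol r 0)"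
proof -
  note vD = VsympD[OF v]
  have g0: "gmat D r v *\<^sub>v wcol r 0 = F v"
    using gmat_wcol_lt[of 0] n_pos by (simp add: gcol_def)
  have sV: "s (ip (V (Hvec v i)) ((F ^^ n) v)) = - ip (Hvec v i) ((F ^^ Suc n) v)"
    using vD by (simp add: V_form s.hom_uminus)
  have "n + i < 2 * n - 1" using assms by simp
  then have gc: "gcol r v (n + i) = \<pi> ^ (Suc i * r) \<cdot>\<^sub>v Hvec v (Suc i)" by (simp add: gcol_def)
  have "F (gcol r v (n + i)) = \<pi> ^ (Suc i * r) \<cdot>\<^sub>v F (Hvec v (Suc i))"
    using vD gc by (simp add: F_smult)
  also have "F (Hvec v (Suc i)) = (s (\<alpha> v) / \<alpha> v) \<cdot>\<^sub>v (\<pi> ^ k \<cdot>\<^sub>v Hvec v i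
      + (ip (Hvec v i) ((F ^^ Suc n) v) / s (\<alpha> v)) \<cdot>\<^sub>v F v)"
    using vD
    by (simp add: Hvec_Suc Gstep_eq F_smult F_diff FV s.hom_div sV del: funpow.simps)
      (intro eq_vecI; auto simp: carrier_vecD[OF F_carrier] carrier_vecD[OF Hvec_carrier])
  also have "\<pi> ^ (Suc i * r) \<cdot>\<^sub>v \<dots> = (s (\<alpha> v) / \<alpha> v) \<cdot>\<^sub>v (\<pi> ^ (r + k + i * r) \<cdot>\<^sub>v Hvec v i) + tcoef r v i \<cdot>\<^sub>v F v"
    using vD
    by (intro eq_vecI) (auto simp: tcoef_def carrier_vecD[OF F_carrier] carrier_vecD[OF Hvec_carrier]
        distrib_left power_add mult_ac simp del: funpow.simps)
  also have "\<dots> = gmat D r v *\<^sub>v ((s (\<alpha> v) / \<alpha> v) \<cdot>\<^sub>v wcol r (n + i) + tcoef r v i \<cdot>\<^sub>v wcol r 0)"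
    using assms by (simp add: mult_add_distrib_mat_vec[OF gmat_carrier] mult_mat_vec[OF gmat_carrier] g0 gmat_wcol_ge)
  finally show ?thesis .
qed

text \<open>All columns of beta but the last are visible from F of the columns of g. The last
  involves F^(n+1) v, with no direct expansion, and is recovered by duality from its pairings with
  the columns of h = g w_r, whose multiplier is known.\<close>

lemma gmat_relative_position:
  obtains \<beta> where "\<beta> \<in> carrier (GSp n)" "b * map_mat s (gmat D r v) = gmat D r v * (wmat D r * \<beta>)"
    "\<And>i. i < 2 * n \<Longrightarrow> \<beta> $$ (i, i) = (if i < n then 1 else s (\<alpha> v) / \<alpha> v)"
    "\<And>i j. i < 2 * n \<Longrightarrow> j < i \<Longrightarrow> \<beta> $$ (i, j) = 0"
    "\<And>i j. i < j \<Longrightarrow> j < 2 * n \<Longrightarrow>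
       \<beta> $$ (i, j) = 0 \<or> (\<exists>l<n. \<beta> $$ (i, j) = tcoef r v l \<or> \<beta> $$ (i, j) = - tcoef r v l)"
proof -
  note vD = VsympD[OF v]
  let ?g = "gmat D r v" and ?\<rho> = "s (\<alpha> v) / \<alpha> v"
  define h where "h = ?g * wmat D r"
  have hG: "h \<in> carrier (GSp n)" unfolding h_def by (intro GSp_mult_closed gmat_GSp v wmat_GSp)
  then have hM: "h \<in> CM" by (rule GSp_carrier_mat)
  have hcol: "h *\<^sub>v e j = ?g *\<^sub>v wcol r j" if "j < 2 * n" for j
    using that by (simp add: h_def wmat_col[symmetric] col_eq_mult_unit[OF wmat_carrier, symmetric]
        assoc_mult_mat_vec[OF gmat_carrier wmat_carrier])
  define \<beta> where "\<beta> = inv\<^bsub>GSp n\<^esub> h * (b * map_mat s ?g)"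
  have sgM: "map_mat s ?g \<in> CM" by simp
  have bG: "b * map_mat s ?g \<in> carrier (GSp n)" by (intro GSp_mult_closed GSp_map s_hom gmat_GSp v b_GSp)
  have \<beta>G: "\<beta> \<in> carrier (GSp n)" unfolding \<beta>_def by (intro GSp_mult_closed GSp_inv_closed hG bG)
  then have \<beta>M: "\<beta> \<in> CM" by (rule GSp_carrier_mat)
  have invM: "inv\<^bsub>GSp n\<^esub> h \<in> CM" using GSp_inv_closed[OF hG] GSp_carrier_mat by blast
  have "h * \<beta> = (h * inv\<^bsub>GSp n\<^esub> h) * (b * map_mat s ?g)"
    unfolding \<beta>_def using hM invM sgM by (simp add: CM_assoc)
  then have h\<beta>: "h * \<beta> = b * map_mat s ?g" using GSp_inv_right[OF hG] by simp
  have Fcol: "h *\<^sub>v col \<beta> j = F (gcol r v j)" if j: "j < 2 * n" for j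
  proof -
    have "h *\<^sub>v col \<beta> j = col (b * map_mat s ?g) j" using col_mult2[OF hM \<beta>M j] h\<beta> by simp
    also have "\<dots> = b *\<^sub>v map_vec s (col ?g j)"
      using j col_mult2[OF b_carrier, of "map_mat s ?g" "2 * n" j] by (simp add: carrier_matD[OF gmat_carrier])
    finally show ?thesis using j vD by (simp add: Fop_def gmat_col)
  qed
  have cancel: "col \<beta> j = y" if "j < 2 * n" "y \<in> CV" "h *\<^sub>v y = F (gcol r v j)" for j y
  proof -
    have "col \<beta> j \<in> CV" using \<beta>M that by simp
    then have "col \<beta> j = inv\<^bsub>GSp n\<^esub> h *\<^sub>v (h *\<^sub>v col \<beta> j)"
      using GSp_inv_left[OF hG] by (simp flip: assoc_mult_mat_vec[OF invM hM])
    also have "h *\<^sub>v col \<beta> j = h *\<^sub>v y" using Fcol that by simp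
    also have "inv\<^bsub>GSp n\<^esub> h *\<^sub>v (h *\<^sub>v y) = y"
      using that(2) GSp_inv_left[OF hG] by (simp flip: assoc_mult_mat_vec[OF invM hM])
    finally show ?thesis .
  qed
  have c1: "col \<beta> j = e j" if "j < n" for j
    using that by (intro cancel) (auto simp: hcol gmat_wcol_lt)
  have c2: "col \<beta> (n + i) = ?\<rho> \<cdot>\<^sub>v e (n + i) + tcoef r v i \<cdot>\<^sub>v e 0" if "Suc i < n" for i
    using that n_pos
    by (intro cancel) (auto simp: F_gcol_ge mult_add_distrib_mat_vec[OF hM] mult_mat_vec[OF hM] hcol
        mult_add_distrib_mat_vec[OF gmat_carrier] mult_mat_vec[OF gmat_carrier])
  let ?L = "2 * n - 1"
  have sim: "similitude_by n h (\<pi> ^ (n * r + k) * \<alpha> v)"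
    using similitude_by_mult[OF gmat_carrier wmat_carrier gmat_similitude[OF v] wmat_similitude]
    by (simp add: h_def power_add mult_ac)
  \<comment> \<open>Pairing with the unit vector i isolates entry 2n-1-i of the last column of beta;
    applying the similitude h turns it into a pairing with F^(n+1) v.\<close>
  have pair: "\<pi> ^ (n * r + k) * \<alpha> v * (- ((- 1) ^ i) * \<beta> $$ (2 * n - Suc i, ?L))
      = ip (?g *\<^sub>v wcol r i) (\<pi> ^ (n * r) \<cdot>\<^sub>v (F ^^ Suc n) v)" if i: "i < 2 * n" for i
  proof -
    have "ip (h *\<^sub>v e i) (h *\<^sub>v col \<beta> ?L) = \<pi> ^ (n * r + k) * \<alpha> v * ip (e i) (col \<beta> ?L)"
      by (rule similitude_byD[OF sim])
        (use \<beta>M n_pos in \<open>auto intro!: col_carrier_vec[where nc = "2 * n"]\<close>)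
    moreover have "ip (e i) (col \<beta> ?L) = - ((- 1) ^ i) * \<beta> $$ (2 * n - Suc i, ?L)"
      using \<beta>M i n_pos
      by (subst sform_unit_left) (auto intro!: col_carrier_vec[where nc = "2 * n"])
    moreover have "\<not> ?L < n" using n_pos by auto
    then have "F (gcol r v ?L) = \<pi> ^ (n * r) \<cdot>\<^sub>v (F ^^ Suc n) v"
      using vD by (simp add: gcol_def F_smult)
    ultimately show ?thesis using i n_pos by (simp add: hcol Fcol)
  qed
  have nz: "\<pi> ^ (n * r + k) * \<alpha> v \<noteq> 0" using pi vD by simp
  \<comment> \<open>For i < n column i of h is a multiple of F^(i+1) v, so one F can be extracted
    from both sides; only i = 0, the corner entry, survives.\<close>
  have l1: "\<beta> $$ (2 * n - Suc i, ?L) = (if i = 0 then ?\<rho> else 0)" if i: "i < n" for i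
  proof -
    have "ip (?g *\<^sub>v wcol r i) (\<pi> ^ (n * r) \<cdot>\<^sub>v (F ^^ Suc n) v)
        = \<pi> ^ (n * r) * (\<pi> ^ (i * r) * ip (F ((F ^^ i) v)) (F ((F ^^ n) v)))"
      using i vD by (simp add: gmat_wcol_lt gcol_def F_smult sform_smult_left sform_smult_right)
    also have "\<dots> = (if i = 0 then - (\<pi> ^ (n * r + k) * s (\<alpha> v)) else 0)"
      using vD i Fpow_Fpow[OF v, of i n] by (simp add: F_form power_add)
    finally have "\<pi> ^ (n * r + k) * \<alpha> v * (- ((- 1) ^ i) * \<beta> $$ (2 * n - Suc i, ?L)) = \<dots>"
      using pair[of i] i by simp
    then show ?thesis using pi vD by (auto split: if_splits simp: field_simps)
  qed
  have l2: "\<beta> $$ (n - Suc l, ?L) = - ((- 1) ^ (n + l)) * tcoef r v l" if l: "l < n" for l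
  proof -
    have "\<pi> ^ (n * r + k) * \<alpha> v * (- ((- 1) ^ (n + l)) * \<beta> $$ (n - Suc l, ?L))
      = \<pi> ^ (r + k + l * r) * (\<pi> ^ (n * r) * ip (Hvec v l) ((F ^^ Suc n) v))"
      using pair[of "n + l"] l vD
      by (simp add: gmat_wcol_ge sform_smult_left sform_smult_right del: funpow.simps)
    also have "\<dots> = \<pi> ^ (n * r + k) * \<alpha> v * tcoef r v l"
      using vD by (simp add: tcoef_def power_add mult_ac del: funpow.simps)
    finally have "- ((- 1) ^ (n + l)) * \<beta> $$ (n - Suc l, ?L) = tcoef r v l"
      by (simp only: mult_left_cancel[OF nz])
    then have "- ((- 1) ^ (n + l)) * (- ((- 1) ^ (n + l)) * \<beta> $$ (n - Suc l, ?L)) = - ((- 1) ^ (n + l)) * tcoef r v l"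
      by simp
    then show ?thesis by (simp flip: mult.assoc power_add)
  qed
  have ent: "\<beta> $$ (i, j) = col \<beta> j $ i" if "i < 2 * n" "j < 2 * n" for i j
    using \<beta>M that by simp
  have cases_j: "j < n \<or> (\<exists>i. j = n + i \<and> Suc i < n) \<or> j = ?L" if "j < 2 * n" for j
  proof (cases "j < n")
    case False
    then have "j = n + (j - n)" "Suc (j - n) < n \<or> j = ?L" using that by auto
    then show ?thesis by metis
  qed simp
  have diag: "\<beta> $$ (i, i) = (if i < n then 1 else ?\<rho>)" if "i < 2 * n" for i
    using cases_j[OF that]
  proof (elim disjE exE)
    assume "i < n" then show ?thesis using that by (simp add: ent c1)
  next
    fix l assume "i = n + l \<and> Suc l < n" then show ?thesis using that by (simp add: ent c2)
  next
    assume "i = ?L" then show ?thesis using l1[of 0] n_pos by auto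
  qed
  have lower: "\<beta> $$ (i, j) = 0" if ij: "i < 2 * n" "j < i" for i j
    using cases_j[OF less_trans[OF ij(2,1)]]
  proof (elim disjE exE)
    assume "j < n" then show ?thesis using ij by (simp add: ent c1)
  next
    fix l assume "j = n + l \<and> Suc l < n" then show ?thesis using ij by (simp add: ent c2)
  qed (use ij in auto)
  have upper: "\<beta> $$ (i, j) = 0 \<or> (\<exists>l<n. \<beta> $$ (i, j) = tcoef r v l \<or> \<beta> $$ (i, j) = - tcoef r v l)"
    if ij: "i < j" "j < 2 * n" for i j
    using cases_j[OF ij(2)]
  proof (elim disjE exE)
    assume "j < n" then show ?thesis using ij by (simp add: ent c1)
  next
    fix l assume l: "j = n + l \<and> Suc l < n"
    then show ?thesis using ij by (cases "i = 0") (auto simp: ent c2 intro!: exI[of _ l])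
  next
    assume j: "j = ?L"
    show ?thesis
    proof (cases "i < n")
      case True
      then have "\<beta> $$ (i, j) = - ((- 1) ^ (n + (n - Suc i))) * tcoef r v (n - Suc i)"
        using l2[of "n - Suc i"] j by simp
      then show ?thesis using True
        by (intro disjI2 exI[of _ "n - Suc i"]) (auto simp: minus_one_power_iff)
    next
      case False
      then show ?thesis using l1[of "2 * n - Suc i"] ij j by auto
    qed
  qed
  have "b * map_mat s ?g = ?g * (wmat D r * \<beta>)"
    using \<beta>M by (simp flip: h\<beta> add: h_def CM_assoc)
  then show ?thesis using that \<beta>G diag lower upper by blast
qed

end

section \<open>Consequences of basicness\<close>

text \<open>Commuting with the transvection y -> y + <y,u> u forces M u to be a multiple of u.
  Applied to the unit vectors and to the sums of the first with any other, this yields one common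
  eigenvalue. The vector x with <x,u> = 1 detects the transvection.\<close>

lemma commutes_imp_scalar:
  assumes M: "M \<in> CM" and comm: "\<And>g. g \<in> carrier (GSp n) \<Longrightarrow> M * g = g * M"
  obtains \<chi> where "\<And>x. x \<in> CV \<Longrightarrow> M *\<^sub>v x = \<chi> \<cdot>\<^sub>v x"
proof -
  have eig: "\<exists>c. M *\<^sub>v u = c \<cdot>\<^sub>v u" if u: "u \<in> CV" and x: "x \<in> CV" "ip x u = 1" for u x
  proof -
    define T where "T = mat (2 * n) (2 * n) (\<lambda>(i, j). (if i = j then 1 else 0) + ip (e j) u * u $ i)"
    have T: "T \<in> CM" by (simp add: T_def)
    have Tx: "T *\<^sub>v y = y + ip y u \<cdot>\<^sub>v u" if y: "y \<in> CV" for y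
    proof (rule eq_vecI)
      fix i assume "i < dim_vec (y + ip y u \<cdot>\<^sub>v u)"
      then have i: "i < 2 * n" using u by simp
      have "(T *\<^sub>v y) $ i = (\<Sum>j = 0..<2 * n. (if i = j then y $ j else 0) + ip (e j) u * y $ j * u $ i)"
        using i y by (auto simp: T_def scalar_prod_def algebra_simps intro!: sum.cong)
      also have "\<dots> = y $ i + (\<Sum>j<2 * n. ip (e j) u * y $ j) * u $ i"
        using i by (simp add: sum.distrib sum_distrib_right atLeast0LessThan)
      also have "(\<Sum>j<2 * n. ip (e j) u * y $ j) = ip y u"
        using y u by (auto simp: sform_sum[OF y u] sform_unit_left intro!: sum.cong)
      finally show "(T *\<^sub>v y) $ i = (y + ip y u \<cdot>\<^sub>v u) $ i" using i u by simp
    qed (use T u in auto)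
    have "similitude_by n T 1"
      unfolding similitude_by_def
    proof (intro conjI ballI)
      fix y z assume yz: "y \<in> CV" "z \<in> CV"
      have "ip (T *\<^sub>v y) (T *\<^sub>v z) = ip y z + ip z u * ip y u + ip y u * ip u z"
        using yz u by (simp add: Tx sform_add_left sform_add_right sform_smult_left sform_smult_right sform_self)
      then show "ip (T *\<^sub>v y) (T *\<^sub>v z) = 1 * ip y z" using sform_swap[OF u yz(2)] by simp
    qed simp
    then have "M * T = T * M" by (intro comm GSp_memI[OF T])
    then have "M *\<^sub>v (T *\<^sub>v x) = T *\<^sub>v (M *\<^sub>v x)"
      using x by (metis M T assoc_mult_mat_vec)
    then have eq: "M *\<^sub>v x + M *\<^sub>v u = M *\<^sub>v x + ip (M *\<^sub>v x) u \<cdot>\<^sub>v u"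
      using x u M by (simp add: Tx mult_add_distrib_mat_vec[OF M])
    have "M *\<^sub>v u = ip (M *\<^sub>v x) u \<cdot>\<^sub>v u"
    proof (rule eq_vecI)
      fix i assume "i < dim_vec (ip (M *\<^sub>v x) u \<cdot>\<^sub>v u)"
      then have i: "i < 2 * n" using u by simp
      have "(M *\<^sub>v x + M *\<^sub>v u) $ i = (M *\<^sub>v x + ip (M *\<^sub>v x) u \<cdot>\<^sub>v u) $ i" by (simp only: eq)
      then show "(M *\<^sub>v u) $ i = (ip (M *\<^sub>v x) u \<cdot>\<^sub>v u) $ i"
        using i u M x by simp
    qed (use M u in auto)
    then show ?thesis by blast
  qed
  have eig_e: "\<exists>c. M *\<^sub>v e i = c \<cdot>\<^sub>v e i" if "i < 2 * n" for i
  proof (rule eig)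
    let ?x = "((- 1) ^ i) \<cdot>\<^sub>v e (2 * n - Suc i)"
    show "ip ?x (e i) = 1"
      using that by (simp add: sform_unit_right flip: power_add)
  qed auto
  then obtain c where c: "\<And>i. i < 2 * n \<Longrightarrow> M *\<^sub>v e i = c i \<cdot>\<^sub>v e i" by metis
  have same: "c i = c 0" if i: "i < 2 * n" for i
  proof (cases "i = 0")
    case False
    have "\<exists>d. M *\<^sub>v (e 0 + e i) = d \<cdot>\<^sub>v (e 0 + e i)"
    proof (rule eig)
      let ?x = "((- 1) ^ i) \<cdot>\<^sub>v e (2 * n - Suc i)"
      show "ip ?x (e 0 + e i) = 1"
        using i False by (simp add: sform_unit_right sform_add_right flip: power_add)
    qed auto
    then obtain d where d: "M *\<^sub>v (e 0 + e i) = d \<cdot>\<^sub>v (e 0 + e i)" by blast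
    have "M *\<^sub>v (e 0 + e i) = c 0 \<cdot>\<^sub>v e 0 + c i \<cdot>\<^sub>v e i"
      using i n_pos by (simp add: mult_add_distrib_mat_vec[OF M] c)
    then have eq: "c 0 \<cdot>\<^sub>v e 0 + c i \<cdot>\<^sub>v e i = d \<cdot>\<^sub>v (e 0 + e i)" using d by simp
    have "c 0 = d" using arg_cong[OF eq, of "\<lambda>u :: 'a vec. u $ 0"] i False n_pos by simp
    moreover have "c i = d" using arg_cong[OF eq, of "\<lambda>u :: 'a vec. u $ i"] i False by simp
    ultimately show ?thesis by simp
  qed simp
  have "M *\<^sub>v x = c 0 \<cdot>\<^sub>v x" if x: "x \<in> CV" for x
  proof (rule eq_vecI)
    fix i assume "i < dim_vec (c 0 \<cdot>\<^sub>v x)"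
    then have i: "i < 2 * n" using x by simp
    have ent: "M $$ (i, j) = (if i = j then c 0 else 0)" if "j < 2 * n" for j
    proof -
      have "M $$ (i, j) = (M *\<^sub>v e j) $ i" using i that M by (simp only: col_eq_mult_unit[OF M that]) simp
      then show ?thesis using c[OF that] same[OF that] i that by simp
    qed
    have "(M *\<^sub>v x) $ i = (\<Sum>j = 0..<2 * n. M $$ (i, j) * x $ j)"
      using i x M by (simp add: scalar_prod_def)
    also have "\<dots> = (\<Sum>j = 0..<2 * n. if i = j then c 0 * x $ j else 0)"
      by (rule sum.cong) (auto simp: ent)
    also have "\<dots> = c 0 * x $ i" using i by simp
    finally show "(M *\<^sub>v x) $ i = (c 0 \<cdot>\<^sub>v x) $ i" using i x by simp
  qed (use M x in auto)
  then show ?thesis by (rule that)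
qed

section \<open>Iterates of F and the slope of a basic element\<close>

lemma spow_hom: "field_hom (s ^^ l)"
proof (induction l)
  case 0
  show ?case by unfold_locales auto
next
  case (Suc l)
  then interpret t: field_hom "s ^^ l" .
  show ?case by unfold_locales (auto simp: t.hom_add t.hom_mult s.hom_add s.hom_mult)
qed

lemma w_spow: "x \<noteq> 0 \<Longrightarrow> w ((s ^^ l) x) = w x" and spow_eq_0: "(s ^^ l) x = 0 \<longleftrightarrow> x = 0"
proof -
  show z: "(s ^^ l) x = 0 \<longleftrightarrow> x = 0" for x by (induction l) auto
  show "x \<noteq> 0 \<Longrightarrow> w ((s ^^ l) x) = w x"
  proof (induction l)
    case (Suc l)
    then show ?case using w_s[of "(s ^^ l) x"] z by (metis funpow.simps(2) o_apply spow_hom field_hom.axioms s_eq_0 funpow_0 s.hom_0_iff z)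
  qed simp
qed

lemma map_spow: "map_vec s (map_vec (s ^^ l) x) = map_vec (s ^^ Suc l) x"
  by (intro eq_vecI) auto

lemma sigma_norm_carrier [simp]: "sigma_norm s n b l \<in> CM"
  by (induction l) (auto intro!: mult_carrier_mat[of _ _ "2 * n"])

lemma Fpow_sigma_norm: "x \<in> CV \<Longrightarrow> (F ^^ l) x = sigma_norm s n b l *\<^sub>v map_vec (s ^^ l) x"
proof (induction l)
  case 0
  then show ?case by (auto intro!: eq_vecI)
next
  case (Suc l)
  have m: "map_vec (s ^^ l) x \<in> CV" using Suc.prems by simp
  have "(F ^^ Suc l) x = F (sigma_norm s n b l *\<^sub>v map_vec (s ^^ l) x)"
    using Suc.IH[OF Suc.prems] by simp
  then have "(F ^^ Suc l) x = b *\<^sub>v map_vec s (sigma_norm s n b l *\<^sub>v map_vec (s ^^ l) x)"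
    by (simp only: Fop_def)
  also have "\<dots> = b *\<^sub>v (map_mat s (sigma_norm s n b l) *\<^sub>v map_vec (s ^^ Suc l) x)"
    using s.mult_mat_vec_hom[OF sigma_norm_carrier m, of l] by (simp only: map_spow)
  also have "\<dots> = sigma_norm s n b (Suc l) *\<^sub>v map_vec (s ^^ Suc l) x"
    using Suc.prems
    by (simp add: assoc_mult_mat_vec[of b "2 * n" "2 * n" _ "2 * n"] del: funpow.simps)
  finally show ?case .
qed

text \<open>A central cocharacter takes a scalar value chi at pi, so after the change of basis c the
  operator F^l is chi times sigma^l. Comparing multipliers then determines ord chi.\<close>

lemma basic_scalar:
  obtains l c \<chi> where "0 < l" "c \<in> carrier (GSp n)" "\<chi> \<noteq> 0" "2 * w \<chi> = int (l * k)"
    "\<And>x. x \<in> CV \<Longrightarrow> c *\<^sub>v (F ^^ l) x = \<chi> \<cdot>\<^sub>v map_vec (s ^^ l) (c *\<^sub>v x)"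
proof -
  have "basic s \<pi> n b" using setting by (simp add: gsp_setting_def)
  then obtain l \<mu> where sl: "slope_hom_multiple s \<pi> n b l \<mu>"
    and cen: "\<And>t g. t \<noteq> 0 \<Longrightarrow> g \<in> carrier (GSp n) \<Longrightarrow> g * \<mu> t = \<mu> t * g"
    unfolding basic_def by blast
  then obtain c where l: "0 < l" and coch: "cocharacter n \<mu>" and c: "c \<in> carrier (GSp n)"
    and eq: "c * sigma_norm s n b l * map_mat (s ^^ l) (inv\<^bsub>GSp n\<^esub> c) = c * \<mu> \<pi> * inv\<^bsub>GSp n\<^esub> c"
    unfolding slope_hom_multiple_def by blast
  interpret t: field_hom "s ^^ l" by (rule spow_hom)
  have MG: "\<mu> \<pi> \<in> carrier (GSp n)" using coch pi by (auto simp: cocharacter_def)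
  then have M: "\<mu> \<pi> \<in> CM" by (rule GSp_carrier_mat)
  obtain \<chi> where \<chi>: "\<And>x. x \<in> CV \<Longrightarrow> \<mu> \<pi> *\<^sub>v x = \<chi> \<cdot>\<^sub>v x"
    using commutes_imp_scalar[OF M] cen pi by metis
  have cM: "c \<in> CM" and ci: "inv\<^bsub>GSp n\<^esub> c \<in> CM" using c GSp_inv_closed[OF c] GSp_carrier_mat by blast+
  note as = assoc_mult_mat[of _ "2 * n" "2 * n" _ "2 * n" _ "2 * n"]
  note mc = mult_carrier_mat[of _ "2 * n" "2 * n" _ "2 * n"]
  have "c * \<mu> \<pi> * inv\<^bsub>GSp n\<^esub> c = \<mu> \<pi> * c * inv\<^bsub>GSp n\<^esub> c" using cen[OF pi(1) c] by simp
  also have "\<dots> = \<mu> \<pi> * (c * inv\<^bsub>GSp n\<^esub> c)" using M cM ci by (intro as)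
  also have "\<dots> = \<mu> \<pi>" using M GSp_inv_right[OF c] by simp
  finally have eq': "c * sigma_norm s n b l * map_mat (s ^^ l) (inv\<^bsub>GSp n\<^esub> c) = \<mu> \<pi>" using eq by simp
  have key: "c * sigma_norm s n b l = \<mu> \<pi> * map_mat (s ^^ l) c"
  proof -
    have "\<mu> \<pi> * map_mat (s ^^ l) c = c * sigma_norm s n b l * map_mat (s ^^ l) (inv\<^bsub>GSp n\<^esub> c) * map_mat (s ^^ l) c"
      by (simp only: eq')
    also have "\<dots> = c * sigma_norm s n b l * (map_mat (s ^^ l) (inv\<^bsub>GSp n\<^esub> c) * map_mat (s ^^ l) c)"
      using cM ci by (intro as mc) auto
    also have "map_mat (s ^^ l) (inv\<^bsub>GSp n\<^esub> c) * map_mat (s ^^ l) c = 1\<^sub>m (2 * n)"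
      using t.mat_hom_mult[OF ci cM] GSp_inv_left[OF c] by (simp add: t.mat_hom_one)
    also have "c * sigma_norm s n b l * 1\<^sub>m (2 * n) = c * sigma_norm s n b l"
      by (rule right_mult_one_mat[OF mc[OF cM sigma_norm_carrier]])
    finally show ?thesis by simp
  qed
  have act: "c *\<^sub>v (F ^^ l) x = \<chi> \<cdot>\<^sub>v map_vec (s ^^ l) (c *\<^sub>v x)" if x: "x \<in> CV" for x
  proof -
    have tx: "map_vec (s ^^ l) x \<in> CV" using x by simp
    have "c *\<^sub>v (F ^^ l) x = (c * sigma_norm s n b l) *\<^sub>v map_vec (s ^^ l) x"
      using Fpow_sigma_norm[OF x] assoc_mult_mat_vec[OF cM sigma_norm_carrier tx] by simp
    also have "\<dots> = \<mu> \<pi> *\<^sub>v (map_mat (s ^^ l) c *\<^sub>v map_vec (s ^^ l) x)"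
      unfolding key by (rule assoc_mult_mat_vec[OF M _ tx]) (use cM in simp)
    also have "map_mat (s ^^ l) c *\<^sub>v map_vec (s ^^ l) x = map_vec (s ^^ l) (c *\<^sub>v x)"
      by (rule t.mult_mat_vec_hom[symmetric, OF cM x])
    also have "\<mu> \<pi> *\<^sub>v \<dots> = \<chi> \<cdot>\<^sub>v \<dots>" using cM x by (intro \<chi>) simp
    finally show ?thesis .
  qed
  obtain la where lam: "similitude_by n c la" "la \<noteq> 0" using c by (rule GSp_memE)
  have e0: "e 0 \<in> CV" "e (2 * n - 1) \<in> CV" by auto
  \<comment> \<open>Evaluating the relation on this pair, whose pairing is -1, gives lambda(c)
    (-pi^k)^l = chi^2 sigma^l(lambda(c)); taking valuations yields 2 ord chi = l k.\<close>
  define a where "a = ip (e 0) (e (2 * n - 1))"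
  have a: "a = - 1" using n_pos by (simp add: a_def sform_unit_unit)
  have "la * ((- (\<pi> ^ k)) ^ l * (s ^^ l) a) = la * ip ((F ^^ l) (e 0)) ((F ^^ l) (e (2 * n - 1)))"
    by (simp add: Fpow_form a_def)
  also have "\<dots> = ip (c *\<^sub>v (F ^^ l) (e 0)) (c *\<^sub>v (F ^^ l) (e (2 * n - 1)))"
    by (rule similitude_byD[OF lam(1), symmetric]) auto
  also have "\<dots> = \<chi> * (\<chi> * (s ^^ l) (la * a))"
    using cM by (simp add: act sform_smult_left sform_smult_right sform_map[OF spow_hom]
        similitude_byD[OF lam(1)] a_def)
  finally have rel: "la * ((- (\<pi> ^ k)) ^ l * (s ^^ l) a) = \<chi> * (\<chi> * (s ^^ l) (la * a))" .
  have sa: "(s ^^ l) a = - 1" by (simp add: a t.hom_uminus t.hom_one)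
  have rel': "la * (- (\<pi> ^ k)) ^ l = \<chi> * (\<chi> * (s ^^ l) la)"
    using rel by (simp add: sa t.hom_mult)
  have nz: "la * (- (\<pi> ^ k)) ^ l \<noteq> 0" using lam pi by simp
  then have \<chi>0: "\<chi> \<noteq> 0" using rel' by auto
  have sl0: "(s ^^ l) la \<noteq> 0" using lam spow_eq_0 by simp
  have "w la + int (l * k) = w (la * (- (\<pi> ^ k)) ^ l)"
    using lam pi by (simp add: w_mult w_power)
  also have "\<dots> = 2 * w \<chi> + w la"
    unfolding rel' using \<chi>0 sl0 lam by (simp add: w_mult w_spow)
  finally have "2 * w \<chi> = int (l * k)" by simp
  then show ?thesis using that l c \<chi>0 act by blast
qed

text \<open>In the basis given by c, the coordinates of F^j v are chi times the twisted coordinates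
  of F^(j-l) v, so j k - 2 ord is controlled by its values for j < l. The constant is crude; only
  its existence matters for \<open>Vsymp_weight\<close>.\<close>

lemma basic_bound:
  assumes v: "v \<in> CV"
  obtains C where "\<And>j. ip v ((F ^^ j) v) \<noteq> 0 \<Longrightarrow> int (j * k) - C \<le> 2 * w (ip v ((F ^^ j) v))"
proof -
  obtain l c \<chi> where l: "0 < l" and c: "c \<in> carrier (GSp n)" and \<chi>: "\<chi> \<noteq> 0" "2 * w \<chi> = int (l * k)"
    and act: "\<And>x. x \<in> CV \<Longrightarrow> c *\<^sub>v (F ^^ l) x = \<chi> \<cdot>\<^sub>v map_vec (s ^^ l) (c *\<^sub>v x)"
    by (rule basic_scalar) blast
  have cM: "c \<in> CM" using c by (rule GSp_carrier_mat)
  define a where "a j p = (c *\<^sub>v (F ^^ j) v) $ p" for j p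
  define E where "E = Max ((\<lambda>(j, p). int (j * k) - 2 * w (a j p)) ` ({..<l} \<times> {..<2 * n}))"
  have bound: "a j p \<noteq> 0 \<Longrightarrow> int (j * k) - E \<le> 2 * w (a j p)" if "p < 2 * n" for j p
  proof (induction j rule: less_induct)
    case (less j)
    show ?case
    proof (cases "j < l")
      case True
      have "int (j * k) - 2 * w (a j p) \<le> E"
        unfolding E_def by (rule Max_ge) (use True that in force)+
      then show ?thesis by simp
    next
      case False
      have "a j p = \<chi> * (s ^^ l) (a (j - l) p)"
      proof -
        have "(F ^^ j) v = (F ^^ l) ((F ^^ (j - l)) v)"
          using False by (simp flip: funpow_add[THEN fun_cong, unfolded o_apply])
        then show ?thesis using act[of "(F ^^ (j - l)) v"] that v cM by (simp add: a_def)
      qed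
      moreover from this have "a (j - l) p \<noteq> 0" using less.prems spow_eq_0[of l 0] by auto
      ultimately have "2 * w (a j p) = int (l * k) + 2 * w (a (j - l) p)"
        using \<chi> w_spow spow_eq_0 by (simp add: w_mult)
      moreover have "int ((j - l) * k) - E \<le> 2 * w (a (j - l) p)"
        using less.IH[of "j - l"] l False \<open>a (j - l) p \<noteq> 0\<close> by simp
      moreover have "int (j * k) = int (l * k) + int ((j - l) * k)"
        using False by (simp flip: of_nat_add add: distrib_right[symmetric])
      ultimately show ?thesis by simp
    qed
  qed
  obtain la where lam: "similitude_by n c la" "la \<noteq> 0" using c by (rule GSp_memE)
  have "int (j * k) - (2 * E + 2 * w la) \<le> 2 * w (ip v ((F ^^ j) v))" if nz: "ip v ((F ^^ j) v) \<noteq> 0" for j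
  proof -
    let ?t = "\<lambda>i. - ((- 1) ^ i) * a 0 i * a j (2 * n - Suc i)"
    have "la * ip v ((F ^^ j) v) = ip (c *\<^sub>v v) (c *\<^sub>v (F ^^ j) v)"
      using v by (simp add: similitude_byD[OF lam(1)])
    also have "\<dots> = sum ?t {..<2 * n}"
      using v cM by (simp add: sform_sum a_def del: index_mult_mat_vec)
    finally have sum: "la * ip v ((F ^^ j) v) = sum ?t {..<2 * n}" .
    \<comment> \<open>Half of j k - 2E rounded up, because \<open>ppow\<close> takes integral
      exponents.\<close>
    define W where "W = (int (j * k) - 2 * E + 1) div 2"
    have "sum ?t {..<2 * n} \<in> ppow w W"
    proof (rule ppow_sum)
      fix i assume i: "i \<in> {..<2 * n}"
      show "?t i \<in> ppow w W"
      proof (cases "?t i = 0")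
        case False
        then have nz: "a 0 i \<noteq> 0" "a j (2 * n - Suc i) \<noteq> 0" by auto
        then have wt: "w (?t i) = w (a 0 i) + w (a j (2 * n - Suc i))"
          by (simp add: w_mult w_power w_uminus_one)
        have "0 - E \<le> 2 * w (a 0 i)" using bound[of i 0] i nz by simp
        moreover have "int (j * k) - E \<le> 2 * w (a j (2 * n - Suc i))" using bound[of "2 * n - Suc i" j] i nz by simp
        ultimately have "int (j * k) - 2 * E \<le> 2 * w (?t i)" using wt by simp
        then have "W \<le> w (?t i)" unfolding W_def by presburger
        then show ?thesis by (simp add: ppow_def)
      next
        case True
        then show ?thesis by (simp only: ppow_0)
      qed
    qed
    then have "W \<le> w (la * ip v ((F ^^ j) v))" using nz lam sum by (auto simp: ppow_def)
    then have "W \<le> w la + w (ip v ((F ^^ j) v))" using nz lam by (simp add: w_mult)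
    then show ?thesis unfolding W_def by presburger
  qed
  then show ?thesis by (rule that)
qed

section \<open>Sharp valuation bounds for pairings with iterates of F\<close>

lemma linear_relation:
  assumes "\<And>i. i \<le> 2 * n \<Longrightarrow> f i \<in> CV"
  obtains x where "\<exists>i\<le>2 * n. x i \<noteq> 0" "\<And>y. y \<in> CV \<Longrightarrow> (\<Sum>i\<le>2 * n. x i * ip (f i) y) = 0"
proof -
  let ?m = "2 * n + 1"
  \<comment> \<open>The 2n+1 vectors are completed by a zero row to a square singular matrix; a
    kernel vector gives the coefficients of the relation.\<close>
  define A where "A = mat ?m ?m (\<lambda>(p, i). if p < 2 * n then f i $ p else 0)"
  have A: "A \<in> carrier_mat ?m ?m" by (simp add: A_def)
  have "transpose_mat A *\<^sub>v unit_vec ?m (2 * n) = 0\<^sub>v ?m"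
    by (rule eq_vecI) (auto simp: A_def scalar_prod_def intro!: sum.neutral)
  moreover have "unit_vec ?m (2 * n) \<noteq> (0\<^sub>v ?m :: 'a vec)"
    by (metis index_unit_vec(1) index_zero_vec(1) less_add_one zero_neq_one)
  ultimately have "det (transpose_mat A) = 0"
    using A by (subst det_0_iff_vec_prod_zero[of _ ?m]) (auto intro!: exI[of _ "unit_vec ?m (2 * n)"])
  then have "det A = 0" using det_transpose[OF A] by simp
  then obtain z where z: "z \<in> carrier_vec ?m" "z \<noteq> 0\<^sub>v ?m" "A *\<^sub>v z = 0\<^sub>v ?m"
    using det_0_iff_vec_prod_zero[OF A] by blast
  show ?thesis
  proof
    show "\<exists>i\<le>2 * n. z $ i \<noteq> 0"
    proof (rule ccontr)
      assume "\<not> ?thesis"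
      then have "z = 0\<^sub>v ?m" using z(1) by (intro eq_vecI) auto
      then show False using z by simp
    qed
    have coord: "(\<Sum>i\<le>2 * n. z $ i * f i $ p) = 0" if p: "p < 2 * n" for p
    proof -
      have "(A *\<^sub>v z) $ p = 0" using z p by simp
      moreover have "(A *\<^sub>v z) $ p = (\<Sum>i = 0..<?m. f i $ p * z $ i)"
        using z(1) p by (simp add: A_def scalar_prod_def)
      ultimately show ?thesis by (simp add: atLeast0LessThan lessThan_Suc_atMost mult.commute)
    qed
    show "(\<Sum>i\<le>2 * n. z $ i * ip (f i) y) = 0" if y: "y \<in> CV" for y
    proof -
      have "(\<Sum>i\<le>2 * n. z $ i * ip (f i) y)
          = (\<Sum>i\<le>2 * n. \<Sum>p<2 * n. (- ((- 1) ^ p) * y $ (2 * n - Suc p)) * (z $ i * f i $ p))"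
        by (rule sum.cong) (auto simp: sform_sum[OF assms y] sum_distrib_left mult_ac intro!: sum.cong)
      also have "\<dots> = (\<Sum>p<2 * n. (- ((- 1) ^ p) * y $ (2 * n - Suc p)) * (\<Sum>i\<le>2 * n. z $ i * f i $ p))"
        by (subst sum.swap) (simp add: sum_distrib_left)
      also have "\<dots> = 0" by (simp add: coord)
      finally show ?thesis .
    qed
  qed
qed

text \<open>If the least weight \<open>2 ord \<langle>v, F\<^sup>j v\<rangle> - jk\<close> were first attained at some \<open>j0 > n\<close>, the Gram
  matrix of \<open>2n + 1\<close> consecutive iterates against their translates by \<open>F\<^sup>j\<^sup>0\<close> would be triangular
  with dominant diagonal, contradicting linear dependence in dimension \<open>2n\<close>.\<close>

lemma Vsymp_weight:
  assumes v: "v \<in> Vsymp D" and nz: "ip v ((F ^^ j) v) \<noteq> 0"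
  shows "2 * w (\<alpha> v) + (int j - int n) * int k \<le> 2 * w (ip v ((F ^^ j) v))"
proof -
  note vD = VsympD[OF v]
  define a where "a j = ip v ((F ^^ j) v)" for j
  define om where "om j = 2 * w (a j) - int (j * k)" for j
  obtain C where C0: "\<And>j. a j \<noteq> 0 \<Longrightarrow> int (j * k) - C \<le> 2 * w (a j)"
    using basic_bound[OF vD(1)] unfolding a_def by blast
  have C: "- C \<le> om j" if "a j \<noteq> 0" for j
    using C0[OF that] by (simp add: om_def)
  have an: "a n \<noteq> 0" using vD by (simp add: a_def)
  define S where "S = {i. a i \<noteq> 0}"
  \<comment> \<open>The weights are bounded below by -C, so adding C makes them natural numbers and
    a minimum exists.\<close>
  obtain j1 where j1: "j1 \<in> S" "\<And>i. i \<in> S \<Longrightarrow> nat (om j1 + C) \<le> nat (om i + C)"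
    using ex_has_least_nat[of "\<lambda>i. i \<in> S" n "\<lambda>i. nat (om i + C)"] an by (auto simp: S_def)
  define N where "N = om j1"
  have N: "N \<le> om i" if "a i \<noteq> 0" for i
    using j1(2)[of i] that C[of i] C[of j1] j1(1) by (auto simp: S_def N_def)
  define j0 where "j0 = (LEAST i. a i \<noteq> 0 \<and> om i = N)"
  have j0: "a j0 \<noteq> 0" "om j0 = N"
    using LeastI[of "\<lambda>i. a i \<noteq> 0 \<and> om i = N" j1] j1 by (auto simp: j0_def N_def S_def)
  have less: "N < om i" if "i < j0" "a i \<noteq> 0" for i
    using not_less_Least[of i "\<lambda>i. a i \<noteq> 0 \<and> om i = N"] N[of i] that by (auto simp: j0_def)
  define B where "B i J = ip ((F ^^ i) v) ((F ^^ J) v)" for i J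
  have B_le: "B i (i + l) = (- (\<pi> ^ k)) ^ i * (s ^^ i) (a l)" for i l
    using Fpow_form[of v "(F ^^ l) v" i] vD by (simp add: B_def a_def funpow_add)
  have B_le_w: "2 * w (B i (i + l)) = om l + int ((i + (i + l)) * k)" "a l \<noteq> 0" if "B i (i + l) \<noteq> 0" for i l
  proof -
    have "(s ^^ i) (a l) \<noteq> 0" using that by (auto simp: B_le)
    then show "a l \<noteq> 0" using spow_eq_0 by blast
    with \<open>(s ^^ i) (a l) \<noteq> 0\<close> have "w (B i (i + l)) = int (i * k) + w (a l)"
      unfolding B_le using pi w_spow by (simp add: w_mult w_power)
    then show "2 * w (B i (i + l)) = om l + int ((i + (i + l)) * k)"
      by (simp add: om_def algebra_simps)
  qed
  have B_swap: "B i J = - B J i" for i J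
    unfolding B_def by (rule sform_swap) (use vD in auto)
  have B_w: "\<exists>l. a l \<noteq> 0 \<and> (J = i + l \<or> i = J + l) \<and> 2 * w (B i J) = om l + int ((i + J) * k)"
    if nz: "B i J \<noteq> 0" for i J
  proof (cases "i \<le> J")
    case True
    then show ?thesis using B_le_w[of i "J - i"] nz by (intro exI[of _ "J - i"]) auto
  next
    case False
    then have "B J (J + (i - J)) \<noteq> 0" using nz B_swap[of i J] by simp
    from B_le_w[OF this] False show ?thesis
      using B_swap[of i J] by (intro exI[of _ "i - J"]) (auto simp: add.commute)
  qed
  have "j0 \<le> n"
  proof (rule ccontr)
    assume "\<not> j0 \<le> n"
    then have big: "n < j0" by simp
    obtain x where x: "\<exists>i\<le>2 * n. x i \<noteq> 0" "\<And>y. y \<in> CV \<Longrightarrow> (\<Sum>i\<le>2 * n. x i * ip ((F ^^ i) v) y) = 0"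
      using linear_relation[of "\<lambda>i. (F ^^ i) v", OF Fpow_carrier[OF vD(1)]] by blast
    define Nz where "Nz = {i. i \<le> 2 * n \<and> x i \<noteq> 0}"
    define u where "u i = 2 * w (x i) + int (i * k)" for i
    have Nz: "finite Nz" "Nz \<noteq> {}" using x(1) by (auto simp: Nz_def)
    define W where "W = Min (u ` Nz)"
    have W: "W \<le> u i" if "i \<in> Nz" for i using Nz that by (auto simp: W_def)
    have "W \<in> u ` Nz" unfolding W_def by (rule Min_in) (use Nz in auto)
    then have "\<exists>i. i \<in> Nz \<and> u i = W" by blast
    then obtain i0 where i0: "i0 \<in> Nz" "u i0 = W" "\<And>i. i < i0 \<Longrightarrow> \<not> (i \<in> Nz \<and> u i = W)"
      using exists_least_iff[of "\<lambda>i. i \<in> Nz \<and> u i = W"] by blast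
    let ?J = "i0 + j0"
    let ?f = "\<lambda>i. x i * B i ?J"
    have lead: "B i0 ?J \<noteq> 0" unfolding B_le using pi j0 spow_eq_0 by simp
    have w_lead: "2 * w (?f i0) = W + N + int (?J * k)"
      using B_le_w(1)[OF lead] lead i0 j0 by (simp add: Nz_def u_def w_mult algebra_simps)
    have "sum ?f {..2 * n} \<noteq> 0"
    proof (rule sum_dominant_nonzero)
      show "i0 \<in> {..2 * n}" using i0 by (simp add: Nz_def)
      show "?f i0 \<noteq> 0" using i0 lead by (simp add: Nz_def)
      fix i assume i: "i \<in> {..2 * n}" "i \<noteq> i0"
      show "?f i \<in> ppow w (w (?f i0) + 1)"
      proof (cases "?f i = 0")
        case False
        then have iX: "i \<in> Nz" and Bi: "B i ?J \<noteq> 0" using i by (auto simp: Nz_def)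
        obtain l where l: "a l \<noteq> 0" "?J = i + l \<or> i = ?J + l" "2 * w (B i ?J) = om l + int ((i + ?J) * k)"
          using B_w[OF Bi] by blast
        have wf: "2 * w (?f i) = u i + om l + int (?J * k)"
          using False l(3) by (simp add: w_mult u_def algebra_simps)
        have "W + N < u i + om l"
        proof (cases "i < i0")
          case True
          then have "W < u i" using i0(3)[OF True] iX W[OF iX] by auto
          then show ?thesis using N[OF l(1)] by simp
        next
          case False
          then have "i0 < i" using i by simp
          \<comment> \<open>If J = i + l then l = j0 - (i - i0). Otherwise l = i - J, which is at
            most 2n - j0 and hence less than n, by the assumption n < j0.\<close>
          then have "l < j0" using l(2) big i i0 by (auto simp: Nz_def)
          then show ?thesis using less[OF _ l(1)] W[OF iX] by simp
        qed
        then have "w (?f i0) < w (?f i)" using wf w_lead by simp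
        then show ?thesis by (simp add: ppow_def)
      next
        case True
        then show ?thesis by (simp only: ppow_0)
      qed
    qed simp
    then show False using x(2)[of "(F ^^ ?J) v"] vD by (simp add: B_def)
  qed
  moreover have "a i = 0" if "i < n" for i using vD that by (simp add: a_def)
  ultimately have "j0 = n" using j0 by (metis linorder_neqE_nat not_le)
  then have "om n \<le> om j" using N[of j] j0 nz by (simp add: a_def)
  then show ?thesis using vD by (simp add: om_def a_def algebra_simps)
qed

text \<open>Each V is moved across the form and raises j by one, which gains k. The correction term
  obeys the same bound, since the estimates for its two factors add up and one ord alpha
  cancels.\<close>

lemma Hvec_weight:
  assumes v: "v \<in> Vsymp D"
  shows "ip (Hvec v i) ((F ^^ j) v) \<noteq> 0 \<Longrightarrow>
    2 * w (\<alpha> v) + (int j - int n + int i) * int k \<le> 2 * w (ip (Hvec v i) ((F ^^ j) v))"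
proof (induction i arbitrary: j)
  case 0
  then show ?case
    using Vsymp_weight[OF v, of j] VsympD[OF v] by (simp add: Hvec_0 sform_smult_left w_mult w_power w_uminus_one)
next
  case (Suc i)
  note vD = VsympD[OF v]
  define c where "c j = ip (V (Hvec v i)) ((F ^^ j) v)" for j
  have c: "2 * w (\<alpha> v) + (int j - int n + int (Suc i)) * int k \<le> 2 * w (c j)" if "c j \<noteq> 0" for j
  proof -
    have "c j = - si (ip (Hvec v i) ((F ^^ Suc j) v))" using vD by (simp add: c_def V_form)
    then show ?thesis using Suc.IH[of "Suc j"] that w_si by (simp del: funpow.simps add: algebra_simps)
  qed
  let ?y = "c n / \<alpha> v * ip v ((F ^^ j) v)"
  have eq: "ip (Hvec v (Suc i)) ((F ^^ j) v) = (\<alpha> v / si (\<alpha> v)) * (c j - ?y)"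
    using vD by (simp add: Hvec_Suc Gstep_eq sform_smult_left sform_diff_left c_def)
  have al: "\<alpha> v / si (\<alpha> v) \<noteq> 0" "w (\<alpha> v / si (\<alpha> v)) = 0" using vD w_si by (auto simp: w_divide)
  define W where "W = (2 * w (\<alpha> v) + (int j - int n + int (Suc i)) * int k + 1) div 2"
  have "c j \<in> ppow w W"
    using c[of j] unfolding ppow_def W_def by (cases "c j = 0") auto
  moreover have "?y \<in> ppow w W"
  proof (cases "?y = 0")
    case False
    then have nz: "c n \<noteq> 0" "ip v ((F ^^ j) v) \<noteq> 0" by auto
    have "w ?y = w (c n) - w (\<alpha> v) + w (ip v ((F ^^ j) v))" using nz vD by (simp add: w_mult w_divide)
    then have "2 * w (\<alpha> v) + (int j - int n + int (Suc i)) * int k \<le> 2 * w ?y"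
      using c[OF nz(1)] Vsymp_weight[OF v nz(2)] by (simp add: algebra_simps)
    then have "W \<le> w ?y" unfolding W_def by simp
    then show ?thesis by (simp add: ppow_def)
  next
    case True
    then show ?thesis by (simp only: ppow_0)
  qed
  ultimately have "c j - ?y \<in> ppow w W" by (rule ppow_diff)
  moreover have nz: "c j - ?y \<noteq> 0" using Suc.prems eq by auto
  ultimately have "W \<le> w (ip (Hvec v (Suc i)) ((F ^^ j) v))"
    unfolding eq w_mult[OF al(1) nz] al(2) by (auto simp: ppow_def)
  then show ?case unfolding W_def by simp
qed

text \<open>The weight gives only half of (1 + l) k, for l = 0 just k/2. As k is 0 or 1 and
  valuations are integers, this still rounds up to k.\<close>

lemma Hvec_ratio_ppow:
  assumes v: "v \<in> Vsymp D"
  shows "ip (Hvec v l) ((F ^^ Suc n) v) / \<alpha> v \<in> ppow w (int k)"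
proof (cases "ip (Hvec v l) ((F ^^ Suc n) v) = 0")
  case False
  note vD = VsympD[OF v]
  have "2 * w (\<alpha> v) + (1 + int l) * int k \<le> 2 * w (ip (Hvec v l) ((F ^^ Suc n) v))"
    using Hvec_weight[OF v False] by simp
  then have "(1 + int l) * int k \<le> 2 * w (ip (Hvec v l) ((F ^^ Suc n) v) / \<alpha> v)"
    using False vD by (simp add: w_divide)
  moreover have "int k \<le> (1 + int l) * int k" by (simp add: distrib_right)
  ultimately have "int k \<le> w (ip (Hvec v l) ((F ^^ Suc n) v) / \<alpha> v)"
    using k_cases by auto
  then show ?thesis by (simp add: ppow_def)
qed simp

end

section \<open>Groups of prescribed shape\<close>

text \<open>All four groups in the theorem have the form \<open>shape\<close> below, with diagonal entries in \<open>U\<close>, entries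
  above the diagonal in \<open>P\<close> and entries below it in \<open>Q\<close>: the choices \<open>(U, P, Q)\<close> are
  \<open>(K\<^sup>*, K, 0)\<close>, \<open>(1, K, 0)\<close>, \<open>(O\<^sup>*, p^(m+1), p^m)\<close> and \<open>(1 + p^(m+1), p^(m+1), p^m)\<close>.\<close>

locale shape_data = gsp_ctx D for D :: "'a::field gsp_datum" +
  fixes r :: nat and U P Q :: "'a set"
  assumes U_one: "1 \<in> U" and U_nonzero: "0 \<notin> U"
    and U_mult: "x \<in> U \<Longrightarrow> y \<in> U \<Longrightarrow> x * y \<in> U"
    and U_inverse: "x \<in> U \<Longrightarrow> inverse x \<in> U"
    and U_s: "s x \<in> U \<longleftrightarrow> x \<in> U"
    and P_0: "0 \<in> P" and P_add: "x \<in> P \<Longrightarrow> y \<in> P \<Longrightarrow> x + y \<in> P"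
    and P_uminus: "x \<in> P \<Longrightarrow> - x \<in> P" and P_s: "s x \<in> P \<longleftrightarrow> x \<in> P"
    and Q_0: "0 \<in> Q" and Q_add: "x \<in> Q \<Longrightarrow> y \<in> Q \<Longrightarrow> x + y \<in> Q"
    and Q_uminus: "x \<in> Q \<Longrightarrow> - x \<in> Q" and Q_s: "s x \<in> Q \<longleftrightarrow> x \<in> Q"
    and UP: "x \<in> U \<Longrightarrow> y \<in> P \<Longrightarrow> x * y \<in> P"
    and UQ: "x \<in> U \<Longrightarrow> y \<in> Q \<Longrightarrow> x * y \<in> Q"
    and PP: "x \<in> P \<Longrightarrow> y \<in> P \<Longrightarrow> x * y \<in> P"
    and QQ: "x \<in> Q \<Longrightarrow> y \<in> Q \<Longrightarrow> x * y \<in> Q"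
    and PQ_P: "x \<in> P \<Longrightarrow> y \<in> Q \<Longrightarrow> x * y \<in> P"
    and PQ_Q: "x \<in> P \<Longrightarrow> y \<in> Q \<Longrightarrow> x * y \<in> Q"
    and U_add_PQ: "u \<in> U \<Longrightarrow> x \<in> P \<Longrightarrow> y \<in> Q \<Longrightarrow> u + x * y \<in> U"
    and eps_Q: "x \<in> Q \<Longrightarrow> \<pi> ^ (2 * r + k) * x \<in> P \<inter> Q"
    and eps_P: "x \<in> P \<Longrightarrow> \<pi> ^ (2 * r + k) * x \<in> P"
begin

lemma P_sum: "(\<And>i. i \<in> A \<Longrightarrow> f i \<in> P) \<Longrightarrow> sum f A \<in> P"
  by (induction A rule: infinite_finite_induct) (auto intro: P_0 P_add)

lemma Q_sum: "(\<And>i. i \<in> A \<Longrightarrow> f i \<in> Q) \<Longrightarrow> sum f A \<in> Q"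
  by (induction A rule: infinite_finite_induct) (auto intro: Q_0 Q_add)

lemma U_add_sum:
  assumes "finite A" "u \<in> U" "\<And>i. i \<in> A \<Longrightarrow> \<exists>x\<in>P. \<exists>y\<in>Q. f i = x * y"
  shows "u + sum f A \<in> U"
  using assms
proof (induction A arbitrary: u)
  case (insert a A)
  then have "u + f a \<in> U" using U_add_PQ by (metis insertI1)
  then have "u + f a + sum f A \<in> U" using insert by (intro insert.IH) auto
  then show ?case using insert by (simp add: add.assoc)
qed simp

lemma sgn_P: "x \<in> P \<Longrightarrow> (- 1) ^ i * x \<in> P"
  by (cases "even i") (auto intro: P_uminus)

lemma sgn_Q: "x \<in> Q \<Longrightarrow> (- 1) ^ i * x \<in> Q"
  by (cases "even i") (auto intro: Q_uminus)

lemma P_sgn: "- ((- 1) ^ i) * x \<in> P \<longleftrightarrow> x \<in> P"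
  using P_uminus by (cases "even i") force+

lemma U_si: "si x \<in> U \<longleftrightarrow> x \<in> U"
  using U_s[of "si x"] by simp

lemma P_si: "si x \<in> P \<longleftrightarrow> x \<in> P"
  using P_s[of "si x"] by simp

lemma Q_si: "si x \<in> Q \<longleftrightarrow> x \<in> Q"
  using Q_s[of "si x"] by simp

text \<open>Membership is tracked column by column because the surjectivity argument constructs the
  columns of g^(-1) g_{b,r}(v) one at a time.\<close>

definition colshape :: "nat \<Rightarrow> 'a vec \<Rightarrow> bool" where
  "colshape j x \<longleftrightarrow> x \<in> CV \<and> x $ j \<in> U \<and> (\<forall>i<j. x $ i \<in> P) \<and> (\<forall>i<2 * n. j < i \<longrightarrow> x $ i \<in> Q)"

definition shape :: "'a mat set" where
  "shape = {g \<in> carrier (GSp n). \<forall>j<2 * n. colshape j (col g j)}"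

lemma colshapeD:
  fixes x :: "'a vec"
  assumes "colshape j x"
  shows "x \<in> CV" "x $ j \<in> U" "i < j \<Longrightarrow> x $ i \<in> P" "j < i \<Longrightarrow> i < 2 * n \<Longrightarrow> x $ i \<in> Q"
  using assms by (auto simp: colshape_def)

lemma shape_entries:
  assumes "g \<in> shape" "i < 2 * n" "j < 2 * n"
  shows "i = j \<Longrightarrow> g $$ (i, j) \<in> U" "i < j \<Longrightarrow> g $$ (i, j) \<in> P" "j < i \<Longrightarrow> g $$ (i, j) \<in> Q"
proof -
  have "g \<in> CM" "colshape j (col g j)" using assms GSp_carrier_mat by (auto simp: shape_def)
  then show "i = j \<Longrightarrow> g $$ (i, j) \<in> U" "i < j \<Longrightarrow> g $$ (i, j) \<in> P" "j < i \<Longrightarrow> g $$ (i, j) \<in> Q"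
    using colshapeD[of j "col g j"] assms by auto
qed

lemma shape_entriesI:
  assumes "g \<in> carrier (GSp n)" "\<And>i. i < 2 * n \<Longrightarrow> g $$ (i, i) \<in> U"
    "\<And>i j. i < j \<Longrightarrow> j < 2 * n \<Longrightarrow> g $$ (i, j) \<in> P" "\<And>i j. j < i \<Longrightarrow> i < 2 * n \<Longrightarrow> g $$ (i, j) \<in> Q"
  shows "g \<in> shape"
proof -
  have "g \<in> CM" using assms GSp_carrier_mat by blast
  then show ?thesis using assms by (auto simp: shape_def colshape_def)
qed

lemma shape_GSp: "g \<in> shape \<Longrightarrow> g \<in> carrier (GSp n)"
  by (simp add: shape_def)

lemma shape_CM: "g \<in> shape \<Longrightarrow> g \<in> CM"
  using shape_GSp GSp_carrier_mat by blast

text \<open>In each off-diagonal sum every product falls into P or Q by one of the mixed rules. On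
  the diagonal the remaining products have one factor in P and one in Q, and \<open>U_add_PQ\<close>
  absorbs them.\<close>

lemma colshape_mult:
  assumes g: "g \<in> shape" and x: "colshape j x" and j: "j < 2 * n"
  shows "colshape j (g *\<^sub>v x)"
proof -
  note xD = colshapeD[OF x] and gD = shape_entries[OF g] and gM = shape_CM[OF g]
  have ent: "(g *\<^sub>v x) $ i = (\<Sum>l<2 * n. g $$ (i, l) * x $ l)" if "i < 2 * n" for i
    using that gM xD(1) by (simp add: scalar_prod_def atLeast0LessThan)
  have "(g *\<^sub>v x) $ i \<in> P" if i: "i < j" for i
  proof -
    have "g $$ (i, l) * x $ l \<in> P" if l: "l < 2 * n" for l
    proof -
      consider "l < i" | "l = i" | "i < l" "l < j" | "l = j" | "j < l" using i by linarith
      then show ?thesis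
      proof cases
        case 1 show ?thesis by (subst mult.commute, rule PQ_P[OF xD(3) gD(3)]) (use 1 i j l in simp_all)
      next
        case 2 show ?thesis by (rule UP[OF gD(1) xD(3)]) (use 2 i j l in simp_all)
      next
        case 3 show ?thesis by (rule PP[OF gD(2) xD(3)]) (use 3 i j l in simp_all)
      next
        case 4 show ?thesis unfolding 4 by (subst mult.commute, rule UP[OF xD(2) gD(2)]) (use 4 i j l in simp_all)
      next
        case 5 show ?thesis by (rule PQ_P[OF gD(2) xD(4)]) (use 5 i j l in simp_all)
      qed
    qed
    then show ?thesis using i j by (auto simp: ent intro!: P_sum simp del: index_mult_mat_vec)
  qed
  moreover have "(g *\<^sub>v x) $ i \<in> Q" if i: "j < i" "i < 2 * n" for i
  proof -
    have "g $$ (i, l) * x $ l \<in> Q" if l: "l < 2 * n" for l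
    proof -
      consider "l < j" | "l = j" | "j < l" "l < i" | "l = i" | "i < l" using i by linarith
      then show ?thesis
      proof cases
        case 1 show ?thesis by (subst mult.commute, rule PQ_Q[OF xD(3) gD(3)]) (use 1 i j l in simp_all)
      next
        case 2 show ?thesis unfolding 2 by (subst mult.commute, rule UQ[OF xD(2) gD(3)]) (use 2 i j l in simp_all)
      next
        case 3 show ?thesis by (rule QQ[OF gD(3) xD(4)]) (use 3 i j l in simp_all)
      next
        case 4 show ?thesis by (rule UQ[OF gD(1) xD(4)]) (use 4 i j l in simp_all)
      next
        case 5 show ?thesis by (rule PQ_Q[OF gD(2) xD(4)]) (use 5 i j l in simp_all)
      qed
    qed
    then show ?thesis using i j by (auto simp: ent intro!: Q_sum simp del: index_mult_mat_vec)
  qed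
  moreover have "(g *\<^sub>v x) $ j \<in> U"
  proof -
    have "(g *\<^sub>v x) $ j = g $$ (j, j) * x $ j + (\<Sum>l\<in>{..<2 * n} - {j}. g $$ (j, l) * x $ l)"
      using j by (simp add: ent sum.remove[of "{..<2 * n}" j] del: index_mult_mat_vec)
    also have "\<dots> \<in> U"
    proof (rule U_add_sum)
      show "g $$ (j, j) * x $ j \<in> U" using gD(1)[of j j] xD(2) j U_mult by blast
      fix l assume l: "l \<in> {..<2 * n} - {j}"
      show "\<exists>a\<in>P. \<exists>c\<in>Q. g $$ (j, l) * x $ l = a * c"
      proof (cases "l < j")
        case True
        then have "x $ l \<in> P" "g $$ (j, l) \<in> Q" using gD(3)[of j l] xD(3)[of l] j l by auto
        then show ?thesis by (metis mult.commute)
      next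
        case False
        then have "g $$ (j, l) \<in> P" "x $ l \<in> Q" using gD(2)[of j l] xD(4)[of l] j l by auto
        then show ?thesis by blast
      qed
    qed simp
    finally show ?thesis .
  qed
  ultimately show ?thesis using gM xD(1) by (simp add: colshape_def)
qed

text \<open>The product of the two distinguished coordinates lies in U and all other terms are in P
  times Q. It controls both the multipliers of group elements and alpha_v.\<close>

lemma pair_U:
  assumes x: "colshape 0 x" and y: "colshape (2 * n - 1) y"
  shows "- ip x y \<in> U"
proof -
  note xD = colshapeD[OF x] and yD = colshapeD[OF y]
  have "- ip x y = (\<Sum>i<2 * n. (- 1) ^ i * x $ i * y $ (2 * n - Suc i))"
    by (simp add: sform_sum[OF xD(1) yD(1)] flip: sum_negf)
  also have "\<dots> = x $ 0 * y $ (2 * n - 1) + (\<Sum>i\<in>{..<2 * n} - {0}. (- 1) ^ i * x $ i * y $ (2 * n - Suc i))"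
    using n_pos by (simp add: sum.remove[of "{..<2 * n}" 0])
  also have "\<dots> \<in> U"
  proof (rule U_add_sum)
    show "x $ 0 * y $ (2 * n - 1) \<in> U" using xD yD U_mult by blast
    fix i assume i: "i \<in> {..<2 * n} - {0}"
    have "(- 1) ^ i * x $ i \<in> Q" using xD(4)[of i] i by (intro sgn_Q) auto
    moreover have "y $ (2 * n - Suc i) \<in> P" using yD(3)[of "2 * n - Suc i"] i by auto
    ultimately show "\<exists>a\<in>P. \<exists>c\<in>Q. (- 1) ^ i * x $ i * y $ (2 * n - Suc i) = a * c"
      by (metis mult.commute)
  qed simp
  finally show ?thesis .
qed

text \<open>Only the coordinate y_0 meets the distinguished coordinate of x, and it lies in P since
  j > 0. This bounds the correction coefficients in the recursion for the G_i.\<close>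

lemma pair_P:
  assumes y: "colshape j y" and j: "0 < j" "j < 2 * n" and x: "colshape (2 * n - 1) x"
  shows "ip y x \<in> P"
proof -
  note xD = colshapeD[OF x] and yD = colshapeD[OF y]
  have "y $ i * x $ (2 * n - Suc i) \<in> P" if i: "i < 2 * n" for i
  proof -
    consider "i = 0" | "0 < i" "i < j" | "i = j" | "j < i" by linarith
    then show ?thesis
    proof cases
      case 1 then show ?thesis using xD(2) yD(3)[of 0] j UP by (simp add: mult.commute[of "y $ 0"])
    next
      case 2 then show ?thesis using xD(3)[of "2 * n - Suc i"] yD(3)[of i] i PP by simp
    next
      case 3 then show ?thesis using xD(3)[of "2 * n - Suc i"] yD(2) i j UP by simp
    next
      case 4 then show ?thesis using xD(3)[of "2 * n - Suc i"] yD(4)[of i] i PQ_P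
        by (simp add: mult.commute[of "y $ i"])
    qed
  qed
  then have "- ((- 1) ^ i) * y $ i * x $ (2 * n - Suc i) \<in> P" if "i < 2 * n" for i
    using that by (simp only: mult.assoc P_sgn)
  then show ?thesis unfolding sform_sum[OF yD(1) xD(1)] by (intro P_sum) auto
qed

lemma shape_similitude:
  assumes g: "g \<in> shape" and c: "similitude_by n g c"
  shows "c \<in> U"
proof -
  have "ip (col g 0) (col g (2 * n - 1)) = - c"
    using similitude_by_cols[OF shape_CM[OF g] c, of 0 "2 * n - 1"] n_pos by simp
  moreover have "colshape 0 (col g 0)" "colshape (2 * n - 1) (col g (2 * n - 1))"
    using g n_pos by (auto simp: shape_def)
  ultimately show ?thesis using pair_U by fastforce
qed

lemma shape_one: "1\<^sub>m (2 * n) \<in> shape"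
proof (rule shape_entriesI)
  show "1\<^sub>m (2 * n) \<in> carrier (GSp n)" using monoid.one_closed[OF group.is_monoid[OF GSp_group]] by fastforce
qed (auto intro: U_one P_0 Q_0)

lemma shape_mult:
  assumes "g \<in> shape" "h \<in> shape"
  shows "g * h \<in> shape"
proof -
  have "colshape j (col (g * h) j)" if "j < 2 * n" for j
  proof -
    have "col (g * h) j = g *\<^sub>v col h j"
      using that by (rule col_mult2[OF shape_CM[OF assms(1)] shape_CM[OF assms(2)]])
    moreover have "colshape j (col h j)" using assms that by (simp add: shape_def)
    ultimately show ?thesis using colshape_mult[OF assms(1) _ that] by simp
  qed
  then show ?thesis using assms by (auto simp: shape_def intro: GSp_mult_closed)
qed

lemma shape_inv:
  assumes g: "g \<in> shape"
  shows "inv\<^bsub>GSp n\<^esub> g \<in> shape"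
proof -
  obtain c where c: "similitude_by n g c" using shape_GSp[OF g] by (rule GSp_memE)
  have cU: "inverse c \<in> U" using shape_similitude[OF g c] by (rule U_inverse)
  have eq: "inv\<^bsub>GSp n\<^esub> g = sadj n g c" by (rule GSp_inv[OF shape_GSp[OF g] c])
  have ent: "sadj n g c $$ (i, j) = (- 1) ^ (i + j) * (inverse c * g $$ (2 * n - Suc j, 2 * n - Suc i))"
    if "i < 2 * n" "j < 2 * n" for i j
    using that by (simp add: sadj_def field_simps)
  show ?thesis
  proof (rule shape_entriesI)
    show "inv\<^bsub>GSp n\<^esub> g \<in> carrier (GSp n)" by (rule GSp_inv_closed[OF shape_GSp[OF g]])
    fix i assume "i < 2 * n"
    then show "(inv\<^bsub>GSp n\<^esub> g) $$ (i, i) \<in> U"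
      using shape_entries(1)[OF g, of "2 * n - Suc i"] cU by (simp add: eq ent U_mult flip: mult_2)
  next
    fix i j assume "i < j" "j < 2 * n"
    then show "(inv\<^bsub>GSp n\<^esub> g) $$ (i, j) \<in> P"
      using shape_entries(2)[OF g, of "2 * n - Suc j" "2 * n - Suc i"] cU by (simp add: eq ent UP sgn_P)
  next
    fix i j assume "j < i" "i < 2 * n"
    then show "(inv\<^bsub>GSp n\<^esub> g) $$ (i, j) \<in> Q"
      using shape_entries(3)[OF g, of "2 * n - Suc j" "2 * n - Suc i"] cU by (simp add: eq ent UQ sgn_Q)
  qed
qed

lemma shape_s: "g \<in> shape \<Longrightarrow> map_mat s g \<in> shape"
proof (rule shape_entriesI)
  assume g: "g \<in> shape"
  then show "map_mat s g \<in> carrier (GSp n)" by (intro GSp_map s_hom shape_GSp)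
  note gM = shape_CM[OF g] and gD = shape_entries[OF g]
  show "map_mat s g $$ (i, i) \<in> U" if "i < 2 * n" for i using that gM gD by (simp add: U_s)
  show "map_mat s g $$ (i, j) \<in> P" if "i < j" "j < 2 * n" for i j using that gM gD by (simp add: P_s)
  show "map_mat s g $$ (i, j) \<in> Q" if "j < i" "i < 2 * n" for i j using that gM gD by (simp add: Q_s)
qed

section \<open>Cosets and membership in Deligne-Lusztig sets\<close>

lemma coset_eq: "coset D shape g = {g * h | h. h \<in> shape}"
  by (auto simp: coset_def l_coset_def)

lemma coset_eq_iff:
  assumes "g \<in> carrier (GSp n)" "g' \<in> carrier (GSp n)"
  shows "coset D shape g = coset D shape g' \<longleftrightarrow> (\<exists>h\<in>shape. g' = g * h)"
proof
  assume "coset D shape g = coset D shape g'"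
  moreover have "g' \<in> coset D shape g'"
    unfolding coset_eq using shape_one GSp_carrier_mat[OF assms(2)]
    by (intro CollectI exI[of _ "1\<^sub>m (2 * n)"]) auto
  ultimately show "\<exists>h\<in>shape. g' = g * h" by (auto simp: coset_eq)
next
  assume "\<exists>h\<in>shape. g' = g * h"
  then obtain h where h: "h \<in> shape" "g' = g * h" by blast
  have gM: "g \<in> CM" using assms GSp_carrier_mat by blast
  have "g * l = g' * (inv\<^bsub>GSp n\<^esub> h * l)" if "l \<in> shape" for l
  proof -
    have "g' * (inv\<^bsub>GSp n\<^esub> h * l) = g * (h * inv\<^bsub>GSp n\<^esub> h) * l"
      using gM shape_CM h that shape_inv[OF h(1)] by (simp add: CM_assoc)
    then show ?thesis using GSp_inv_right[OF shape_GSp[OF h(1)]] gM by simp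
  qed
  moreover have "g' * l = g * (h * l)" if "l \<in> shape" for l
    using gM shape_CM h that by (simp add: CM_assoc)
  ultimately show "coset D shape g = coset D shape g'"
    unfolding coset_eq using h shape_mult shape_inv by blast
qed

lemma DL_setI:
  assumes "g \<in> carrier (GSp n)" "b * map_mat s g = g * (x * \<beta>)" "\<beta> \<in> shape" "x \<in> CM"
  shows "coset D shape g \<in> DL_set D shape x"
proof -
  have M: "g \<in> CM" "inv\<^bsub>GSp n\<^esub> g \<in> CM" "\<beta> \<in> CM"
    using assms GSp_inv_closed GSp_carrier_mat shape_CM by blast+
  have "inv\<^bsub>GSp n\<^esub> g * b * map_mat s g = inv\<^bsub>GSp n\<^esub> g * (g * (x * \<beta>))"
    using M by (simp add: CM_assoc assms(2))
  also have "\<dots> = (inv\<^bsub>GSp n\<^esub> g * g) * (x * \<beta>)"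
    using M assms(4) by (simp add: CM_assoc)
  also have "\<dots> = 1\<^sub>m (2 * n) * x * \<beta>" using GSp_inv_left[OF assms(1)] M assms(4) by simp
  finally have "\<exists>h1\<in>shape. \<exists>h2\<in>shape. inv\<^bsub>GSp n\<^esub> g * b * map_mat s g = h1 * x * h2"
    using assms(3) shape_one by blast
  then show ?thesis
    using assms(1) by (auto simp: DL_set_def Let_def coset_def r_coset_def set_mult_def)
qed

text \<open>Replacing g by g h1 absorbs the left factor of the double coset, at the price of a
  factor sigma(h1) on the right, which stays in the group by Frobenius stability.\<close>

lemma DL_setE:
  assumes "C \<in> DL_set D shape x" "x \<in> CM"
  obtains g \<beta> where "g \<in> carrier (GSp n)" "b * map_mat s g = g * (x * \<beta>)" "\<beta> \<in> shape" "C = coset D shape g"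
proof -
  obtain g h1 h2 where g: "g \<in> carrier (GSp n)" "C = coset D shape g"
    and h: "h1 \<in> shape" "h2 \<in> shape" "inv\<^bsub>GSp n\<^esub> g * b * map_mat s g = h1 * x * h2"
    using assms(1) by (auto simp: DL_set_def Let_def coset_def r_coset_def set_mult_def)
  have M: "g \<in> CM" "inv\<^bsub>GSp n\<^esub> g \<in> CM" "h1 \<in> CM" "h2 \<in> CM" "map_mat s h1 \<in> CM"
    using g h GSp_inv_closed GSp_carrier_mat shape_CM shape_s by blast+
  have "b * map_mat s g = (g * inv\<^bsub>GSp n\<^esub> g) * (b * map_mat s g)"
    using GSp_inv_right[OF g(1)] M by simp
  also have "\<dots> = g * (inv\<^bsub>GSp n\<^esub> g * b * map_mat s g)" using M by (simp add: CM_assoc)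
  finally have bg: "b * map_mat s g = g * (h1 * x * h2)" using h(3) by simp
  have "b * map_mat s (g * h1) = b * map_mat s g * map_mat s h1"
    using M by (simp add: s_mat_mult CM_assoc)
  also have "\<dots> = (g * h1) * (x * (h2 * map_mat s h1))"
    unfolding bg using M assms(2) by (simp add: CM_assoc)
  finally have "b * map_mat s (g * h1) = (g * h1) * (x * (h2 * map_mat s h1))" .
  moreover have "coset D shape g = coset D shape (g * h1)"
    using coset_eq_iff[of g "g * h1"] g h GSp_mult_closed shape_GSp by blast
  moreover have "g * h1 \<in> carrier (GSp n)" using g h GSp_mult_closed shape_GSp by blast
  moreover have "h2 * map_mat s h1 \<in> shape" using h shape_mult shape_s by blast
  ultimately show ?thesis using that g by blast
qed

end

section \<open>Surjectivity\<close>

lemma (in gsp_ctx) wmat_index: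
  assumes y: "y \<in> CV"
  shows "(wmat D r *\<^sub>v y) $ 0 = (- 1) ^ (n + 1) * \<pi> ^ (r + k) * y $ n"
    "1 \<le> p \<Longrightarrow> p < n \<Longrightarrow> (wmat D r *\<^sub>v y) $ p = inverse (\<pi> ^ r) * y $ (p - 1)"
    "n \<le> p \<Longrightarrow> p < 2 * n - 1 \<Longrightarrow> (wmat D r *\<^sub>v y) $ p = \<pi> ^ (r + k) * y $ (p + 1)"
    "(wmat D r *\<^sub>v y) $ (2 * n - 1) = inverse (\<pi> ^ r) * y $ (n - 1)"
proof -
  have ent: "(wmat D r *\<^sub>v y) $ p = c * y $ l"
    if p: "p < 2 * n" and l: "l < 2 * n" and wc: "\<And>j. j < 2 * n \<Longrightarrow> wcol r j $ p = (if j = l then c else 0)" for p l c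
  proof -
    have w: "wmat D r $$ (p, j) = wcol r j $ p" if "j < 2 * n" for j
      using that p by (simp flip: wmat_col add: carrier_matD[OF wmat_carrier])
    have "(wmat D r *\<^sub>v y) $ p = (\<Sum>j = 0..<2 * n. wmat D r $$ (p, j) * y $ j)"
      using p y by (simp add: scalar_prod_def carrier_matD[OF wmat_carrier])
    also have "\<dots> = (\<Sum>j = 0..<2 * n. if j = l then c * y $ j else 0)"
      by (rule sum.cong) (auto simp: w wc)
    also have "\<dots> = c * y $ l" using l by simp
    finally show ?thesis .
  qed
  show "(wmat D r *\<^sub>v y) $ 0 = (- 1) ^ (n + 1) * \<pi> ^ (r + k) * y $ n"
    by (rule ent) (use n_pos in \<open>auto simp: wcol_def\<close>)
  show "(wmat D r *\<^sub>v y) $ p = inverse (\<pi> ^ r) * y $ (p - 1)" if p: "1 \<le> p" "p < n"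
  proof (rule ent)
    fix j assume "j < 2 * n"
    then show "wcol r j $ p = (if j = p - 1 then inverse (\<pi> ^ r) else 0)"
      using p by (cases "j < n - 1"; cases "j = n - 1"; cases "j = n") (auto simp: wcol_def)
  qed (use p in auto)
  show "(wmat D r *\<^sub>v y) $ p = \<pi> ^ (r + k) * y $ (p + 1)" if p: "n \<le> p" "p < 2 * n - 1"
  proof (rule ent)
    fix j assume j: "j < 2 * n"
    have pn: "p < 2 * n" "p \<noteq> 2 * n - 1" "0 < p" using p by linarith+
    consider "j < n - 1" | "j = n - 1" | "j = n" | "n < j" by linarith
    then show "wcol r j $ p = (if j = p + 1 then \<pi> ^ (r + k) else 0)"
    proof cases
      case 1
      then have "j + 1 \<noteq> p" "j \<noteq> p + 1" "j + 1 < 2 * n" using p by linarith+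
      then show ?thesis using 1 pn by (simp add: wcol_def)
    next
      case 2
      then have "j \<noteq> p + 1" using p by linarith
      then show ?thesis using 2 pn by (simp add: wcol_def)
    next
      case 3
      then have "j \<noteq> p + 1" "\<not> j < n - 1" "j \<noteq> n - 1" using p n_pos by linarith+
      then show ?thesis using 3 pn by (simp add: wcol_def)
    next
      case 4
      then have "(p = j - 1) = (j = p + 1)" "\<not> j < n - 1" "j \<noteq> n - 1" "j \<noteq> n" "j - 1 < 2 * n"
        using j by linarith+
      then show ?thesis using pn by (simp add: wcol_def)
    qed
  qed (use p in auto)
  show "(wmat D r *\<^sub>v y) $ (2 * n - 1) = inverse (\<pi> ^ r) * y $ (n - 1)"
    by (rule ent) (use n_pos in \<open>auto simp: wcol_def\<close>)
qed

section \<open>The effect of w_r and its inverse on column shapes\<close>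

context shape_data
begin

text \<open>After the scaling by pi^r the first n coordinates are moved with coefficient 1 and the
  last n acquire pi^(2r+k), up to one sign. This is the origin of the exponent in
  \<open>eps_Q\<close> and \<open>eps_P\<close>.\<close>

definition shift :: "'a vec \<Rightarrow> 'a vec" where
  "shift y = \<pi> ^ r \<cdot>\<^sub>v (wmat D r *\<^sub>v y)"

lemma shift_carrier [simp]: "y \<in> CV \<Longrightarrow> shift y \<in> CV"
  by (simp add: shift_def)

lemma shift_index:
  assumes y: "y \<in> CV"
  shows "shift y $ 0 = (- 1) ^ (n + 1) * (\<pi> ^ (2 * r + k) * y $ n)"
    "1 \<le> p \<Longrightarrow> p < n \<Longrightarrow> shift y $ p = y $ (p - 1)"
    "n \<le> p \<Longrightarrow> p < 2 * n - 1 \<Longrightarrow> shift y $ p = \<pi> ^ (2 * r + k) * y $ (p + 1)"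
    "shift y $ (2 * n - 1) = y $ (n - 1)"
proof -
  have c: "shift y $ p = \<pi> ^ r * (wmat D r *\<^sub>v y) $ p" if "p < 2 * n" for p
    using that by (simp add: shift_def carrier_matD[OF wmat_carrier] del: index_mult_mat_vec)
  have e: "\<pi> ^ (2 * r + k) = \<pi> ^ r * \<pi> ^ (r + k)" by (simp add: power_add mult_2)
  show "shift y $ 0 = (- 1) ^ (n + 1) * (\<pi> ^ (2 * r + k) * y $ n)"
  proof -
    have "0 < 2 * n" using n_pos by simp
    then show ?thesis by (simp only: c wmat_index(1)[OF y] e mult.assoc mult.left_commute)
  qed
  show "1 \<le> p \<Longrightarrow> p < n \<Longrightarrow> shift y $ p = y $ (p - 1)"
    using pi by (simp add: c wmat_index[OF y] del: index_mult_mat_vec)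
  show "n \<le> p \<Longrightarrow> p < 2 * n - 1 \<Longrightarrow> shift y $ p = \<pi> ^ (2 * r + k) * y $ (p + 1)"
    by (simp add: c wmat_index[OF y] e mult.assoc del: index_mult_mat_vec)
  show "shift y $ (2 * n - 1) = y $ (n - 1)"
    using n_pos pi wmat_index(4)[OF y] c[of "2 * n - 1"] by (simp del: index_mult_mat_vec)
qed

lemma eps_QP: "x \<in> Q \<Longrightarrow> \<pi> ^ (2 * r + k) * x \<in> P" and eps_QQ: "x \<in> Q \<Longrightarrow> \<pi> ^ (2 * r + k) * x \<in> Q"
  using eps_Q by auto

text \<open>The first n coordinates slide down by one. What enters position 0 comes from the second
  half, so its factor pi^(2r+k) is needed to pass from Q to P.\<close>

lemma shift_colshape:
  assumes y: "colshape j y" and j: "Suc j < n"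
  shows "colshape (Suc j) (shift y)"
proof -
  note yD = colshapeD[OF y]
  have "shift y $ i \<in> P" if "i < Suc j" for i
  proof (cases "i = 0")
    case True
    have "y $ n \<in> Q" by (rule yD(4)) (use j in auto)
    then show ?thesis unfolding True shift_index(1)[OF yD(1)] by (intro sgn_P eps_QP)
  next
    case False
    then show ?thesis using that j shift_index(2)[OF yD(1), of i] yD(3)[of "i - 1"] by simp
  qed
  moreover have "shift y $ i \<in> Q" if i: "Suc j < i" "i < 2 * n" for i
  proof -
    consider "i < n" | "n \<le> i" "i < 2 * n - 1" | "i = 2 * n - 1" using i by linarith
    then show ?thesis
    proof cases
      case 1
      then show ?thesis using i shift_index(2)[OF yD(1), of i] yD(4)[of "i - 1"] by simp
    next
      case 2
      have "y $ (i + 1) \<in> Q" by (rule yD(4)) (use 2 i in auto)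
      then show ?thesis unfolding shift_index(3)[OF yD(1) 2] by (rule eps_QQ)
    next
      case 3
      have "y $ (n - 1) \<in> Q" by (rule yD(4)) (use j in auto)
      then show ?thesis unfolding 3 shift_index(4)[OF yD(1)] .
    qed
  qed
  moreover have "shift y $ Suc j \<in> U" using j shift_index(2)[OF yD(1), of "Suc j"] yD(2) by simp
  ultimately show ?thesis using yD(1) by (simp add: colshape_def)
qed

text \<open>Position n-1 jumps to 2n-1, so all other coordinates now count as above the diagonal;
  the second half, so far only in Q, reaches P through the factor pi^(2r+k).\<close>

lemma shift_colshape_last:
  assumes y: "colshape (n - 1) y"
  shows "colshape (2 * n - 1) (shift y)"
proof -
  note yD = colshapeD[OF y]
  have "shift y $ i \<in> P" if i: "i < 2 * n - 1" for i
  proof -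
    consider "i = 0" | "1 \<le> i" "i < n" | "n \<le> i" by linarith
    then show ?thesis
    proof cases
      case 1
      have "y $ n \<in> Q" by (rule yD(4)) (use n_pos in auto)
      then show ?thesis unfolding 1 shift_index(1)[OF yD(1)] by (intro sgn_P eps_QP)
    next
      case 2
      then show ?thesis using shift_index(2)[OF yD(1) 2] yD(3)[of "i - 1"] by simp
    next
      case 3
      have "y $ (i + 1) \<in> Q" by (rule yD(4)) (use 3 i in auto)
      then show ?thesis unfolding shift_index(3)[OF yD(1) 3 i] by (rule eps_QP)
    qed
  qed
  moreover have "shift y $ (2 * n - 1) \<in> U" using shift_index(4)[OF yD(1)] yD(2) by simp
  ultimately show ?thesis using yD(1) by (auto simp: colshape_def)
qed

text \<open>This is pi^(r+k) times the inverse of w_r, as \<open>wmat_unshift\<close> confirms. It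
  plays for V the part that \<open>shift\<close> plays for F.\<close>

definition unshift :: "'a vec \<Rightarrow> 'a vec" where
  "unshift z = vec (2 * n) (\<lambda>p. if p < n - 1 then \<pi> ^ (2 * r + k) * z $ (p + 1)
     else if p = n - 1 then \<pi> ^ (2 * r + k) * z $ (2 * n - 1)
     else if p = n then (- 1) ^ (n + 1) * z $ 0 else z $ (p - 1))"

lemma unshift_carrier [simp]: "unshift z \<in> CV"
  by (simp add: unshift_def)

lemma unshift_index:
  "p < n - 1 \<Longrightarrow> unshift z $ p = \<pi> ^ (2 * r + k) * z $ (p + 1)"
  "unshift z $ (n - 1) = \<pi> ^ (2 * r + k) * z $ (2 * n - 1)"
  "unshift z $ n = (- 1) ^ (n + 1) * z $ 0"
  "n < p \<Longrightarrow> p < 2 * n \<Longrightarrow> unshift z $ p = z $ (p - 1)"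
  using n_pos by (auto simp: unshift_def)

lemma wmat_unshift:
  assumes z: "z \<in> CV"
  shows "wmat D r *\<^sub>v unshift z = \<pi> ^ (r + k) \<cdot>\<^sub>v z"
proof (rule eq_vecI)
  fix p assume "p < dim_vec (\<pi> ^ (r + k) \<cdot>\<^sub>v z)"
  then have p: "p < 2 * n" using z by simp
  note wi = wmat_index[OF unshift_carrier]
  have e: "inverse (\<pi> ^ r) * (\<pi> ^ (2 * r + k) * x) = \<pi> ^ (r + k) * x" for x
  proof -
    have "2 * r + k = r + (r + k)" by simp
    then show ?thesis using pi by (simp only: power_add) simp
  qed
  consider "p = 0" | "1 \<le> p" "p < n" | "n \<le> p" "p < 2 * n - 1" | "p = 2 * n - 1" using p by linarith
  then have "(wmat D r *\<^sub>v unshift z) $ p = \<pi> ^ (r + k) * z $ p"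
  proof cases
    case 1
    have "(- 1) ^ (n + 1) * \<pi> ^ (r + k) * ((- 1) ^ (n + 1) * z $ 0) = \<pi> ^ (r + k) * z $ 0"
      by (cases "even n") auto
    then show ?thesis unfolding 1 wi(1) unshift_index(3) .
  next
    case 2
    then have "p - 1 < n - 1" "p - 1 + 1 = p" by auto
    then show ?thesis unfolding wi(2)[OF 2] by (simp add: unshift_index(1) e)
  next
    case 3
    then show ?thesis unfolding wi(3)[OF 3] by (simp add: unshift_index(4))
  next
    case 4
    show ?thesis unfolding 4 wi(4) unshift_index(2) by (rule e)
  qed
  then show "(wmat D r *\<^sub>v unshift z) $ p = (\<pi> ^ (r + k) \<cdot>\<^sub>v z) $ p" using p z by simp
qed (use z in \<open>simp add: carrier_matD[OF wmat_carrier]\<close>)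

lemma unshift_colshape:
  assumes z: "colshape j z" and j: "n \<le> j" "Suc j < 2 * n"
  shows "colshape (Suc j) (unshift z)"
proof -
  note zD = colshapeD[OF z]
  have "unshift z $ i \<in> P" if i: "i < Suc j" for i
  proof -
    consider "i < n - 1" | "i = n - 1" | "i = n" | "n < i" by linarith
    then show ?thesis
    proof cases
      case 1
      have "z $ (i + 1) \<in> P" by (rule zD(3)) (use 1 j in auto)
      then show ?thesis unfolding unshift_index(1)[OF 1] by (rule eps_P)
    next
      case 2
      have "z $ (2 * n - 1) \<in> Q" by (rule zD(4)) (use j in auto)
      then show ?thesis unfolding 2 unshift_index(2) by (rule eps_QP)
    next
      case 3
      have "z $ 0 \<in> P" by (rule zD(3)) (use j n_pos in auto)
      then show ?thesis unfolding 3 unshift_index(3) by (rule sgn_P)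
    next
      case 4
      have "z $ (i - 1) \<in> P" by (rule zD(3)) (use i 4 in auto)
      then show ?thesis using unshift_index(4)[OF 4] i j by simp
    qed
  qed
  moreover have "unshift z $ i \<in> Q" if i: "Suc j < i" "i < 2 * n" for i
  proof -
    have "z $ (i - 1) \<in> Q" by (rule zD(4)) (use i in auto)
    then show ?thesis using unshift_index(4)[of i] i j by simp
  qed
  moreover have "unshift z $ Suc j \<in> U" using unshift_index(4)[of "Suc j"] j zD(2) by simp
  ultimately show ?thesis by (simp add: colshape_def)
qed

lemma unshift_colshape_first:
  assumes z: "colshape 0 z"
  shows "colshape n (unshift ((- 1) ^ (n + 1) \<cdot>\<^sub>v z))"
proof -
  note zD = colshapeD[OF z]
  let ?z = "(- 1) ^ (n + 1) \<cdot>\<^sub>v z"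
  have zi: "?z $ i = (- 1) ^ (n + 1) * z $ i" if "i < 2 * n" for i using that zD(1) by simp
  have zQ: "?z $ i \<in> Q" if "0 < i" "i < 2 * n" for i
    unfolding zi[OF that(2)] by (rule sgn_Q) (use zD(4) that in auto)
  have "unshift ?z $ i \<in> P" if i: "i < n" for i
  proof -
    consider "i < n - 1" | "i = n - 1" using i by linarith
    then show ?thesis
    proof cases
      case 1
      have "?z $ (i + 1) \<in> Q" by (rule zQ) (use 1 in auto)
      then show ?thesis unfolding unshift_index(1)[OF 1] by (rule eps_QP)
    next
      case 2
      have "?z $ (2 * n - 1) \<in> Q" by (rule zQ) (use n_pos in auto)
      then show ?thesis unfolding 2 unshift_index(2) by (rule eps_QP)
    qed
  qed
  moreover have "unshift ?z $ i \<in> Q" if i: "n < i" "i < 2 * n" for i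
    unfolding unshift_index(4)[OF i] by (rule zQ) (use i n_pos in auto)
  moreover have "unshift ?z $ n \<in> U"
  proof -
    have "(- 1) ^ (n + 1) * ((- 1) ^ (n + 1) * z $ 0) = z $ 0" by (cases "even n") auto
    then show ?thesis unfolding unshift_index(3) using zi[of 0] n_pos zD(2) by simp
  qed
  ultimately show ?thesis by (simp add: colshape_def)
qed

lemma colshape_s: "j < 2 * n \<Longrightarrow> colshape j x \<Longrightarrow> colshape j (map_vec s x)"
  by (auto simp: colshape_def U_s P_s Q_s)

lemma colshape_si: "j < 2 * n \<Longrightarrow> colshape j x \<Longrightarrow> colshape j (map_vec si x)"
  by (auto simp: colshape_def U_si P_si Q_si)

lemma colshape_smult:
  assumes u: "u \<in> U" and j: "j < 2 * n" and x: "colshape j x"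
  shows "colshape j (u \<cdot>\<^sub>v x)"
proof -
  note xD = colshapeD[OF x]
  have idx: "(u \<cdot>\<^sub>v x) $ i = u * x $ i" if "i < 2 * n" for i using that xD(1) by simp
  show ?thesis
    using xD(1) j U_mult[OF u xD(2)] UP[OF u xD(3)] UQ[OF u xD(4)]
    by (auto simp: colshape_def idx simp del: index_smult_vec)
qed

text \<open>Models the subtraction of a multiple of v in the recursion for the G_i: the unit
  coordinate of x sits at position 0, above the diagonal for j > 0, so a coefficient in P does no
  harm.\<close>

lemma colshape_diff:
  assumes y: "colshape j y" and j: "0 < j" "j < 2 * n" and x: "colshape 0 x" and c: "c \<in> P"
  shows "colshape j (y - c \<cdot>\<^sub>v x)"
proof -
  note yD = colshapeD[OF y] and xD = colshapeD[OF x]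
  have idx: "(y - c \<cdot>\<^sub>v x) $ i = y $ i + (- c) * x $ i" if "i < 2 * n" for i
    using that xD(1) yD(1) by simp
  have "(y - c \<cdot>\<^sub>v x) $ i \<in> P" if i: "i < j" for i
  proof -
    have "(- c) * x $ i \<in> P"
    proof (cases "i = 0")
      case True
      then show ?thesis using UP[OF xD(2) P_uminus[OF c]] by (simp add: mult.commute)
    next
      case False
      show ?thesis by (rule PQ_P[OF P_uminus[OF c] xD(4)]) (use False i j in auto)
    qed
    moreover have "i < 2 * n" using i j by simp
    ultimately show ?thesis by (simp only: idx P_add[OF yD(3)[OF i]])
  qed
  moreover have "(y - c \<cdot>\<^sub>v x) $ i \<in> Q" if i: "j < i" "i < 2 * n" for i
  proof -
    have "(- c) * x $ i \<in> Q" by (rule PQ_Q[OF P_uminus[OF c] xD(4)]) (use i in auto)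
    then show ?thesis by (simp only: idx[OF i(2)] Q_add[OF yD(4)[OF i]])
  qed
  moreover have "(y - c \<cdot>\<^sub>v x) $ j \<in> U"
    unfolding idx[OF j(2)] by (rule U_add_PQ[OF yD(2) P_uminus[OF c] xD(4)]) (use j in auto)
  ultimately show ?thesis using xD(1) yD(1) by (simp add: colshape_def)
qed

text \<open>The operator pi^r F in g-coordinates, when b sigma(g) = g w_r beta. Its i-th iterate
  represents pi^(ir) F^i, since the Frobenius fixes pi; this matches the scaling of the
  columns.\<close>

definition Phi :: "'a mat \<Rightarrow> 'a vec \<Rightarrow> 'a vec" where
  "Phi \<beta> x = shift (\<beta> *\<^sub>v map_vec s x)"

section \<open>The columns of g_{b,r}(gx) in g-coordinates\<close>

context
  fixes \<beta> :: "'a mat"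
  assumes \<beta>: "\<beta> \<in> shape"
begin

lemma Phi_carrier [simp]: "x \<in> CV \<Longrightarrow> Phi \<beta> x \<in> CV"
  using shape_CM[OF \<beta>] by (simp add: Phi_def)

lemma Phi_pow_carrier [simp]: "x \<in> CV \<Longrightarrow> (Phi \<beta> ^^ i) x \<in> CV"
  by (induction i) auto

lemma Phi_pow_colshape:
  assumes x: "colshape 0 x"
  shows "i < n \<Longrightarrow> colshape i ((Phi \<beta> ^^ i) x)"
proof (induction i)
  case (Suc i)
  then have "colshape i (\<beta> *\<^sub>v map_vec s ((Phi \<beta> ^^ i) x))"
    by (intro colshape_mult[OF \<beta>] colshape_s) auto
  then have "colshape (Suc i) (Phi \<beta> ((Phi \<beta> ^^ i) x))"
    unfolding Phi_def[of \<beta> "(Phi \<beta> ^^ i) x"] using Suc.prems by (rule shift_colshape)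
  then show ?case by simp
qed (use x in simp)

lemma Phi_pow_colshape_last:
  assumes x: "colshape 0 x"
  shows "colshape (2 * n - 1) ((Phi \<beta> ^^ n) x)"
proof -
  obtain m where m: "n = Suc m" using n_pos by (cases n) auto
  have "colshape (n - 1) (\<beta> *\<^sub>v map_vec s ((Phi \<beta> ^^ (n - 1)) x))"
    by (intro colshape_mult[OF \<beta>] colshape_s Phi_pow_colshape x) (use n_pos in auto)
  then have "colshape (2 * n - 1) (Phi \<beta> ((Phi \<beta> ^^ (n - 1)) x))"
    unfolding Phi_def by (rule shift_colshape_last)
  moreover have "(Phi \<beta> ^^ n) x = Phi \<beta> ((Phi \<beta> ^^ (n - 1)) x)" using m by simp
  ultimately show ?thesis by simp
qed

context
  fixes g :: "'a mat" and x :: "'a vec" and la :: 'a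
  assumes g: "g \<in> carrier (GSp n)" and bg: "b * map_mat s g = g * (wmat D r * \<beta>)"
    and la: "similitude_by n g la" "la \<noteq> 0"
    and x: "colshape 0 x" and iso: "\<And>i. 1 \<le> i \<Longrightarrow> i < n \<Longrightarrow> ip x ((Phi \<beta> ^^ i) x) = 0"
begin

lemma g_CM [simp]: "g \<in> CM"
  by (rule GSp_carrier_mat[OF g])

lemma F_gmult: "y \<in> CV \<Longrightarrow> F (g *\<^sub>v y) = g *\<^sub>v (wmat D r *\<^sub>v (\<beta> *\<^sub>v map_vec s y))"
proof -
  assume y: "y \<in> CV"
  have "F (g *\<^sub>v y) = (b * map_mat s g) *\<^sub>v map_vec s y"
    using y by (simp add: Fop_def s_vec_mult assoc_mult_mat_vec[of b "2 * n" "2 * n" "map_mat s g" "2 * n"])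
  also have "\<dots> = g *\<^sub>v ((wmat D r * \<beta>) *\<^sub>v map_vec s y)"
    unfolding bg using y shape_CM[OF \<beta>]
    by (intro assoc_mult_mat_vec[of _ "2 * n" "2 * n" _ "2 * n"]) auto
  also have "(wmat D r * \<beta>) *\<^sub>v map_vec s y = wmat D r *\<^sub>v (\<beta> *\<^sub>v map_vec s y)"
    using y shape_CM[OF \<beta>]
    by (intro assoc_mult_mat_vec[of _ "2 * n" "2 * n" _ "2 * n"]) auto
  finally show ?thesis .
qed

lemma pi_F_gmult: "y \<in> CV \<Longrightarrow> \<pi> ^ r \<cdot>\<^sub>v F (g *\<^sub>v y) = g *\<^sub>v Phi \<beta> y"
  using shape_CM[OF \<beta>] by (simp add: F_gmult Phi_def shift_def mult_mat_vec[OF g_CM])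

abbreviation "gx \<equiv> g *\<^sub>v x"

lemma x_CV [simp]: "x \<in> CV"
  by (rule colshapeD(1)[OF x])

lemma Fpow_gmult: "\<pi> ^ (i * r) \<cdot>\<^sub>v (F ^^ i) gx = g *\<^sub>v (Phi \<beta> ^^ i) x"
proof (induction i)
  case (Suc i)
  have "\<pi> ^ (Suc i * r) \<cdot>\<^sub>v (F ^^ Suc i) gx = \<pi> ^ r \<cdot>\<^sub>v F (\<pi> ^ (i * r) \<cdot>\<^sub>v (F ^^ i) gx)"
    by (simp add: F_smult smult_smult_assoc power_add)
  then show ?case by (simp add: Suc.IH pi_F_gmult)
qed simp

text \<open>The similitude g transports pairings up to its multiplier, so the isotropy conditions on
  v = g x become those on x and the iterates of \<open>Phi\<close>.\<close>

lemma pair_Phi: "y \<in> CV \<Longrightarrow> ip (g *\<^sub>v y) ((F ^^ i) gx) = inverse (\<pi> ^ (i * r)) * (la * ip y ((Phi \<beta> ^^ i) x))"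
proof -
  assume y: "y \<in> CV"
  have "la * ip y ((Phi \<beta> ^^ i) x) = ip (g *\<^sub>v y) (\<pi> ^ (i * r) \<cdot>\<^sub>v (F ^^ i) gx)"
    unfolding Fpow_gmult by (rule similitude_byD[OF la(1), symmetric]) (use y in auto)
  also have "\<dots> = \<pi> ^ (i * r) * ip (g *\<^sub>v y) ((F ^^ i) gx)"
    using y by (simp add: sform_smult_right)
  finally show ?thesis using pi by simp
qed

abbreviation "xx \<equiv> ip x ((Phi \<beta> ^^ n) x)"

lemma xx_U: "- xx \<in> U"
  by (rule pair_U[OF x Phi_pow_colshape_last[OF x]])

lemma xx_nonzero: "xx \<noteq> 0"
  using xx_U U_nonzero by auto

lemma alpha_v: "\<alpha> gx = inverse (\<pi> ^ (n * r)) * (la * xx)"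
  unfolding alpha_def form_def by (rule pair_Phi) simp

lemma v_Vsymp: "gx \<in> Vsymp D"
  using xx_nonzero la pi iso by (intro VsympI) (auto simp: pair_Phi)

text \<open>Multipliers in b sigma(g) = g w_r beta give sigma(lambda(g)) = lambda(g) lambda(beta).
  Hence the ratio is lambda(beta) times sigma(xx)/xx, and all these factors lie in U.\<close>

lemma alpha_ratio: "s (\<alpha> gx) / \<alpha> gx \<in> U"
proof -
  obtain lb where lb: "similitude_by n \<beta> lb" using shape_GSp[OF \<beta>] by (rule GSp_memE)
  have lbU: "lb \<in> U" by (rule shape_similitude[OF \<beta> lb])
  have "similitude_by n (b * map_mat s g) (- (\<pi> ^ k) * s la)"
    by (intro similitude_by_mult b_similitude similitude_by_map s_hom la) auto
  moreover have "similitude_by n (g * (wmat D r * \<beta>)) (la * (- (\<pi> ^ k) * lb))"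
    by (intro similitude_by_mult la wmat_similitude lb) (use shape_CM[OF \<beta>] in auto)
  ultimately have "- (\<pi> ^ k) * s la = la * (- (\<pi> ^ k) * lb)"
    unfolding bg using similitude_by_unique[OF n_pos(1)] shape_CM[OF \<beta>] by (metis CM_mult g_CM wmat_carrier)
  then have "\<pi> ^ k * s la = \<pi> ^ k * (la * lb)" by (simp add: mult_ac)
  then have sl: "s la = la * lb" using pi by (simp only: mult_cancel_left power_eq_0_iff) simp
  have sa: "s (\<alpha> gx) = inverse (\<pi> ^ (n * r)) * (la * lb * s xx)"
    unfolding alpha_v by (simp only: s.hom_mult s.hom_inverse s_pi_pow sl)
  have "s (\<alpha> gx) / \<alpha> gx = lb * (s xx / xx)"
    unfolding sa unfolding alpha_v using pi la xx_nonzero by (simp add: field_simps)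
  then have "s (\<alpha> gx) / \<alpha> gx = lb * (s (- xx) * inverse (- xx))"
    by (simp add: s.hom_uminus divide_inverse)
  moreover have "lb * (s (- xx) * inverse (- xx)) \<in> U"
    by (intro U_mult lbU U_inverse[OF xx_U]) (simp only: U_s xx_U)
  ultimately show ?thesis by (simp only:)
qed

lemma alpha_ratio': "\<alpha> gx / si (\<alpha> gx) \<in> U"
proof -
  have "si (s (\<alpha> gx) / \<alpha> gx) = \<alpha> gx / si (\<alpha> gx)" by (simp add: divide_inverse si.hom_mult si.hom_inverse)
  then show ?thesis using alpha_ratio U_si by metis
qed

text \<open>The operator pi^r V in g-coordinates, obtained by inverting \<open>Phi\<close> up to a
  power of pi.\<close>

definition Psi :: "'a vec \<Rightarrow> 'a vec" where
  "Psi z = map_vec si (inv\<^bsub>GSp n\<^esub> \<beta> *\<^sub>v unshift z)"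

lemma Psi_carrier [simp]: "Psi z \<in> CV"
  using shape_CM[OF shape_inv[OF \<beta>]] by (simp add: Psi_def)

lemma pi_V_gmult:
  assumes z: "z \<in> CV"
  shows "\<pi> ^ r \<cdot>\<^sub>v V (g *\<^sub>v z) = g *\<^sub>v Psi z"
proof -
  note ib = shape_CM[OF shape_inv[OF \<beta>]]
  have "F (g *\<^sub>v Psi z) = g *\<^sub>v (wmat D r *\<^sub>v ((\<beta> * inv\<^bsub>GSp n\<^esub> \<beta>) *\<^sub>v unshift z))"
    using F_gmult[OF Psi_carrier, of z] assoc_mult_mat_vec[OF shape_CM[OF \<beta>] ib unshift_carrier, of z]
    by (simp add: Psi_def)
  also have "\<dots> = g *\<^sub>v (\<pi> ^ (r + k) \<cdot>\<^sub>v z)"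
    using GSp_inv_right[OF shape_GSp[OF \<beta>]] by (simp add: wmat_unshift[OF z])
  also have "\<dots> = \<pi> ^ k \<cdot>\<^sub>v (\<pi> ^ r \<cdot>\<^sub>v (g *\<^sub>v z))"
    using z by (simp add: mult_mat_vec[OF g_CM] smult_smult_assoc power_add mult.commute)
  finally have "V (\<pi> ^ r \<cdot>\<^sub>v (g *\<^sub>v z)) = g *\<^sub>v Psi z" using z by (intro V_eqI) auto
  then show ?thesis using z by (simp add: V_smult)
qed

lemma Hvec_gmult_step:
  assumes z: "z \<in> CV" and H: "\<pi> ^ l \<cdot>\<^sub>v h = g *\<^sub>v z" "h \<in> CV"
  shows "\<pi> ^ (r + l) \<cdot>\<^sub>v Gstep D gx h =
    g *\<^sub>v ((\<alpha> gx / si (\<alpha> gx)) \<cdot>\<^sub>v (Psi z - (ip (Psi z) ((Phi \<beta> ^^ n) x) / xx) \<cdot>\<^sub>v x))"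
proof -
  have V: "\<pi> ^ (r + l) \<cdot>\<^sub>v V h = g *\<^sub>v Psi z"
  proof -
    have "\<pi> ^ (r + l) \<cdot>\<^sub>v V h = \<pi> ^ r \<cdot>\<^sub>v V (\<pi> ^ l \<cdot>\<^sub>v h)"
      using H(2) by (simp add: V_smult smult_smult_assoc power_add)
    then show ?thesis using pi_V_gmult[OF z] H(1) by simp
  qed
  have c: "\<pi> ^ (r + l) * (ip (V h) ((F ^^ n) gx) / \<alpha> gx) = ip (Psi z) ((Phi \<beta> ^^ n) x) / xx"
  proof -
    have "\<pi> ^ (r + l) * ip (V h) ((F ^^ n) gx) = ip (g *\<^sub>v Psi z) ((F ^^ n) gx)"
      using H(2) by (simp add: sform_smult_left flip: V)
    also have "\<dots> = inverse (\<pi> ^ (n * r)) * (la * ip (Psi z) ((Phi \<beta> ^^ n) x))" by (simp add: pair_Phi)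
    finally have "\<pi> ^ (r + l) * (ip (V h) ((F ^^ n) gx) / \<alpha> gx)
        = inverse (\<pi> ^ (n * r)) * (la * ip (Psi z) ((Phi \<beta> ^^ n) x)) / \<alpha> gx" by simp
    then show ?thesis unfolding alpha_v using pi la xx_nonzero by simp
  qed
  have "\<pi> ^ (r + l) \<cdot>\<^sub>v Gstep D gx h = (\<alpha> gx / si (\<alpha> gx)) \<cdot>\<^sub>v (\<pi> ^ (r + l) \<cdot>\<^sub>v V h
      - (\<pi> ^ (r + l) * (ip (V h) ((F ^^ n) gx) / \<alpha> gx)) \<cdot>\<^sub>v gx)"
    unfolding Gstep_eq using H(2)
    by (intro eq_vecI) (auto simp: carrier_vecD[OF V_carrier] carrier_matD[OF g_CM] right_diff_distrib mult_ac simp del: index_mult_mat_vec)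
  also have "\<dots> = g *\<^sub>v ((\<alpha> gx / si (\<alpha> gx)) \<cdot>\<^sub>v (Psi z - (ip (Psi z) ((Phi \<beta> ^^ n) x) / xx) \<cdot>\<^sub>v x))"
    unfolding V c by (simp add: mult_mat_vec[OF g_CM] mult_minus_distrib_mat_vec[OF g_CM])
  finally show ?thesis .
qed

text \<open>The correction coefficient is a quotient of an element of P by an element of U up to
  sign, hence lies in P; the prefactor is the inverse Frobenius twist of
  \<open>alpha_ratio\<close>.\<close>

lemma Psi_step_colshape:
  assumes z: "colshape j (Psi z)" and j: "n \<le> j" "j < 2 * n"
  shows "colshape j ((\<alpha> gx / si (\<alpha> gx)) \<cdot>\<^sub>v (Psi z - (ip (Psi z) ((Phi \<beta> ^^ n) x) / xx) \<cdot>\<^sub>v x))"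
proof -
  have j0: "0 < j" using j n_pos by simp
  have "ip (Psi z) ((Phi \<beta> ^^ n) x) \<in> P"
    by (rule pair_P[OF z j0 j(2) Phi_pow_colshape_last[OF x]])
  then have "inverse (- xx) * - ip (Psi z) ((Phi \<beta> ^^ n) x) \<in> P"
    by (intro UP U_inverse xx_U P_uminus)
  then have "ip (Psi z) ((Phi \<beta> ^^ n) x) / xx \<in> P" by (simp add: field_simps)
  then show ?thesis using alpha_ratio' x z j j0 by (intro colshape_smult colshape_diff) auto
qed

lemma Psi_colshape:
  assumes "colshape j (unshift z)" "j < 2 * n"
  shows "colshape j (Psi z)"
  unfolding Psi_def using assms by (intro colshape_si colshape_mult shape_inv \<beta>)

text \<open>G_(i+1) occupies the zero-based column n + i. The first step carries shape 0 to shape n;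
  each later one raises the position by one.\<close>

lemma Hvec_gmult:
  "Suc i < n \<Longrightarrow> \<exists>z. colshape (n + i) z \<and> \<pi> ^ (Suc i * r) \<cdot>\<^sub>v Hvec gx (Suc i) = g *\<^sub>v z"
proof (induction i)
  case 0
  let ?z = "(- 1) ^ (n + 1) \<cdot>\<^sub>v x"
  have "\<pi> ^ 0 \<cdot>\<^sub>v Hvec gx 0 = g *\<^sub>v ?z" by (simp add: Hvec_0 mult_mat_vec[OF g_CM])
  from Hvec_gmult_step[OF _ this] have eq: "\<pi> ^ r \<cdot>\<^sub>v Hvec gx (Suc 0) = g *\<^sub>v ((\<alpha> gx / si (\<alpha> gx)) \<cdot>\<^sub>v (Psi ?z - (ip (Psi ?z) ((Phi \<beta> ^^ n) x) / xx) \<cdot>\<^sub>v x))"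
    by (simp add: Hvec_Suc)
  moreover have "colshape n (Psi ?z)"
    by (rule Psi_colshape[OF unshift_colshape_first[OF x]]) (use n_pos in auto)
  then have "colshape n ((\<alpha> gx / si (\<alpha> gx)) \<cdot>\<^sub>v (Psi ?z - (ip (Psi ?z) ((Phi \<beta> ^^ n) x) / xx) \<cdot>\<^sub>v x))"
    by (rule Psi_step_colshape) (use n_pos in auto)
  ultimately show ?case by auto
next
  case (Suc i)
  then obtain z where z: "colshape (n + i) z" "\<pi> ^ (Suc i * r) \<cdot>\<^sub>v Hvec gx (Suc i) = g *\<^sub>v z" by auto
  have "\<pi> ^ (r + Suc i * r) \<cdot>\<^sub>v Hvec gx (Suc (Suc i)) = g *\<^sub>v ((\<alpha> gx / si (\<alpha> gx)) \<cdot>\<^sub>v (Psi z - (ip (Psi z) ((Phi \<beta> ^^ n) x) / xx) \<cdot>\<^sub>v x))"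
    unfolding Hvec_Suc[of gx "Suc i"] by (rule Hvec_gmult_step[OF colshapeD(1)[OF z(1)] z(2)]) simp
  moreover have "colshape (Suc (n + i)) (Psi z)"
    by (rule Psi_colshape[OF unshift_colshape[OF z(1)]]) (use Suc.prems in auto)
  then have "colshape (Suc (n + i)) ((\<alpha> gx / si (\<alpha> gx)) \<cdot>\<^sub>v (Psi z - (ip (Psi z) ((Phi \<beta> ^^ n) x) / xx) \<cdot>\<^sub>v x))"
    by (rule Psi_step_colshape) (use Suc.prems in auto)
  ultimately show ?case by auto
qed

lemma gcol_gmult:
  assumes j: "j < 2 * n"
  shows "\<exists>z. colshape j z \<and> gcol r gx j = g *\<^sub>v z"
proof -
  consider "j < n" | "n \<le> j" "j < 2 * n - 1" | "j = 2 * n - 1" using j by linarith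
  then show ?thesis
  proof cases
    case 1
    then show ?thesis using Fpow_gmult[of j] Phi_pow_colshape[OF x 1] by (auto simp: gcol_def)
  next
    case 2
    then show ?thesis using Hvec_gmult[of "j - n"] by (auto simp: gcol_def)
  next
    case 3
    then have "\<not> j < n" "\<not> j < 2 * n - 1" using n_pos by auto
    then show ?thesis using Fpow_gmult[of n] Phi_pow_colshape_last[OF x] 3 by (auto simp: gcol_def)
  qed
qed

text \<open>Every column of g^(-1) g_{b,r}(v) has the prescribed shape, and the matrix is a
  similitude because v lies in the symplectic locus; together this is membership in the
  group.\<close>

lemma coset_gmat: "coset D shape g = coset D shape (gmat D r gx)"
proof -
  let ?h = "inv\<^bsub>GSp n\<^esub> g * gmat D r gx"
  have ig: "inv\<^bsub>GSp n\<^esub> g \<in> CM" using GSp_inv_closed[OF g] GSp_carrier_mat by blast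
  have "?h \<in> shape"
    unfolding shape_def
  proof (intro CollectI conjI allI impI)
    show "?h \<in> carrier (GSp n)" by (intro GSp_mult_closed GSp_inv_closed g gmat_GSp v_Vsymp)
    fix j assume j: "j < 2 * n"
    obtain z where z: "colshape j z" "gcol r gx j = g *\<^sub>v z" using gcol_gmult[OF j] by blast
    have "col ?h j = inv\<^bsub>GSp n\<^esub> g *\<^sub>v col (gmat D r gx) j"
      by (rule col_mult2[OF ig gmat_carrier j])
    also have "\<dots> = (inv\<^bsub>GSp n\<^esub> g * g) *\<^sub>v z"
      using colshapeD(1)[OF z(1)] ig j by (simp add: gmat_col z(2) assoc_mult_mat_vec[OF ig g_CM])
    also have "\<dots> = z" using GSp_inv_left[OF g] colshapeD(1)[OF z(1)] by simp
    finally show "colshape j (col ?h j)" using z by simp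
  qed
  moreover have "gmat D r gx = g * ?h"
  proof -
    have "g * ?h = (g * inv\<^bsub>GSp n\<^esub> g) * gmat D r gx" using ig by (simp add: CM_assoc)
    then show ?thesis using GSp_inv_right[OF g] by simp
  qed
  ultimately show ?thesis using coset_eq_iff[OF g gmat_GSp[OF v_Vsymp]] by blast
qed

end

end

text \<open>The two hypotheses are where the four groups differ: the first is the valuation estimate
  coming from basicness, the second solves the isotropy equations.\<close>

lemma gmat_DL_image:
  assumes tc: "\<And>v l. v \<in> Vsymp D \<Longrightarrow> l < n \<Longrightarrow> tcoef r v l \<in> P"
    and iso: "\<And>\<beta>. \<beta> \<in> shape \<Longrightarrow> \<exists>x. colshape 0 x \<and> (\<forall>i. 1 \<le> i \<longrightarrow> i < n \<longrightarrow> ip x ((Phi \<beta> ^^ i) x) = 0)"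
  shows "(\<lambda>v. coset D shape (gmat D r v)) ` {v \<in> Vsymp D. s (\<alpha> v) / \<alpha> v \<in> U} = DL_set D shape (wmat D r)"
proof (intro equalityI subsetI)
  fix C assume "C \<in> (\<lambda>v. coset D shape (gmat D r v)) ` {v \<in> Vsymp D. s (\<alpha> v) / \<alpha> v \<in> U}"
  then obtain v where v: "v \<in> Vsymp D" "s (\<alpha> v) / \<alpha> v \<in> U" and C: "C = coset D shape (gmat D r v)" by blast
  obtain \<beta> where \<beta>: "\<beta> \<in> carrier (GSp n)" "b * map_mat s (gmat D r v) = gmat D r v * (wmat D r * \<beta>)"
    "\<And>i. i < 2 * n \<Longrightarrow> \<beta> $$ (i, i) = (if i < n then 1 else s (\<alpha> v) / \<alpha> v)"
    "\<And>i j. i < 2 * n \<Longrightarrow> j < i \<Longrightarrow> \<beta> $$ (i, j) = 0"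
    "\<And>i j. i < j \<Longrightarrow> j < 2 * n \<Longrightarrow>
       \<beta> $$ (i, j) = 0 \<or> (\<exists>l<n. \<beta> $$ (i, j) = tcoef r v l \<or> \<beta> $$ (i, j) = - tcoef r v l)"
    by (rule gmat_relative_position[OF v(1), where r = r]) blast
  have "\<beta> \<in> shape"
  proof (rule shape_entriesI[OF \<beta>(1)])
    show "\<beta> $$ (i, i) \<in> U" if "i < 2 * n" for i using \<beta>(3)[OF that] U_one v(2) by simp
    show "\<beta> $$ (i, j) \<in> P" if "i < j" "j < 2 * n" for i j
      using \<beta>(5)[OF that] tc[OF v(1)] P_0 P_uminus by auto
    show "\<beta> $$ (i, j) \<in> Q" if "j < i" "i < 2 * n" for i j using \<beta>(4)[OF that(2,1)] Q_0 by simp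
  qed
  then show "C \<in> DL_set D shape (wmat D r)"
    unfolding C by (rule DL_setI[OF gmat_GSp[OF v(1)] \<beta>(2)]) simp
next
  fix C assume "C \<in> DL_set D shape (wmat D r)"
  then obtain g \<beta> where g: "g \<in> carrier (GSp n)" "b * map_mat s g = g * (wmat D r * \<beta>)" "\<beta> \<in> shape"
    "C = coset D shape g"
    using DL_setE[OF _ wmat_carrier] by metis
  obtain la where la: "similitude_by n g la" "la \<noteq> 0" using g(1) by (rule GSp_memE)
  obtain x where x: "colshape 0 x" "\<And>i. 1 \<le> i \<Longrightarrow> i < n \<Longrightarrow> ip x ((Phi \<beta> ^^ i) x) = 0"
    using iso[OF g(3)] by blast
  note ctx = g(3,1,2) la x(1)
  have "g *\<^sub>v x \<in> Vsymp D" by (rule v_Vsymp[OF ctx]) (rule x(2))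
  moreover have "s (\<alpha> (g *\<^sub>v x)) / \<alpha> (g *\<^sub>v x) \<in> U" by (rule alpha_ratio[OF ctx]) (rule x(2))
  moreover have "coset D shape g = coset D shape (gmat D r (g *\<^sub>v x))"
    by (rule coset_gmat[OF ctx]) (rule x(2))
  ultimately show "C \<in> (\<lambda>v. coset D shape (gmat D r v)) ` {v \<in> Vsymp D. s (\<alpha> v) / \<alpha> v \<in> U}"
    unfolding g(4) by blast
qed

end

section \<open>Solving the isotropy equations\<close>

text \<open>Covers the two groups defined by congruences. \<open>U_add_P\<close> says that U is
  stable under small perturbations, which keeps the distinguished coordinate in U in the limit of
  the successive approximations.\<close>

locale shape_val = shape_data D r U P Q
  for D :: "'a::field gsp_datum" and r :: nat and U P Q :: "'a set" +
  fixes m :: nat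
  assumes mrk: "m + 1 \<le> r + kap D"
    and P_def: "P = ppow (vord D) (int m + 1)" and Q_def: "Q = ppow (vord D) (int m)"
    and U_unit: "x \<in> U \<Longrightarrow> vord D x = 0"
    and U_add_P: "x \<in> U \<Longrightarrow> y \<in> P \<Longrightarrow> x + y \<in> U"
begin

definition vp :: "int \<Rightarrow> 'a vec \<Rightarrow> bool" where
  "vp N x \<longleftrightarrow> x \<in> CV \<and> (\<forall>p<2 * n. x $ p \<in> ppow w N)"

lemma vpD:
  fixes x :: "'a vec"
  shows "vp N x \<Longrightarrow> x \<in> CV" "vp N x \<Longrightarrow> p < 2 * n \<Longrightarrow> x $ p \<in> ppow w N"
  by (auto simp: vp_def)

lemma vp_mono: "vp N x \<Longrightarrow> M \<le> N \<Longrightarrow> vp M x"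
  by (auto simp: vp_def intro: ppow_mono)

lemma vp_add: "vp N x \<Longrightarrow> vp N y \<Longrightarrow> vp N (x + y)"
  by (auto simp: vp_def intro!: ppow_add)

lemma U_integral: "x \<in> U \<Longrightarrow> x \<in> ppow w 0"
  using U_unit by (auto simp: ppow_def)

lemma P_integral: "x \<in> P \<Longrightarrow> x \<in> ppow w 0" and Q_integral: "x \<in> Q \<Longrightarrow> x \<in> ppow w 0"
  by (auto simp: P_def Q_def elim: ppow_mono)

lemma ip_ppow: "vp M x \<Longrightarrow> vp N y \<Longrightarrow> ip x y \<in> ppow w (M + N)"
proof -
  assume x: "vp M x" and y: "vp N y"
  have "- ((- 1) ^ i) * x $ i * y $ (2 * n - Suc i) \<in> ppow w (M + N)" if "i < 2 * n" for i
  proof -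
    have "x $ i * y $ (2 * n - Suc i) \<in> ppow w (M + N)" by (intro ppow_mult vpD(2)[OF x] vpD(2)[OF y]) (use that in auto)
    then show ?thesis by (cases "even i") (auto simp: mult.assoc)
  qed
  then show ?thesis unfolding sform_sum[OF vpD(1)[OF x] vpD(1)[OF y]] by (intro ppow_sum) auto
qed

lemma colshape_integral: "colshape j x \<Longrightarrow> vp 0 x"
  unfolding vp_def
proof (intro conjI allI impI)
  assume x: "colshape j x"
  note xD = colshapeD[OF x]
  show "x \<in> CV" by (rule xD)
  fix p assume "p < 2 * n"
  then show "x $ p \<in> ppow w 0"
    using xD U_integral P_integral Q_integral by (cases p j rule: linorder_cases) auto
qed

lemma shape_integral: "g \<in> shape \<Longrightarrow> i < 2 * n \<Longrightarrow> j < 2 * n \<Longrightarrow> g $$ (i, j) \<in> ppow w 0"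
  using shape_entries[of g i j] U_integral P_integral Q_integral by (cases i j rule: linorder_cases) auto

lemma eps_ppow: "x \<in> ppow w N \<Longrightarrow> \<pi> ^ (2 * r + k) * x \<in> ppow w (N + 1)"
proof -
  assume x: "x \<in> ppow w N"
  have "\<pi> ^ (2 * r + k) \<in> ppow w 1" using pi mrk by (auto simp: ppow_def w_power)
  from ppow_mult[OF this x] show ?thesis by (simp add: add.commute)
qed

text \<open>The second half may be worse by one order because its factor pi^(2r+k) has positive
  valuation.\<close>

lemma shift_vp:
  fixes y :: "'a vec"
  assumes y: "y \<in> CV" "\<And>p. p < 2 * n \<Longrightarrow> n \<le> p \<Longrightarrow> y $ p \<in> ppow w (N - 1)"
    "\<And>p. p < n \<Longrightarrow> y $ p \<in> ppow w N"
  shows "vp N (shift y)"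
  unfolding vp_def
proof (intro conjI allI impI)
  show "shift y \<in> CV" using y by simp
  fix p assume p: "p < 2 * n"
  have eps: "\<pi> ^ (2 * r + k) * y $ q \<in> ppow w N" if "q < 2 * n" "n \<le> q" for q
    using eps_ppow[OF y(2)[OF that]] by simp
  consider "p = 0" | "1 \<le> p" "p < n" | "n \<le> p" "p < 2 * n - 1" | "p = 2 * n - 1" using p by linarith
  then show "shift y $ p \<in> ppow w N"
  proof cases
    case 1
    have "\<pi> ^ (2 * r + k) * y $ n \<in> ppow w N" by (rule eps) (use n_pos in auto)
    then show ?thesis unfolding 1 shift_index(1)[OF y(1)] by (cases "even n") auto
  next
    case 2
    then show ?thesis unfolding shift_index(2)[OF y(1) 2] by (intro y(3)) auto
  next
    case 3
    then show ?thesis unfolding shift_index(3)[OF y(1) 3] by (intro eps) auto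
  next
    case 4
    show ?thesis unfolding 4 shift_index(4)[OF y(1)] by (rule y(3)) (use n_pos in auto)
  qed
qed

context
  fixes \<beta> :: "'a mat"
  assumes \<beta>: "\<beta> \<in> shape"
begin

lemma beta_index: "x \<in> CV \<Longrightarrow> p < 2 * n \<Longrightarrow> (\<beta> *\<^sub>v map_vec s x) $ p = (\<Sum>l<2 * n. \<beta> $$ (p, l) * s (x $ l))"
  using shape_CM[OF \<beta>] by (simp add: scalar_prod_def atLeast0LessThan)

lemma beta_vp: "vp N x \<Longrightarrow> p < 2 * n \<Longrightarrow> (\<beta> *\<^sub>v map_vec s x) $ p \<in> ppow w N"
proof -
  assume x: "vp N x" and p: "p < 2 * n"
  have "\<beta> $$ (p, l) * s (x $ l) \<in> ppow w N" if "l < 2 * n" for l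
    by (rule ppow_mult_le[OF shape_integral[OF \<beta> p that], of _ N]) (use vpD(2)[OF x that] in auto)
  then show ?thesis unfolding beta_index[OF vpD(1)[OF x] p] by (intro ppow_sum) auto
qed

lemma Phi_vp: "vp N x \<Longrightarrow> vp N (Phi \<beta> x)"
  unfolding Phi_def
  by (rule shift_vp) (use shape_CM[OF \<beta>] in \<open>auto simp: vpD(1) intro: beta_vp ppow_mono simp del: index_mult_mat_vec\<close>)

lemma Phi_pow_vp: "vp N x \<Longrightarrow> vp N ((Phi \<beta> ^^ i) x)"
  by (induction i) (auto intro: Phi_vp)

text \<open>\<open>Phi\<close> contracts vectors supported in the second half of the coordinates; this makes the
  quadratic isotropy equations linear up to higher order.\<close>

lemma Phi_contract:
  fixes x :: "'a vec"
  assumes x: "vp N x" and supp: "\<And>p. p < n \<Longrightarrow> x $ p = 0"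
  shows "vp (N + 1) (Phi \<beta> x)"
  unfolding Phi_def
proof (rule shift_vp)
  show "\<beta> *\<^sub>v map_vec s x \<in> CV" using vpD(1)[OF x] shape_CM[OF \<beta>] by simp
  show "(\<beta> *\<^sub>v map_vec s x) $ p \<in> ppow w (N + 1 - 1)" if "p < 2 * n" for p
    using beta_vp[OF x that] by simp
  fix p assume p: "p < n"
  then have p2: "p < 2 * n" by simp
  have "\<beta> $$ (p, l) * s (x $ l) \<in> ppow w (N + 1)" if l: "l < 2 * n" for l
  proof (cases "l < n")
    case True
    then show ?thesis using supp by simp
  next
    case False
    then have "\<beta> $$ (p, l) \<in> P" using shape_entries(2)[OF \<beta> p2 l] p by simp
    then have "\<beta> $$ (p, l) \<in> ppow w (int m + 1)" by (simp add: P_def)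
    then show ?thesis by (rule ppow_mult_le[of _ _ _ N]) (use vpD(2)[OF x l] in auto)
  qed
  then show "(\<beta> *\<^sub>v map_vec s x) $ p \<in> ppow w (N + 1)"
    unfolding beta_index[OF vpD(1)[OF x] p2] by (intro ppow_sum) auto
qed

lemma Phi_add: "x \<in> CV \<Longrightarrow> y \<in> CV \<Longrightarrow> Phi \<beta> (x + y) = Phi \<beta> x + Phi \<beta> y"
  using shape_CM[OF \<beta>]
  by (simp add: Phi_def shift_def s_vec_add mult_add_distrib_mat_vec[OF shape_CM[OF \<beta>]]
      mult_add_distrib_mat_vec[OF wmat_carrier] smult_add_distrib_vec[of _ "2 * n"])

lemma Phi_pow_add: "x \<in> CV \<Longrightarrow> y \<in> CV \<Longrightarrow> (Phi \<beta> ^^ i) (x + y) = (Phi \<beta> ^^ i) x + (Phi \<beta> ^^ i) y"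
  by (induction i) (auto simp: Phi_add Phi_pow_carrier[OF \<beta>])

abbreviation "defect i x \<equiv> ip x ((Phi \<beta> ^^ i) x)"

lemma defect_add:
  assumes "x \<in> CV" "y \<in> CV"
  shows "defect i (x + y) = defect i x + ip y ((Phi \<beta> ^^ i) x) + ip (x + y) ((Phi \<beta> ^^ i) y)"
  using assms by (simp add: Phi_pow_add sform_add_left sform_add_right Phi_pow_carrier[OF \<beta>])

text \<open>A Newton step for equation i: change x in the coordinate 2n-1-i, which is dual to the
  unit coordinate of Phi^i x. For j > i coordinate i of Phi^j x lies in P, so those equations keep
  their extra order; for 1 <= j < i the order N is preserved.\<close>

lemma improve_one:
  assumes x: "colshape 0 x" and N: "int m \<le> N" and i: "1 \<le> i" "i < n"
    and d: "\<And>j. 1 \<le> j \<Longrightarrow> j < n \<Longrightarrow> defect j x \<in> ppow w N"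
    and d1: "\<And>j. i < j \<Longrightarrow> j < n \<Longrightarrow> defect j x \<in> ppow w (N + 1)"
  shows "\<exists>y. colshape 0 (x + y) \<and> vp N y \<and> (\<forall>j. 1 \<le> j \<longrightarrow> j < n \<longrightarrow> defect j (x + y) \<in> ppow w N)
    \<and> (\<forall>j. i \<le> j \<longrightarrow> j < n \<longrightarrow> defect j (x + y) \<in> ppow w (N + 1))"
proof -
  note xD = colshapeD[OF x]
  let ?X = "\<lambda>j. (Phi \<beta> ^^ j) x"
  have Xs: "colshape j (?X j)" if "j < n" for j by (rule Phi_pow_colshape[OF \<beta> x that])
  have Xi: "?X i $ i \<in> U" by (rule colshapeD(2)[OF Xs[OF i(2)]])
  \<comment> \<open>Chosen so that the linear term <y, Phi^i x> equals minus the defect; the sign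
    comes from pairing with the unit vector at 2n-1-i.\<close>
  define c where "c = - ((- 1) ^ i) * (inverse (?X i $ i) * defect i x)"
  define q where "q = 2 * n - Suc i"
  define y where "y = c \<cdot>\<^sub>v e q"
  have q: "q < 2 * n" "n \<le> q" "2 * n - Suc q = i" using i by (auto simp: q_def)
  have cN: "c \<in> ppow w N"
  proof -
    have "inverse (?X i $ i) * defect i x \<in> ppow w N"
      by (rule ppow_mult_le[OF U_integral[OF U_inverse[OF Xi]] d[OF i]]) simp
    then show ?thesis unfolding c_def by (cases "even i") auto
  qed
  have yN: "vp N y" using cN q by (auto simp: vp_def y_def)
  have yCV: "y \<in> CV" by (rule vpD(1)[OF yN])
  have ysupp: "y $ p = 0" if "p < n" for p using that q by (simp add: y_def)
  have pairy: "ip y (?X j) = c * ((- 1) ^ i * ?X j $ i)" if "j < n" for j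
  proof -
    have "(- 1 :: 'a) ^ q = - ((- 1) ^ i)" using i by (simp add: q_def minus_one_reflect)
    then show ?thesis
      using q colshapeD(1)[OF Xs[OF that]] by (simp add: y_def sform_smult_left sform_unit_left)
  qed
  have shape_xy: "colshape 0 (x + y)"
  proof -
    have "(x + y) $ 0 = x $ 0" using xD(1) yCV ysupp[of 0] n_pos by simp
    moreover have "(x + y) $ p \<in> Q" if "0 < p" "p < 2 * n" for p
      using xD(1) yCV xD(4)[OF that] vpD(2)[OF vp_mono[OF yN N] that(2)] that
      by (simp add: Q_def ppow_add)
    ultimately show ?thesis using xD yCV by (simp add: colshape_def)
  qed
  \<comment> \<open>The part with \<open>Phi\<close> applied to y is of order N + 1, since y is
    supported in the second half and the first application of \<open>Phi\<close> contracts
    it.\<close>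
  have last: "ip (x + y) ((Phi \<beta> ^^ j) y) \<in> ppow w (N + 1)" if j: "1 \<le> j" for j
  proof -
    have "(Phi \<beta> ^^ j) y = (Phi \<beta> ^^ (j - 1)) (Phi \<beta> y)"
      using j by (cases j) (simp_all add: funpow_swap1)
    then have "vp (N + 1) ((Phi \<beta> ^^ j) y)" using Phi_pow_vp[OF Phi_contract[OF yN ysupp]] by simp
    from ip_ppow[OF colshape_integral[OF shape_xy] this] show ?thesis by simp
  qed
  have eq: "defect j (x + y) = defect j x + ip y (?X j) + ip (x + y) ((Phi \<beta> ^^ j) y)" for j
    by (rule defect_add[OF xD(1) yCV])
  have N1: "a \<in> ppow w N" if "a \<in> ppow w (N + 1)" for a by (rule ppow_mono[OF that]) simp
  have "defect j (x + y) \<in> ppow w N" if j: "1 \<le> j" "j < n" for j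
  proof -
    have "vp 0 (?X j)" by (rule colshape_integral[OF Xs[OF j(2)]])
    from ip_ppow[OF yN this] have "ip y (?X j) \<in> ppow w N" by simp
    then show ?thesis unfolding eq using d[OF j] N1[OF last[OF j(1)]] by (intro ppow_add)
  qed
  moreover have "defect j (x + y) \<in> ppow w (N + 1)" if j: "i \<le> j" "j < n" for j
  proof (cases "j = i")
    case True
    have "?X i $ i \<noteq> 0" using Xi U_nonzero by metis
    then have "c * ((- 1) ^ i * ?X i $ i) = - defect i x" by (cases "even i") (auto simp: c_def)
    then have "defect i (x + y) = ip (x + y) ((Phi \<beta> ^^ i) y)" unfolding eq pairy[OF i(2)] by simp
    then show ?thesis using True last[OF i(1)] by simp
  next
    case False
    then have ij: "i < j" using j by simp
    have "?X j $ i \<in> ppow w (int m + 1)" using colshapeD(3)[OF Xs[OF j(2)] ij] by (simp add: P_def)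
    then have "(- 1) ^ i * ?X j $ i \<in> ppow w (int m + 1)" by (cases "even i") auto
    then have "ip y (?X j) \<in> ppow w (N + 1)"
      unfolding pairy[OF j(2)] by (rule ppow_mult_le[OF cN]) (use N in auto)
    then show ?thesis unfolding eq using d1[OF ij j(2)] last[of j] i j by (intro ppow_add) auto
  qed
  ultimately show ?thesis using shape_xy yN by blast
qed

text \<open>The equations are treated from n-1 downwards, since a correction for i may disturb those
  below it; t counts how many are already improved.\<close>

lemma improve:
  assumes x: "colshape 0 x" and N: "int m \<le> N"
    and d: "\<And>j. 1 \<le> j \<Longrightarrow> j < n \<Longrightarrow> defect j x \<in> ppow w N"
  shows "\<exists>y. colshape 0 (x + y) \<and> vp N y \<and> (\<forall>j. 1 \<le> j \<longrightarrow> j < n \<longrightarrow> defect j (x + y) \<in> ppow w (N + 1))"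
proof -
  have "t \<le> n - 1 \<Longrightarrow> \<exists>y. colshape 0 (x + y) \<and> vp N y \<and> (\<forall>j. 1 \<le> j \<longrightarrow> j < n \<longrightarrow> defect j (x + y) \<in> ppow w N)
    \<and> (\<forall>j. n - t \<le> j \<longrightarrow> j < n \<longrightarrow> defect j (x + y) \<in> ppow w (N + 1))" for t
  proof (induction t)
    case 0
    have "x + 0\<^sub>v (2 * n) = x" using colshapeD(1)[OF x] by simp
    then show ?case using x d by (intro exI[of _ "0\<^sub>v (2 * n)"]) (auto simp: vp_def)
  next
    case (Suc t)
    then obtain y where y: "colshape 0 (x + y)" "vp N y" "\<And>j. 1 \<le> j \<Longrightarrow> j < n \<Longrightarrow> defect j (x + y) \<in> ppow w N"
      "\<And>j. n - t \<le> j \<Longrightarrow> j < n \<Longrightarrow> defect j (x + y) \<in> ppow w (N + 1)" by auto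
    have i: "1 \<le> n - Suc t" "n - Suc t < n" using Suc.prems by auto
    obtain y' where y': "colshape 0 (x + y + y')" "vp N y'"
      "\<And>j. 1 \<le> j \<Longrightarrow> j < n \<Longrightarrow> defect j (x + y + y') \<in> ppow w N"
      "\<And>j. n - Suc t \<le> j \<Longrightarrow> j < n \<Longrightarrow> defect j (x + y + y') \<in> ppow w (N + 1)"
      using improve_one[OF y(1) N i y(3)] y(4) by force
    have "x + y + y' = x + (y + y')"
      by (rule assoc_add_vec) (use colshapeD(1)[OF x] vpD(1)[OF y(2)] vpD(1)[OF y'(2)] in auto)
    then show ?case using y' vp_add[OF y(2) y'(2)] by (intro exI[of _ "y + y'"]) auto
  qed
  from this[of "n - 1"] obtain y where y: "colshape 0 (x + y)" "vp N y"
    "\<And>j. n - (n - 1) \<le> j \<Longrightarrow> j < n \<Longrightarrow> defect j (x + y) \<in> ppow w (N + 1)" by auto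
  have "n - (n - 1) = 1" using n_pos by simp
  then show ?thesis using y by auto
qed

text \<open>Start from the first unit vector, whose defects are last coordinates of columns of shape
  j < n and so lie in Q = p^m. Each round gains one order, and completeness of the full field gives
  a limit whose defects lie in every power of p.\<close>

lemma exists_isotropic: "\<exists>x. colshape 0 x \<and> (\<forall>i. 1 \<le> i \<longrightarrow> i < n \<longrightarrow> defect i x = 0)"
proof -
  define good where "good t x \<longleftrightarrow> colshape 0 x \<and> (\<forall>j. 1 \<le> j \<longrightarrow> j < n \<longrightarrow> defect j x \<in> ppow w (int (m + t)))" for t x
  have e0: "colshape 0 (e 0)" using n_pos by (auto simp: colshape_def U_one Q_0)
  have start: "good 0 (e 0)"
    unfolding good_def
  proof (intro conjI allI impI e0)
    fix j assume j: "1 \<le> j" "j < n"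
    note sh = Phi_pow_colshape[OF \<beta> e0 j(2)]
    have "(Phi \<beta> ^^ j) (e 0) $ (2 * n - 1) \<in> Q" by (rule colshapeD(4)[OF sh]) (use j in auto)
    then show "defect j (e 0) \<in> ppow w (int (m + 0))"
      using colshapeD(1)[OF sh] n_pos by (simp add: sform_unit_left Q_def)
  qed
  have step: "\<exists>x'. good (Suc t) x' \<and> (\<exists>y. vp (int (m + t)) y \<and> x' = x + y)" if "good t x" for t x
    using improve[of x "int (m + t)"] that by (auto simp: good_def add.commute)
  obtain a where X: "\<And>t. good t (a t)" "\<And>t. \<exists>y. vp (int (m + t)) y \<and> a (Suc t) = a t + y"
    using dependent_nat_choice[of good "\<lambda>t x x'. \<exists>y. vp (int (m + t)) y \<and> x' = x + y"] start step by metis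
  have XC: "colshape 0 (a t)" for t using X(1) by (simp add: good_def)
  have comp: "complete_in w UNIV" using setting by (simp add: gsp_setting_def completed_max_unramified_def)
  have "\<exists>l. \<forall>t. l - a t $ p \<in> ppow w (int t)" if p: "p < 2 * n" for p
  proof -
    have "a (Suc t) $ p - a t $ p \<in> ppow w (int t)" for t
    proof -
      obtain y where y: "vp (int (m + t)) y" "a (Suc t) = a t + y" using X(2) by blast
      have "a (Suc t) $ p - a t $ p = y $ p"
        using y colshapeD(1)[OF XC[of t]] vpD(1)[OF y(1)] p by simp
      then show ?thesis using ppow_mono[OF vpD(2)[OF y(1) p], of "int t"] by simp
    qed
    then show ?thesis using complete_increments[OF comp, of "\<lambda>t. a t $ p"] by auto
  qed
  then obtain l where l: "\<And>p t. p < 2 * n \<Longrightarrow> l p - a t $ p \<in> ppow w (int t)" by metis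
  define x where "x = vec (2 * n) l"
  have xCV: "x \<in> CV" by (simp add: x_def)
  define dd where "dd t = x - a t" for t
  have dv: "vp (int t) (dd t)" for t
    using l colshapeD(1)[OF XC[of t]] by (auto simp: vp_def dd_def x_def)
  have xeq: "x = a t + dd t" for t
    using xCV colshapeD(1)[OF XC[of t]] by (intro eq_vecI) (auto simp: dd_def)
  have xi: "x $ p = a t $ p + dd t $ p" if "p < 2 * n" for p t
    using xCV colshapeD(1)[OF XC[of t]] that by (simp add: dd_def)
  have xs: "colshape 0 x"
  proof -
    \<comment> \<open>Two different approximations are used: precision m + 1 keeps the distinguished
      coordinate in U, precision m keeps the others in Q.\<close>
    have "dd (m + 1) $ p \<in> P" if "p < 2 * n" for p
      using vpD(2)[OF dv that, of "m + 1"] by (simp add: P_def add.commute)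
    then have "a (m + 1) $ 0 + dd (m + 1) $ 0 \<in> U"
      using n_pos by (intro U_add_P colshapeD(2)[OF XC]) auto
    moreover have "a m $ p + dd m $ p \<in> Q" if "0 < p" "p < 2 * n" for p
      using colshapeD(4)[OF XC that] vpD(2)[OF dv that(2)] by (intro Q_add) (auto simp: Q_def)
    ultimately show ?thesis
      using xCV xi[of 0 "m + 1"] xi[of _ m] n_pos by (simp add: colshape_def)
  qed
  have "defect j x = 0" if j: "1 \<le> j" "j < n" for j
  proof (rule ppow_all_nat)
    fix t
    have "defect j (a t) \<in> ppow w (int (m + t))" using X(1)[of t] j by (simp add: good_def)
    then have "defect j (a t) \<in> ppow w (int t)" by (rule ppow_mono) simp
    moreover have "ip (dd t) ((Phi \<beta> ^^ j) (a t)) \<in> ppow w (int t)"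
      using ip_ppow[OF dv Phi_pow_vp[OF colshape_integral[OF XC]], of t j t] by simp
    moreover have "ip x ((Phi \<beta> ^^ j) (dd t)) \<in> ppow w (int t)"
      using ip_ppow[OF colshape_integral[OF xs] Phi_pow_vp[OF dv], of j t] by simp
    ultimately show "defect j x \<in> ppow w (int t)"
      using defect_add[of "a t" "dd t" j] colshapeD(1)[OF XC] vpD(1)[OF dv] xeq[of t, symmetric]
      by (simp add: ppow_add)
  qed
  then show ?thesis using xs by blast
qed

end

text \<open>The scaling of the column contributes at least r and the slope bound contributes k;
  their sum is at least m + 1 by hypothesis.\<close>

lemma tcoef_P:
  assumes "v \<in> Vsymp D" "l < n"
  shows "tcoef r v l \<in> P"
proof -
  have "\<pi> ^ (Suc l * r) \<in> ppow w (int r)" using pi by (simp add: ppow_def w_power)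
  then show ?thesis
    unfolding tcoef_def P_def by (rule ppow_mult_le[OF _ Hvec_ratio_ppow[OF assms(1)]]) (use mrk in auto)
qed

lemma gmat_DL_image_val:
  "(\<lambda>v. coset D shape (gmat D r v)) ` {v \<in> Vsymp D. s (\<alpha> v) / \<alpha> v \<in> U} = DL_set D shape (wmat D r)"
  by (rule gmat_DL_image) (use tcoef_P exists_isotropic in auto)

end

section \<open>Quotients and equivariance\<close>

text \<open>The quotient relation is by definition the fibre relation of f, so bijectivity onto the
  image is automatic. Inverses in J are required only on A, which suffices to make J permute the
  classes.\<close>

locale acted_map =
  fixes J :: "'j set" and act :: "'j \<Rightarrow> 'x \<Rightarrow> 'x" and A :: "'x set" and f :: "'x \<Rightarrow> 'y"
    and aT :: "'j \<Rightarrow> 'y \<Rightarrow> 'y"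
  assumes act_closed: "j \<in> J \<Longrightarrow> x \<in> A \<Longrightarrow> act j x \<in> A"
    and act_f: "j \<in> J \<Longrightarrow> x \<in> A \<Longrightarrow> f (act j x) = aT j (f x)"
    and act_inverse: "j \<in> J \<Longrightarrow> \<exists>j'\<in>J. \<forall>x\<in>A. act j (act j' x) = x \<and> act j' (act j x) = x"
begin

definition R :: "('x \<times> 'x) set" where
  "R = {(x, y). x \<in> A \<and> y \<in> A \<and> f x = f y}"

lemma equiv_R: "equiv A R"
  by (rule equivI) (auto simp: R_def refl_on_def sym_def trans_def)

lemma image_class: "x \<in> A \<Longrightarrow> f ` (R `` {x}) = {f x}"
  by (auto simp: R_def)

lemma descends_R: "descends f (A // R)"
  unfolding descends_def by (auto elim!: quotientE simp: image_class)

lemma induced_class: "x \<in> A \<Longrightarrow> induced f (R `` {x}) = f x"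
  by (simp add: induced_def image_class)

lemma bij_induced: "bij_betw (induced f) (A // R) (f ` A)"
proof (rule bij_betwI')
  fix C C' assume "C \<in> A // R" "C' \<in> A // R"
  then obtain x x' where x: "x \<in> A" "C = R `` {x}" "x' \<in> A" "C' = R `` {x'}" by (auto elim!: quotientE)
  have "C = C' \<longleftrightarrow> (x, x') \<in> R" unfolding x(2,4) by (rule eq_equiv_class_iff[OF equiv_R x(1,3)])
  also have "\<dots> \<longleftrightarrow> f x = f x'" using x(1,3) by (simp add: R_def)
  finally show "induced f C = induced f C' \<longleftrightarrow> C = C'" using x by (simp add: induced_class)
next
  show "induced f C \<in> f ` A" if "C \<in> A // R" for C
    using that by (auto elim!: quotientE simp: induced_class)
  show "\<exists>C\<in>A // R. y = induced f C" if "y \<in> f ` A" for y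
    using that by (auto simp: induced_class intro!: bexI[of _ "R `` {x}" for x] quotientI)
qed

text \<open>The translate of a class is contained in a class by equivariance; the inverse element
  shows that it exhausts that class.\<close>

lemma act_class:
  assumes j: "j \<in> J" and x: "x \<in> A"
  shows "act j ` (R `` {x}) = R `` {act j x}"
proof (intro equalityI subsetI)
  fix z assume "z \<in> act j ` (R `` {x})"
  then show "z \<in> R `` {act j x}" using j x by (auto simp: R_def act_closed act_f)
next
  fix z assume "z \<in> R `` {act j x}"
  then have z: "z \<in> A" "f z = f (act j x)" by (auto simp: R_def)
  obtain j' where j': "j' \<in> J" "\<And>x. x \<in> A \<Longrightarrow> act j (act j' x) = x \<and> act j' (act j x) = x"
    using act_inverse[OF j] by blast
  have "f (act j' z) = f (act j' (act j x))" using z j x j'(1) by (simp add: act_f act_closed)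
  then have "act j' z \<in> R `` {x}" using z(1) j' x by (auto simp: R_def act_closed)
  then show "z \<in> act j ` (R `` {x})" using j'(2)[OF z(1)] by (metis image_eqI)
qed

lemma equivariant_induced: "equivariant J (\<lambda>j C. act j ` C) (A // R) aT (f ` A) (induced f)"
  unfolding equivariant_def
proof (intro conjI ballI)
  show "induced f ` (A // R) \<subseteq> f ` A" by (auto elim!: quotientE simp: induced_class)
  fix j assume j: "j \<in> J"
  show "act j ` C \<in> A // R" if "C \<in> A // R" for C
    using that j by (auto elim!: quotientE simp: act_class intro!: quotientI act_closed)
  show "aT j y \<in> f ` A" if "y \<in> f ` A" for y
    using that j by (auto simp flip: act_f intro: act_closed)
  show "induced f (act j ` C) = aT j (induced f C)" if "C \<in> A // R" for C
    using that j by (auto elim!: quotientE simp: act_class induced_class act_closed act_f)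
qed

end

text \<open>In both diagrams the vertical maps forget part of the information in a coset, so they are
  determined by their values on the classes of vectors.\<close>

locale acted_square = f1: acted_map J act A1 f1 aT + f2: acted_map J act A2 f2 aT
  for J :: "'j set" and act :: "'j \<Rightarrow> 'x \<Rightarrow> 'x" and A1 A2 :: "'x set" and f1 f2 :: "'x \<Rightarrow> 'y"
    and aT :: "'j \<Rightarrow> 'y \<Rightarrow> 'y" +
  fixes ver :: "'y \<Rightarrow> 'y"
  assumes sub: "A1 \<subseteq> A2" and ver: "x \<in> A1 \<Longrightarrow> ver (f1 x) = f2 x"
begin

lemma equivariant_ver: "equivariant J aT (f1 ` A1) aT (f2 ` A2) ver"
  unfolding equivariant_def
proof (intro conjI ballI)
  show "ver ` f1 ` A1 \<subseteq> f2 ` A2" using sub ver by auto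
  fix j assume j: "j \<in> J"
  show "aT j y \<in> f1 ` A1" if "y \<in> f1 ` A1" for y
    using that j by (auto simp flip: f1.act_f intro: f1.act_closed)
  show "aT j y \<in> f2 ` A2" if "y \<in> f2 ` A2" for y
    using that j by (auto simp flip: f2.act_f intro: f2.act_closed)
  fix y assume "y \<in> f1 ` A1"
  then obtain x where x: "x \<in> A1" "y = f1 x" by blast
  then have "ver (aT j y) = f2 (act j x)" using j by (simp add: f1.act_closed ver flip: f1.act_f)
  then show "ver (aT j y) = aT j (ver y)" using x j sub by (simp add: ver f2.act_f subsetD)
qed

lemma class_const:
  assumes "(x, y) \<in> f1.R"
  shows "f2.R `` {x} = f2.R `` {y}"
proof (rule equiv_class_eq[OF f2.equiv_R])
  have "x \<in> A1" "y \<in> A1" "f1 x = f1 y" using assms by (auto simp: f1.R_def)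
  then show "(x, y) \<in> f2.R" using ver[of x] ver[of y] sub by (auto simp: f2.R_def)
qed

lemma image_class_ver:
  assumes x: "x \<in> A1"
  shows "(\<lambda>v. f2.R `` {v}) ` (f1.R `` {x}) = {f2.R `` {x}}"
proof -
  have "x \<in> f1.R `` {x}" using x by (simp add: f1.R_def)
  moreover have "f2.R `` {y} = f2.R `` {x}" if "y \<in> f1.R `` {x}" for y
    using class_const[of x y] that by simp
  ultimately show ?thesis by blast
qed

lemma descends_ver: "descends (\<lambda>v. f2.R `` {v}) (A1 // f1.R)"
  unfolding descends_def by (auto elim!: quotientE simp: image_class_ver)

lemma induced_ver: "x \<in> A1 \<Longrightarrow> induced (\<lambda>v. f2.R `` {v}) (f1.R `` {x}) = f2.R `` {x}"
  by (simp add: induced_def image_class_ver)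

lemma square_quotient:
  "equivariant_bij_square J (\<lambda>j C. act j ` C) (A1 // f1.R) aT (f1 ` A1)
     (\<lambda>j C. act j ` C) (A2 // f2.R) aT (f2 ` A2)
     (induced f1) (induced (\<lambda>v. f2.R `` {v})) ver (induced f2)"
  unfolding equivariant_bij_square_def
proof (intro conjI ballI f1.equivariant_induced f2.equivariant_induced f1.bij_induced f2.bij_induced
    equivariant_ver)
  show "ver (induced f1 C) = induced f2 (induced (\<lambda>v. f2.R `` {v}) C)" if "C \<in> A1 // f1.R" for C
    using that sub by (auto elim!: quotientE simp: f1.induced_class induced_ver f2.induced_class ver subsetD)
  show "equivariant J (\<lambda>j C. act j ` C) (A1 // f1.R) (\<lambda>j C. act j ` C) (A2 // f2.R) (induced (\<lambda>v. f2.R `` {v}))"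
    unfolding equivariant_def
  proof (intro conjI ballI)
    show "induced (\<lambda>v. f2.R `` {v}) ` (A1 // f1.R) \<subseteq> A2 // f2.R"
      using sub by (auto elim!: quotientE simp: induced_ver intro!: quotientI)
    fix j assume j: "j \<in> J"
    show "act j ` C \<in> A1 // f1.R" if "C \<in> A1 // f1.R" for C
      using that j by (auto elim!: quotientE simp: f1.act_class intro!: quotientI f1.act_closed)
    show "act j ` C \<in> A2 // f2.R" if "C \<in> A2 // f2.R" for C
      using that j by (auto elim!: quotientE simp: f2.act_class intro!: quotientI f2.act_closed)
    show "induced (\<lambda>v. f2.R `` {v}) (act j ` C) = act j ` induced (\<lambda>v. f2.R `` {v}) C"
      if C: "C \<in> A1 // f1.R" for C
    proof -
      obtain x where x: "x \<in> A1" "C = f1.R `` {x}" using C by (auto elim!: quotientE)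
      have "x \<in> A2" using x sub by blast
      then show ?thesis
        unfolding x(2) f1.act_class[OF j x(1)] induced_ver[OF x(1)] induced_ver[OF f1.act_closed[OF j x(1)]]
        by (simp only: f2.act_class[OF j])
    qed
  qed
qed

text \<open>The variant for the first diagram, whose upper source consists of vectors and not of
  classes.\<close>

lemma square_inj:
  assumes inj: "inj_on f1 A1"
  shows "equivariant_bij_square J act A1 aT (f1 ` A1)
     (\<lambda>j C. act j ` C) (A2 // f2.R) aT (f2 ` A2)
     f1 (\<lambda>v. f2.R `` {v}) ver (induced f2)"
  unfolding equivariant_bij_square_def
proof (intro conjI ballI f2.equivariant_induced f2.bij_induced equivariant_ver)
  show "bij_betw f1 A1 (f1 ` A1)" using inj by (rule inj_on_imp_bij_betw)
  show "ver (f1 x) = induced f2 (f2.R `` {x})" if "x \<in> A1" for x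
    using that sub by (simp add: ver f2.induced_class subsetD)
  show "equivariant J act A1 aT (f1 ` A1) f1"
    using f1.act_closed f1.act_f unfolding equivariant_def
    by (auto simp flip: f1.act_f)
  show "equivariant J act A1 (\<lambda>j C. act j ` C) (A2 // f2.R) (\<lambda>v. f2.R `` {v})"
    using f1.act_closed sub unfolding equivariant_def
    by (auto elim!: quotientE simp: f2.act_class subsetD intro!: quotientI f2.act_closed)
qed

end

section \<open>The two diagrams\<close>

context gsp_ctx
begin

lemma J_act_coset:
  assumes j: "j \<in> J_grp D" and v: "v \<in> Vsymp D" and H: "H \<subseteq> CM"
  shows "coset D H (gmat D r (j *\<^sub>v v)) = coset_act D j (coset D H (gmat D r v))"
proof -
  obtain c where c: "similitude_by n j c" "c \<noteq> 0" "s c = c" by (rule J_similitude[OF j])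
  have "gmat D r (j *\<^sub>v v) = j * gmat D r v" by (rule J_gmat[OF j c v])
  moreover have "j * gmat D r v * h = j * (gmat D r v * h)" if "h \<in> H" for h
    using that H J_comm(2)[OF j] by (intro CM_assoc) auto
  ultimately show ?thesis
    by (auto simp: coset_def coset_act_def l_coset_def)
qed

lemma J_act_inverse:
  assumes j: "j \<in> J_grp D"
  shows "\<exists>j'\<in>J_grp D. \<forall>x\<in>CV. j *\<^sub>v (j' *\<^sub>v x) = x \<and> j' *\<^sub>v (j *\<^sub>v x) = x"
proof (intro bexI ballI)
  show i: "inv\<^bsub>GSp n\<^esub> j \<in> J_grp D" by (rule J_inv[OF j])
  fix x assume x: "x \<in> CV"
  note jm = J_comm(1,2)[OF j] and im = J_comm(2)[OF i]
  show "j *\<^sub>v (inv\<^bsub>GSp n\<^esub> j *\<^sub>v x) = x \<and> inv\<^bsub>GSp n\<^esub> j *\<^sub>v (j *\<^sub>v x) = x"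
    using x GSp_inv_right[OF jm(1)] GSp_inv_left[OF jm(1)]
    by (simp flip: assoc_mult_mat_vec[OF jm(2) im] assoc_mult_mat_vec[OF im jm(2)])
qed

lemma J_act_Vsymp:
  assumes j: "j \<in> J_grp D" and v: "v \<in> Vsymp D"
  shows "j *\<^sub>v v \<in> Vsymp D" "s (\<alpha> (j *\<^sub>v v)) / \<alpha> (j *\<^sub>v v) = s (\<alpha> v) / \<alpha> v"
proof -
  obtain c where c: "similitude_by n j c" "c \<noteq> 0" "s c = c" by (rule J_similitude[OF j])
  show "j *\<^sub>v v \<in> Vsymp D" by (rule J_Vsymp[OF j c v])
  show "s (\<alpha> (j *\<^sub>v v)) / \<alpha> (j *\<^sub>v v) = s (\<alpha> v) / \<alpha> v"
    unfolding J_alpha[OF j c VsympD(1)[OF v]] using c VsympD[OF v] by (simp add: s.hom_mult)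
qed

lemma acted_coset_map:
  assumes H: "H \<subseteq> CM"
  shows "acted_map (J_grp D) (*\<^sub>v) {v \<in> Vsymp D. s (\<alpha> v) / \<alpha> v \<in> U} (\<lambda>v. coset D H (gmat D r v)) (coset_act D)"
proof
  fix j assume j: "j \<in> J_grp D"
  show "j *\<^sub>v x \<in> {v \<in> Vsymp D. s (\<alpha> v) / \<alpha> v \<in> U}" if "x \<in> {v \<in> Vsymp D. s (\<alpha> v) / \<alpha> v \<in> U}" for x
    using that J_act_Vsymp[OF j, of x] by simp
  show "coset D H (gmat D r (j *\<^sub>v x)) = coset_act D j (coset D H (gmat D r x))"
    if "x \<in> {v \<in> Vsymp D. s (\<alpha> v) / \<alpha> v \<in> U}" for x
    using that J_act_coset[OF j _ H] by simp
  show "\<exists>j'\<in>J_grp D. \<forall>x\<in>{v \<in> Vsymp D. s (\<alpha> v) / \<alpha> v \<in> U}. j *\<^sub>v (j' *\<^sub>v x) = x \<and> j' *\<^sub>v (j *\<^sub>v x) = x"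
    using J_act_inverse[OF j] VsympD(1) by blast
qed

end

context shape_data
begin

lemma coset_image:
  assumes H: "H \<subseteq> shape" "1\<^sub>m (2 * n) \<in> H" and g: "g \<in> carrier (GSp n)"
  shows "coset D shape ` coset D H g = {coset D shape g}"
proof -
  have "g \<in> coset D H g"
    using H(2) GSp_carrier_mat[OF g] by (auto simp: coset_def l_coset_def intro!: bexI[of _ "1\<^sub>m (2 * n)"])
  moreover have "coset D shape x = coset D shape g" if x: "x \<in> coset D H g" for x
  proof -
    obtain h where h: "h \<in> H" "x = g * h" using x by (auto simp: coset_def l_coset_def)
    then have "h \<in> shape" using H by blast
    then show ?thesis using coset_eq_iff[OF g, of x] h g GSp_mult_closed shape_GSp by metis
  qed
  ultimately show ?thesis by blast
qed

lemma shape_subset_CM: "shape \<subseteq> CM"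
  using shape_CM by blast

end

text \<open>Every element of a coset of the smaller group determines the same coset of the larger
  one. Hence the image of a coset under the coset map is a singleton, and \<open>induced\<close> is
  the natural projection.\<close>

lemma shape_square:
  fixes D :: "'a::field gsp_datum"
  assumes S1: "shape_data D r U1 P1 Q1" and S2: "shape_data D r U2 P2 Q2"
    and sub: "U1 \<subseteq> U2" "P1 \<subseteq> P2" "Q1 \<subseteq> Q2"
  shows "acted_square (J_grp D) (*\<^sub>v)
      {v \<in> Vsymp D. frob D (alpha D v) / alpha D v \<in> U1} {v \<in> Vsymp D. frob D (alpha D v) / alpha D v \<in> U2}
      (\<lambda>v. coset D (shape_data.shape D U1 P1 Q1) (gmat D r v))
      (\<lambda>v. coset D (shape_data.shape D U2 P2 Q2) (gmat D r v)) (coset_act D)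
      (induced (coset D (shape_data.shape D U2 P2 Q2)))"
    and "(\<lambda>v. coset D (shape_data.shape D U1 P1 Q1) (gmat D r v)) ` {v \<in> Vsymp D. frob D (alpha D v) / alpha D v \<in> U1}
      = T \<Longrightarrow> descends (coset D (shape_data.shape D U2 P2 Q2)) T"
proof -
  interpret S1: shape_data D r U1 P1 Q1 by (rule S1)
  interpret S2: shape_data D r U2 P2 Q2 by (rule S2)
  have "S1.shape \<subseteq> S2.shape"
    using sub unfolding S1.shape_def S2.shape_def S1.colshape_def S2.colshape_def by blast
  then have img: "coset D S2.shape ` coset D S1.shape (gmat D r v) = {coset D S2.shape (gmat D r v)}"
    if "v \<in> Vsymp D" for v
    using S2.coset_image[OF _ S1.shape_one S1.gmat_GSp[OF that]] by blast
  show "acted_square (J_grp D) (*\<^sub>v)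
      {v \<in> Vsymp D. frob D (alpha D v) / alpha D v \<in> U1} {v \<in> Vsymp D. frob D (alpha D v) / alpha D v \<in> U2}
      (\<lambda>v. coset D S1.shape (gmat D r v)) (\<lambda>v. coset D S2.shape (gmat D r v)) (coset_act D)
      (induced (coset D S2.shape))"
    unfolding acted_square_def acted_square_axioms_def
    using sub(1) img
    by (auto simp: induced_def intro!: S1.acted_coset_map S1.shape_subset_CM S2.shape_subset_CM)
  show "descends (coset D S2.shape) T"
    if "(\<lambda>v. coset D S1.shape (gmat D r v)) ` {v \<in> Vsymp D. frob D (alpha D v) / alpha D v \<in> U1} = T"
    unfolding descends_def that[symmetric] using img by auto
qed

section \<open>The Borel and unipotent groups, and the first diagram\<close>

context gsp_ctx
begin

lemma diag_nonzero:
  fixes g :: "'a mat"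
  assumes g: "g \<in> carrier (GSp n)" "upper_triangular g" and i: "i < 2 * n"
  shows "g $$ (i, i) \<noteq> 0"
proof
  assume z: "g $$ (i, i) = 0"
  have gM: "g \<in> CM" "inv\<^bsub>GSp n\<^esub> g \<in> CM" using g GSp_inv_closed GSp_carrier_mat by blast+
  have "0 \<in> set (diag_mat g)" using z i gM by (auto simp: diag_mat_def image_iff intro!: bexI[of _ i])
  then have "det g = 0" using det_upper_triangular[OF g(2) gM(1)] by (simp add: prod_list_zero_iff)
  moreover have "det (inv\<^bsub>GSp n\<^esub> g) * det g = 1"
    using det_mult[OF gM(2,1)] GSp_inv_left[OF g(1)] by simp
  ultimately show False by simp
qed

lemma shape_data_Borel: "shape_data D 0 (UNIV - {0}) UNIV {0}"
  by unfold_locales auto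

lemma shape_data_Unip: "shape_data D 0 {1} UNIV {0}"
  by unfold_locales auto

lemma shape_Borel: "shape_data.shape D (UNIV - {0}) UNIV {0} = Borel n"
proof -
  interpret S: shape_data D 0 "UNIV - {0}" UNIV "{0}" by (rule shape_data_Borel)
  show ?thesis
  proof (intro equalityI subsetI)
    show "g \<in> Borel n" if "g \<in> S.shape" for g
      using that S.shape_entries(3)[OF that] S.shape_CM[OF that]
      by (auto simp: Borel_def S.shape_GSp intro!: upper_triangularI)
    show "g \<in> S.shape" if "g \<in> Borel n" for g
    proof (rule S.shape_entriesI)
      show g: "g \<in> carrier (GSp n)" using that by (simp add: Borel_def)
      have ut: "upper_triangular g" using that by (simp add: Borel_def)
      show "g $$ (i, i) \<in> UNIV - {0}" if "i < 2 * n" for i using diag_nonzero[OF g ut that] by simp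
      show "g $$ (i, j) \<in> {0}" if "j < i" "i < 2 * n" for i j
        using ut that GSp_carrier_mat[OF g] by auto
    qed auto
  qed
qed

lemma shape_Unip: "shape_data.shape D {1} UNIV {0} = Unip n"
proof -
  interpret S: shape_data D 0 "{1}" UNIV "{0}" by (rule shape_data_Unip)
  show ?thesis
  proof (intro equalityI subsetI)
    show "g \<in> Unip n" if "g \<in> S.shape" for g
      using that S.shape_entries(1,3)[OF that] S.shape_CM[OF that]
      by (auto simp: Unip_def Borel_def S.shape_GSp intro!: upper_triangularI)
    show "g \<in> S.shape" if "g \<in> Unip n" for g
    proof (rule S.shape_entriesI)
      show g: "g \<in> carrier (GSp n)" using that by (simp add: Borel_def Unip_def)
      have ut: "upper_triangular g" using that by (simp add: Borel_def Unip_def)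
      show "g $$ (i, i) \<in> {1}" if "i < 2 * n" for i using \<open>g \<in> Unip n\<close> that by (simp add: Unip_def)
      show "g $$ (i, j) \<in> {0}" if "j < i" "i < 2 * n" for i j
        using ut that GSp_carrier_mat[OF g] by auto
    qed auto
  qed
qed

end

context shape_data
begin

text \<open>With Q zero the first unit vector is already isotropic: its pairing with an iterate of
  \<open>Phi\<close> is the last coordinate of a column of shape i < n. The condition on
  \<open>tcoef\<close> is empty because P is everything.\<close>

lemma DL_image_upper:
  assumes "P = UNIV" "Q = {0}"
  shows "(\<lambda>v. coset D shape (gmat D r v)) ` {v \<in> Vsymp D. s (\<alpha> v) / \<alpha> v \<in> U} = DL_set D shape (wmat D r)"
proof (rule gmat_DL_image)
  show "tcoef r v l \<in> P" for v l using assms by simp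
  fix \<beta> assume \<beta>: "\<beta> \<in> shape"
  have e0: "colshape 0 (e 0)" using n_pos by (auto simp: colshape_def U_one Q_0)
  have "ip (e 0) ((Phi \<beta> ^^ i) (e 0)) = 0" if i: "1 \<le> i" "i < n" for i
  proof -
    note sh = Phi_pow_colshape[OF \<beta> e0 i(2)]
    have "(Phi \<beta> ^^ i) (e 0) $ (2 * n - 1) \<in> Q" by (rule colshapeD(4)[OF sh]) (use i in auto)
    then show ?thesis using assms(2) colshapeD(1)[OF sh] n_pos by (simp add: sform_unit_left)
  qed
  then show "\<exists>x. colshape 0 x \<and> (\<forall>i. 1 \<le> i \<longrightarrow> i < n \<longrightarrow> ip x ((Phi \<beta> ^^ i) x) = 0)" using e0 by blast
qed

text \<open>The first column of \<open>gmat\<close> is v, and the first column of an upper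
  triangular h is a multiple of the first unit vector. This gives injectivity for U and the scalar
  relation for B.\<close>

lemma coset_eq_first_col:
  assumes Q: "Q = {0}" and v: "v1 \<in> Vsymp D" "v2 \<in> Vsymp D"
    and eq: "coset D shape (gmat D r v1) = coset D shape (gmat D r v2)"
  obtains c where "c \<in> U" "v2 = c \<cdot>\<^sub>v v1"
proof -
  obtain h where h: "h \<in> shape" "gmat D r v2 = gmat D r v1 * h"
    using eq coset_eq_iff[OF gmat_GSp[OF v(1)] gmat_GSp[OF v(2)]] by blast
  have sh: "colshape 0 (col h 0)" using h n_pos by (simp add: shape_def)
  have col: "col h 0 = h $$ (0, 0) \<cdot>\<^sub>v e 0"
  proof (rule eq_vecI)
    fix i assume "i < dim_vec (h $$ (0, 0) \<cdot>\<^sub>v e 0)"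
    then have i: "i < 2 * n" by simp
    show "col h 0 $ i = (h $$ (0, 0) \<cdot>\<^sub>v e 0) $ i"
      using colshapeD(4)[OF sh, of i] Q i shape_CM[OF h(1)] by (cases "i = 0") auto
  qed (use shape_CM[OF h(1)] in auto)
  have g0: "gcol r u 0 = u" if "u \<in> CV" for u using that n_pos by (simp add: gcol_def)
  have "v2 = col (gmat D r v2) 0" using n_pos VsympD[OF v(2)] by (simp add: gmat_col g0)
  also have "\<dots> = gmat D r v1 *\<^sub>v col h 0"
    unfolding h(2) by (rule col_mult2[OF gmat_carrier shape_CM[OF h(1)]]) (use n_pos in simp)
  also have "\<dots> = h $$ (0, 0) \<cdot>\<^sub>v (gmat D r v1 *\<^sub>v e 0)"
    unfolding col by (rule mult_mat_vec[OF gmat_carrier]) simp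
  also have "gmat D r v1 *\<^sub>v e 0 = v1"
    using n_pos VsympD[OF v(1)] by (simp add: col_eq_mult_unit[OF gmat_carrier] gmat_col g0)
  finally have "v2 = h $$ (0, 0) \<cdot>\<^sub>v v1" .
  moreover have "h $$ (0, 0) \<in> U" using shape_entries(1)[OF h(1), of 0 0] n_pos by simp
  ultimately show ?thesis by (rule that[rotated])
qed

text \<open>The two matrices differ on the right by a diagonal matrix, column j being rescaled by
  the scalar from \<open>gcol_rescale\<close>.\<close>

lemma coset_smult:
  assumes U: "U = UNIV - {0}" and v: "v \<in> Vsymp D" and c: "c \<noteq> 0"
  shows "coset D shape (gmat D r v) = coset D shape (gmat D r (c \<cdot>\<^sub>v v))"
proof -
  let ?g = "gmat D r v" and ?g' = "gmat D r (c \<cdot>\<^sub>v v)"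
  have v': "c \<cdot>\<^sub>v v \<in> Vsymp D" by (rule smult_Vsymp[OF v c])
  note G = gmat_GSp[OF v, of r] gmat_GSp[OF v', of r]
  let ?h = "inv\<^bsub>GSp n\<^esub> ?g * ?g'"
  have ig: "inv\<^bsub>GSp n\<^esub> ?g \<in> CM" using GSp_inv_closed[OF G(1)] GSp_carrier_mat by blast
  have "?h \<in> shape"
    unfolding shape_def
  proof (intro CollectI conjI allI impI)
    show "?h \<in> carrier (GSp n)" by (intro GSp_mult_closed GSp_inv_closed G)
    fix j assume j: "j < 2 * n"
    obtain a where a: "a \<noteq> 0" "gcol r (c \<cdot>\<^sub>v v) j = a \<cdot>\<^sub>v gcol r v j" using gcol_rescale[OF v c] by blast
    have "col ?h j = inv\<^bsub>GSp n\<^esub> ?g *\<^sub>v col ?g' j" by (rule col_mult2[OF ig gmat_carrier j])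
    also have "col ?g' j = ?g *\<^sub>v (a \<cdot>\<^sub>v e j)"
      using j VsympD[OF v] a(2)
      by (simp add: gmat_col mult_mat_vec[OF gmat_carrier] col_eq_mult_unit[OF gmat_carrier])
    also have "inv\<^bsub>GSp n\<^esub> ?g *\<^sub>v \<dots> = a \<cdot>\<^sub>v e j"
      using GSp_inv_left[OF G(1)] by (simp flip: assoc_mult_mat_vec[OF ig gmat_carrier])
    finally have col: "col ?h j = a \<cdot>\<^sub>v e j" .
    have "a \<in> U" using a(1) by (simp add: U)
    then show "colshape j (col ?h j)" unfolding col using j by (auto simp: colshape_def P_0 Q_0)
  qed
  moreover have "?g' = ?g * ?h"
  proof -
    have "?g * ?h = (?g * inv\<^bsub>GSp n\<^esub> ?g) * ?g'" using ig by (simp add: CM_assoc)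
    then show ?thesis using GSp_inv_right[OF G(1)] by simp
  qed
  ultimately show ?thesis using coset_eq_iff[OF G] by blast
qed

end

context gsp_ctx
begin

lemma Vsymp_rat_eq: "Vsymp_rat D = {v \<in> Vsymp D. s (\<alpha> v) / \<alpha> v \<in> {1}}"
  using VsympD(4) s_fixed_base by (auto simp: Vsymp_rat_def)

lemma Vsymp_all_eq: "Vsymp D = {v \<in> Vsymp D. s (\<alpha> v) / \<alpha> v \<in> UNIV - {0}}"
  using VsympD(4) by auto

text \<open>The fibre relation of the lower map is identified with proportionality: one direction
  compares first columns, the other rescales. For U the only admissible scalar is 1, so the upper
  map is injective on vectors.\<close>

lemma semi_infinite_diagram:
  "equiv (Vsymp D) (scalar_rel D) \<and>
      descends (\<lambda>v. coset D (B_of D) (gmat D 0 v)) (Vsymp D // scalar_rel D) \<and>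
      descends (coset D (B_of D)) (DL_set D (U_of D) (wmat D 0)) \<and>
      equivariant_bij_square (J_grp D)
        (*\<^sub>v) (Vsymp_rat D)
        (coset_act D) (DL_set D (U_of D) (wmat D 0))
        class_act (Vsymp D // scalar_rel D)
        (coset_act D) (DL_set D (B_of D) (wmat D 0))
        (\<lambda>v. coset D (U_of D) (gmat D 0 v))
        (\<lambda>v. scalar_rel D `` {v})
        (induced (coset D (B_of D)))
        (induced (\<lambda>v. coset D (B_of D) (gmat D 0 v)))"
proof -
  interpret B: shape_data D 0 "UNIV - {0}" UNIV "{0}" by (rule shape_data_Borel)
  interpret N: shape_data D 0 "{1}" UNIV "{0}" by (rule shape_data_Unip)
  note sq = shape_square[OF shape_data_Unip shape_data_Borel, unfolded shape_Borel shape_Unip,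
      folded Vsymp_rat_eq Vsymp_all_eq]
  interpret A: acted_square "J_grp D" "(*\<^sub>v)" "Vsymp_rat D" "Vsymp D"
    "\<lambda>v. coset D (Unip n) (gmat D 0 v)" "\<lambda>v. coset D (Borel n) (gmat D 0 v)" "coset_act D"
    "induced (coset D (Borel n))"
    by (rule sq) auto
  have imU: "(\<lambda>v. coset D (Unip n) (gmat D 0 v)) ` Vsymp_rat D = DL_set D (Unip n) (wmat D 0)"
    using N.DL_image_upper[OF refl refl] by (simp only: shape_Unip Vsymp_rat_eq[symmetric])
  have imB: "(\<lambda>v. coset D (Borel n) (gmat D 0 v)) ` Vsymp D = DL_set D (Borel n) (wmat D 0)"
    using B.DL_image_upper[OF refl refl] by (simp only: shape_Borel Vsymp_all_eq[symmetric])
  have R: "A.f2.R = scalar_rel D"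
  proof (intro equalityI subrelI)
    fix v1 v2 assume "(v1, v2) \<in> A.f2.R"
    then have v: "v1 \<in> Vsymp D" "v2 \<in> Vsymp D" "coset D B.shape (gmat D 0 v1) = coset D B.shape (gmat D 0 v2)"
      by (auto simp: A.f2.R_def shape_Borel)
    obtain c where "c \<in> UNIV - {0}" "v2 = c \<cdot>\<^sub>v v1" by (rule B.coset_eq_first_col[OF refl v])
    then show "(v1, v2) \<in> scalar_rel D" using v by (auto simp: scalar_rel_def)
  next
    fix v1 v2 assume "(v1, v2) \<in> scalar_rel D"
    then obtain c where "v1 \<in> Vsymp D" "c \<noteq> 0" "v2 = c \<cdot>\<^sub>v v1" by (auto simp: scalar_rel_def)
    then show "(v1, v2) \<in> A.f2.R"
      using B.coset_smult[OF refl] smult_Vsymp by (auto simp: A.f2.R_def shape_Borel)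
  qed
  have inj: "inj_on (\<lambda>v. coset D (Unip n) (gmat D 0 v)) (Vsymp_rat D)"
  proof (rule inj_onI)
    fix v1 v2 assume v: "v1 \<in> Vsymp_rat D" "v2 \<in> Vsymp_rat D"
      and eq: "coset D (Unip n) (gmat D 0 v1) = coset D (Unip n) (gmat D 0 v2)"
    then have V: "v1 \<in> Vsymp D" "v2 \<in> Vsymp D" by (auto simp: Vsymp_rat_def)
    obtain c where "c \<in> {1}" "v2 = c \<cdot>\<^sub>v v1"
      by (rule N.coset_eq_first_col[OF refl V]) (use eq in \<open>auto simp: shape_Unip\<close>)
    then show "v1 = v2" by simp
  qed
  have act: "class_act = (\<lambda>j C. (*\<^sub>v) j ` C)" by (intro ext) (simp add: class_act_def)
  show ?thesis
    using A.f2.equiv_R A.f2.descends_R sq(2)[OF _ _ _ imU] A.square_inj[OF inj]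
    by (simp add: R imU imB act)
qed

section \<open>The groups defined by congruences, and the second diagram\<close>

lemma shape_val_I:
  assumes "m + 1 \<le> r + k"
  shows "shape_val D r {x. x \<noteq> 0 \<and> w x = 0} (ppow w (int m + 1)) (ppow w (int m)) m"
proof -
  have u0: "x \<in> ppow w 0" if "x \<noteq> 0" "w x = 0" for x using that by (simp add: ppow_def)
  have eps: "\<pi> ^ (2 * r + k) \<in> ppow w 1" using pi assms by (auto simp: ppow_def w_power)
  have dom: "x + y \<noteq> 0 \<and> w (x + y) = 0" if "x \<noteq> 0" "w x = 0" "y \<in> ppow w (int m + 1)" for x y
    using w_add_dominant[of x y] that ppow_mono[OF that(3), of 1] by auto
  have dom': "u + x * y \<noteq> 0 \<and> w (u + x * y) = 0"
    if "u \<noteq> 0" "w u = 0" "x \<in> ppow w (int m + 1)" "y \<in> ppow w (int m)" for u x y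
    by (rule dom[OF that(1,2) ppow_mult_le[OF that(3,4)]]) simp
  show ?thesis
    by unfold_locales
      (use assms dom dom' in \<open>auto simp: w_mult w_inverse w_s intro: ppow_add ppow_mult_le[OF u0] ppow_mult_le
        ppow_mult_le[OF eps] elim: ppow_mono\<close>)
qed

lemma shape_val_Idot:
  assumes "m + 1 \<le> r + k"
  shows "shape_val D r {x. x - 1 \<in> ppow w (int m + 1)} (ppow w (int m + 1)) (ppow w (int m)) m"
proof -
  let ?p = "ppow w (int m + 1)"
  have unit: "x \<noteq> 0 \<and> w x = 0" if "x - 1 \<in> ?p" for x
    using w_add_dominant[of 1 "x - 1"] ppow_mono[OF that, of 1] by simp
  have u0: "x \<in> ppow w 0" if "x - 1 \<in> ?p" for x using unit[OF that] by (simp add: ppow_def)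
  have eps: "\<pi> ^ (2 * r + k) \<in> ppow w 1" using pi assms by (auto simp: ppow_def w_power)
  have mult: "x * y - 1 \<in> ?p" if "x - 1 \<in> ?p" "y - 1 \<in> ?p" for x y
  proof -
    have "x * y - 1 = (x - 1) * y + (y - 1)" by (simp add: algebra_simps)
    then show ?thesis using ppow_add[OF ppow_mult_le[OF that(1) u0[OF that(2)]] that(2)]
      by (simp only: add_0_right order_refl)
  qed
  have inv: "inverse x - 1 \<in> ?p" if "x - 1 \<in> ?p" for x
  proof -
    have "inverse x \<in> ppow w 0" using unit[OF that] by (simp add: ppow_def w_inverse)
    from ppow_mult_le[OF that this] have "(x - 1) * inverse x \<in> ?p" by simp
    moreover have "inverse x - 1 = - ((x - 1) * inverse x)" using unit[OF that] by (simp add: field_simps)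
    ultimately show ?thesis by (simp only: ppow_uminus)
  qed
  have ss: "s x - 1 \<in> ?p \<longleftrightarrow> x - 1 \<in> ?p" for x
    using ppow_s[of "x - 1" "int m + 1"] by (simp add: s.hom_minus)
  have add: "u + x - 1 \<in> ?p" if "u - 1 \<in> ?p" "x \<in> ?p" for u x
    using ppow_add[OF that] by (simp add: algebra_simps)
  have add': "u + x * y - 1 \<in> ?p" if "u - 1 \<in> ?p" "x \<in> ?p" "y \<in> ppow w (int m)" for u x y
    by (rule add[OF that(1) ppow_mult_le[OF that(2,3)]]) simp
  have nz: "- 1 \<notin> ?p" by (simp add: ppow_one)
  show ?thesis
    by unfold_locales
      (use assms unit mult inv add add' nz in \<open>auto simp: ss intro: ppow_add ppow_mult_le[OF u0] ppow_mult_le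
        ppow_mult_le[OF eps] elim: ppow_mono\<close>)
qed

lemma shape_I:
  assumes "m + 1 \<le> r + k"
  shows "shape_data.shape D {x. x \<noteq> 0 \<and> w x = 0} (ppow w (int m + 1)) (ppow w (int m)) = I_grp n w m"
proof -
  interpret S: shape_val D r "{x. x \<noteq> 0 \<and> w x = 0}" "ppow w (int m + 1)" "ppow w (int m)" m
    by (rule shape_val_I[OF assms])
  show ?thesis
    using S.shape_entries S.shape_GSp by (force simp: I_grp_def intro!: S.shape_entriesI)
qed

lemma shape_Idot:
  assumes "m + 1 \<le> r + k"
  shows "shape_data.shape D {x. x - 1 \<in> ppow w (int m + 1)} (ppow w (int m + 1)) (ppow w (int m)) = Idot_grp n w m"
proof -
  interpret S: shape_val D r "{x. x - 1 \<in> ppow w (int m + 1)}" "ppow w (int m + 1)" "ppow w (int m)" m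
    by (rule shape_val_Idot[OF assms])
  show ?thesis
    using S.shape_entries S.shape_GSp by (force simp: Idot_grp_def intro!: S.shape_entriesI)
qed

lemma Vsymp_cong_eq: "Vsymp_cong D m = {v \<in> Vsymp D. s (\<alpha> v) / \<alpha> v \<in> {x. x - 1 \<in> ppow w (int m + 1)}}"
  by (auto simp: Vsymp_cong_def)

text \<open>The Frobenius preserves valuations, so the ratio is a unit for every v and the source
  for I^m is the whole symplectic locus.\<close>

lemma Vsymp_unit_eq: "Vsymp D = {v \<in> Vsymp D. s (\<alpha> v) / \<alpha> v \<in> {x. x \<noteq> 0 \<and> w x = 0}}"
  using VsympD(4) by (auto simp: w_divide w_s)

text \<open>The relations are by definition equality of cosets, that is, the fibre relations of the
  maps. What remains is the computation of the two images, done in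
  \<open>gmat_DL_image_val\<close>.\<close>

lemma affine_diagram:
  assumes mrk: "m + 1 \<le> r + k"
  shows "equiv (Vsymp D) (sim_rel D m r) \<and>
      equiv (Vsymp_cong D m) (restrict_rel (simdot_rel D m r) (Vsymp_cong D m)) \<and>
      descends (\<lambda>v. coset D (I_of D m) (gmat D r v)) (Vsymp D // sim_rel D m r) \<and>
      descends (\<lambda>v. coset D (Idot_of D m) (gmat D r v))
        (Vsymp_cong D m // restrict_rel (simdot_rel D m r) (Vsymp_cong D m)) \<and>
      descends (\<lambda>v. sim_rel D m r `` {v})
        (Vsymp_cong D m // restrict_rel (simdot_rel D m r) (Vsymp_cong D m)) \<and>
      descends (coset D (I_of D m)) (DL_set D (Idot_of D m) (wmat D r)) \<and>
      equivariant_bij_square (J_grp D)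
        class_act (Vsymp_cong D m // restrict_rel (simdot_rel D m r) (Vsymp_cong D m))
        (coset_act D) (DL_set D (Idot_of D m) (wmat D r))
        class_act (Vsymp D // sim_rel D m r)
        (coset_act D) (DL_set D (I_of D m) (wmat D r))
        (induced (\<lambda>v. coset D (Idot_of D m) (gmat D r v)))
        (induced (\<lambda>v. sim_rel D m r `` {v}))
        (induced (coset D (I_of D m)))
        (induced (\<lambda>v. coset D (I_of D m) (gmat D r v)))"
proof -
  note SI = shape_val_I[OF mrk] and SD = shape_val_Idot[OF mrk]
  interpret SI: shape_val D r "{x. x \<noteq> 0 \<and> w x = 0}" "ppow w (int m + 1)" "ppow w (int m)" m
    by (rule SI)
  interpret SD: shape_val D r "{x. x - 1 \<in> ppow w (int m + 1)}" "ppow w (int m + 1)" "ppow w (int m)" m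
    by (rule SD)
  have subU: "{x. x - 1 \<in> ppow w (int m + 1)} \<subseteq> {x. x \<noteq> 0 \<and> w x = 0}"
    using SD.U_nonzero SD.U_unit by blast
  note sq = shape_square[OF SD.shape_data_axioms SI.shape_data_axioms subU order_refl order_refl,
      unfolded shape_I[OF mrk] shape_Idot[OF mrk], folded Vsymp_cong_eq Vsymp_unit_eq]
  interpret A: acted_square "J_grp D" "(*\<^sub>v)" "Vsymp_cong D m" "Vsymp D"
    "\<lambda>v. coset D (Idot_grp n w m) (gmat D r v)" "\<lambda>v. coset D (I_grp n w m) (gmat D r v)" "coset_act D"
    "induced (coset D (I_grp n w m))"
    by (rule sq(1))
  have imD: "(\<lambda>v. coset D (Idot_grp n w m) (gmat D r v)) ` Vsymp_cong D m = DL_set D (Idot_grp n w m) (wmat D r)"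
    using SD.gmat_DL_image_val by (simp only: shape_Idot[OF mrk] Vsymp_cong_eq[symmetric])
  have imI: "(\<lambda>v. coset D (I_grp n w m) (gmat D r v)) ` Vsymp D = DL_set D (I_grp n w m) (wmat D r)"
    using SI.gmat_DL_image_val by (simp only: shape_I[OF mrk] Vsymp_unit_eq[symmetric])
  have R2: "A.f2.R = sim_rel D m r" by (auto simp: A.f2.R_def sim_rel_def)
  have R1: "A.f1.R = restrict_rel (simdot_rel D m r) (Vsymp_cong D m)"
  proof -
    have "Vsymp_cong D m \<subseteq> Vsymp D" by (auto simp: Vsymp_cong_def)
    then show ?thesis unfolding A.f1.R_def simdot_rel_def restrict_rel_def by blast
  qed
  have act: "class_act = (\<lambda>j C. (*\<^sub>v) j ` C)" by (intro ext) (simp add: class_act_def)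
  show ?thesis
    using A.f2.equiv_R A.f1.equiv_R A.f2.descends_R A.f1.descends_R A.descends_ver sq(2)[OF imD] A.square_quotient
    by (simp only: R1 R2 imD imI act)
qed

end

theorem theorem1p0p1:
  fixes D :: "'a::field gsp_datum" and r m :: nat
  assumes "gsp_setting D" and "m + 1 \<le> r + kap D"
  shows
    "(equiv (Vsymp D) (scalar_rel D) \<and>
      descends (\<lambda>v. coset D (B_of D) (gmat D 0 v)) (Vsymp D // scalar_rel D) \<and>
      descends (coset D (B_of D)) (DL_set D (U_of D) (wmat D 0)) \<and>
      equivariant_bij_square (J_grp D)
        (*\<^sub>v) (Vsymp_rat D)
        (coset_act D) (DL_set D (U_of D) (wmat D 0))
        class_act (Vsymp D // scalar_rel D)
        (coset_act D) (DL_set D (B_of D) (wmat D 0))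
        (\<lambda>v. coset D (U_of D) (gmat D 0 v))
        (\<lambda>v. scalar_rel D `` {v})
        (induced (coset D (B_of D)))
        (induced (\<lambda>v. coset D (B_of D) (gmat D 0 v))))
     \<and>
     (equiv (Vsymp D) (sim_rel D m r) \<and>
      equiv (Vsymp_cong D m) (restrict_rel (simdot_rel D m r) (Vsymp_cong D m)) \<and>
      descends (\<lambda>v. coset D (I_of D m) (gmat D r v)) (Vsymp D // sim_rel D m r) \<and>
      descends (\<lambda>v. coset D (Idot_of D m) (gmat D r v))
        (Vsymp_cong D m // restrict_rel (simdot_rel D m r) (Vsymp_cong D m)) \<and>
      descends (\<lambda>v. sim_rel D m r `` {v})
        (Vsymp_cong D m // restrict_rel (simdot_rel D m r) (Vsymp_cong D m)) \<and>
      descends (coset D (I_of D m)) (DL_set D (Idot_of D m) (wmat D r)) \<and>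
      equivariant_bij_square (J_grp D)
        class_act (Vsymp_cong D m // restrict_rel (simdot_rel D m r) (Vsymp_cong D m))
        (coset_act D) (DL_set D (Idot_of D m) (wmat D r))
        class_act (Vsymp D // sim_rel D m r)
        (coset_act D) (DL_set D (I_of D m) (wmat D r))
        (induced (\<lambda>v. coset D (Idot_of D m) (gmat D r v)))
        (induced (\<lambda>v. sim_rel D m r `` {v}))
        (induced (coset D (I_of D m)))
        (induced (\<lambda>v. coset D (I_of D m) (gmat D r v))))"
proof -
  interpret gsp_ctx D by unfold_locales (rule assms(1))
  show ?thesis
    by (rule conjI[OF semi_infinite_diagram affine_diagram[OF assms(2)]])
qed

end
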